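(* Let $k$ be a commutative ring. The category $\mathsf{NdI}_k$ of non-degenerate idempotent $k$-projective algebras, with morphisms the non-degenerate idempotent ($k$-projective) extensions, is a monoidal category (with tensor product $\otimes=\otimes_k$ and unit object $k$).
   Context: Conventions. All modules are $k$-modules, linear means $k$-linear, $\otimes=\otimes_k$. An algebra is a $k$-module $A$ with an associative linear multiplication (no unit assumed). $A$ is idempotent if $A=A^2$ (finite sums of products); non-degenerate if for every $a\in A$: $a=0$ whenever $ab=0$ for all $b\in A$, and $a=0$ whenever $ba=0$ for all $b\in A$; $k$-projective if projective as a $k$-module. A right $A$-module $M$ is idempotent if $M=MA$, non-degenerate if $m=0$ whenever $ma=0$ for all $a\in A$; similarly for left modules; a bimodule has such a property if it has it on both sides. An algebra $A$ is an extension of an algebra $B$ if $A$ is a $B$-bimodule whose multiplication is $B$-bilinear and $B$-balanced, i.e. $(a\cdot b)a'=a(b\cdot a')$. The extension is non-degenerate (idempotent, $k$-projective) if $A$ is so as a $B$-bimodule. The data of $\mathsf{NdI}_k$. Objects are the non-degenerate idempotent $k$-projective algebras. A morphism from $B$ to $A$ is a structure of non-degenerate idempotent ($k$-projective) $B$-extension on the algebra $A$. If $f$ is a morphism from $B$ to $A$ and $g$ a morphism from $A$ to $R$, then $g\circ f$ is the $B$-extension structure on $R$ with actions $r\cdot b=\sum_i r_i\cdot(a_i\cdot b)$ for $r=\sum_i r_i\cdot a_i\in RA$ and $b\cdot r=\sum_j(b\cdot a'_j)\cdot r'_j$ for $r=\sum_j a'_j\cdot r'_j\in AR$. The identity of $A$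 is the canonical extension of $A$ by itself. The tensor product of objects $A,B$ is the algebra $A\otimes B$ with $(a\otimes b)(a'\otimes b')=aa'\otimes bb'$; the tensor product of morphisms $f$ from $B$ to $A$ and $f'$ from $B'$ to $A'$ is the $B\otimes B'$-extension $A\otimes A'$ with the componentwise actions $(b\otimes b')\cdot(a\otimes a')=b\cdot a\otimes b'\cdot a'$, $(a\otimes a')\cdot(b\otimes b')=a\cdot b\otimes a'\cdot b'$. *)

theory Defs
  imports "HOL-Algebra.Algebra"
begin

section \<open>Categories and monoidal categories\<close>

locale category =
  fixes Ob :: "'o set"
    and Hom :: "'o \<Rightarrow> 'o \<Rightarrow> 'm set"
    and Comp :: "'m \<Rightarrow> 'm \<Rightarrow> 'm"  (infixr "\<bullet>" 60)
    and Id :: "'o \<Rightarrow> 'm"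
  assumes Hom_disjoint: "\<lbrakk>A \<in> Ob; B \<in> Ob; A' \<in> Ob; B' \<in> Ob; f \<in> Hom A B; f \<in> Hom A' B'\<rbrakk>
      \<Longrightarrow> A = A' \<and> B = B'"
    and Id_in_Hom: "A \<in> Ob \<Longrightarrow> Id A \<in> Hom A A"
    and Comp_in_Hom: "\<lbrakk>A \<in> Ob; B \<in> Ob; C \<in> Ob; f \<in> Hom A B; g \<in> Hom B C\<rbrakk> \<Longrightarrow> g \<bullet> f \<in> Hom A C"
    and Comp_assoc: "\<lbrakk>A \<in> Ob; B \<in> Ob; C \<in> Ob; D \<in> Ob; f \<in> Hom A B; g \<in> Hom B C; h \<in> Hom C D\<rbrakk>
      \<Longrightarrow> (h \<bullet> g) \<bullet> f = h \<bullet> (g \<bullet> f)"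
    and Comp_Id_left: "\<lbrakk>A \<in> Ob; B \<in> Ob; f \<in> Hom A B\<rbrakk> \<Longrightarrow> Id B \<bullet> f = f"
    and Comp_Id_right: "\<lbrakk>A \<in> Ob; B \<in> Ob; f \<in> Hom A B\<rbrakk> \<Longrightarrow> f \<bullet> Id A = f"
begin

definition iso_in :: "'o \<Rightarrow> 'o \<Rightarrow> 'm \<Rightarrow> bool" where
  "iso_in A B f \<longleftrightarrow> f \<in> Hom A B \<and> (\<exists>g \<in> Hom B A. g \<bullet> f = Id A \<and> f \<bullet> g = Id B)"

end

locale monoidal_category = category Ob Hom Comp Id
  for Ob :: "'o set" and Hom :: "'o \<Rightarrow> 'o \<Rightarrow> 'm set"
    and Comp :: "'m \<Rightarrow> 'm \<Rightarrow> 'm"  (infixr "\<bullet>" 60) and Id :: "'o \<Rightarrow> 'm" +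
  fixes TOb :: "'o \<Rightarrow> 'o \<Rightarrow> 'o"  (infixr "\<boxtimes>" 70)
    and TMor :: "'m \<Rightarrow> 'm \<Rightarrow> 'm"  (infixr "\<boxtimes>\<^sub>m" 70)
    and I :: 'o
    and assoc :: "'o \<Rightarrow> 'o \<Rightarrow> 'o \<Rightarrow> 'm"
    and lunit :: "'o \<Rightarrow> 'm"
    and runit :: "'o \<Rightarrow> 'm"
  assumes I_in_Ob: "I \<in> Ob"
    and TOb_in_Ob: "\<lbrakk>A \<in> Ob; B \<in> Ob\<rbrakk> \<Longrightarrow> A \<boxtimes> B \<in> Ob"
    and TMor_in_Hom: "\<lbrakk>A \<in> Ob; B \<in> Ob; A' \<in> Ob; B' \<in> Ob; f \<in> Hom A B; f' \<in> Hom A' B'\<rbrakk>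
      \<Longrightarrow> f \<boxtimes>\<^sub>m f' \<in> Hom (A \<boxtimes> A') (B \<boxtimes> B')"
    and TMor_Id: "\<lbrakk>A \<in> Ob; B \<in> Ob\<rbrakk> \<Longrightarrow> Id A \<boxtimes>\<^sub>m Id B = Id (A \<boxtimes> B)"
    and interchange: "\<lbrakk>A \<in> Ob; B \<in> Ob; C \<in> Ob; A' \<in> Ob; B' \<in> Ob; C' \<in> Ob;
        f \<in> Hom A B; g \<in> Hom B C; f' \<in> Hom A' B'; g' \<in> Hom B' C'\<rbrakk>
      \<Longrightarrow> (g \<bullet> f) \<boxtimes>\<^sub>m (g' \<bullet> f') = (g \<boxtimes>\<^sub>m g') \<bullet> (f \<boxtimes>\<^sub>m f')"
    and assoc_iso: "\<lbrakk>A \<in> Ob; B \<in> Ob; C \<in> Ob\<rbrakk>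
      \<Longrightarrow> iso_in ((A \<boxtimes> B) \<boxtimes> C) (A \<boxtimes> (B \<boxtimes> C)) (assoc A B C)"
    and lunit_iso: "A \<in> Ob \<Longrightarrow> iso_in (I \<boxtimes> A) A (lunit A)"
    and runit_iso: "A \<in> Ob \<Longrightarrow> iso_in (A \<boxtimes> I) A (runit A)"
    and assoc_natural: "\<lbrakk>A \<in> Ob; B \<in> Ob; C \<in> Ob; A' \<in> Ob; B' \<in> Ob; C' \<in> Ob;
        f \<in> Hom A A'; g \<in> Hom B B'; h \<in> Hom C C'\<rbrakk>
      \<Longrightarrow> assoc A' B' C' \<bullet> ((f \<boxtimes>\<^sub>m g) \<boxtimes>\<^sub>m h) = (f \<boxtimes>\<^sub>m (g \<boxtimes>\<^sub>m h)) \<bullet> assoc A B C"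
    and lunit_natural: "\<lbrakk>A \<in> Ob; B \<in> Ob; f \<in> Hom A B\<rbrakk> \<Longrightarrow> lunit B \<bullet> (Id I \<boxtimes>\<^sub>m f) = f \<bullet> lunit A"
    and runit_natural: "\<lbrakk>A \<in> Ob; B \<in> Ob; f \<in> Hom A B\<rbrakk> \<Longrightarrow> runit B \<bullet> (f \<boxtimes>\<^sub>m Id I) = f \<bullet> runit A"
    and pentagon: "\<lbrakk>A \<in> Ob; B \<in> Ob; C \<in> Ob; D \<in> Ob\<rbrakk>
      \<Longrightarrow> (Id A \<boxtimes>\<^sub>m assoc B C D) \<bullet> (assoc A (B \<boxtimes> C) D \<bullet> (assoc A B C \<boxtimes>\<^sub>m Id D))
          = assoc A B (C \<boxtimes> D) \<bullet> assoc (A \<boxtimes> B) C D"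
    and triangle: "\<lbrakk>A \<in> Ob; B \<in> Ob\<rbrakk>
      \<Longrightarrow> (Id A \<boxtimes>\<^sub>m lunit B) \<bullet> assoc A I B = runit A \<boxtimes>\<^sub>m Id B"

section \<open>Linear maps and projective modules\<close>

definition linear_map ::
    "('k, 'm) ring_scheme \<Rightarrow> ('k, 'a, 'p) module_scheme \<Rightarrow> ('k, 'b, 'q) module_scheme \<Rightarrow> ('a \<Rightarrow> 'b) \<Rightarrow> bool"
  where "linear_map K M N f \<longleftrightarrow>
     f \<in> carrier M \<rightarrow> carrier N \<and>
     (\<forall>x\<in>carrier M. \<forall>y\<in>carrier M. f (x \<oplus>\<^bsub>M\<^esub> y) = f x \<oplus>\<^bsub>N\<^esub> f y) \<and>
     (\<forall>r\<in>carrier K. \<forall>x\<in>carrier M. f (r \<odot>\<^bsub>M\<^esub> x) = r \<odot>\<^bsub>N\<^esub> f x)"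

definition bilinear_map ::
    "('k, 'm) ring_scheme \<Rightarrow> ('k, 'a, 'p) module_scheme \<Rightarrow> ('k, 'b, 'q) module_scheme
      \<Rightarrow> ('k, 'c, 'r) module_scheme \<Rightarrow> ('a \<Rightarrow> 'b \<Rightarrow> 'c) \<Rightarrow> bool"
  where "bilinear_map K M N P h \<longleftrightarrow>
     (\<forall>x\<in>carrier M. linear_map K N P (\<lambda>y. h x y)) \<and>
     (\<forall>y\<in>carrier N. linear_map K M P (\<lambda>x. h x y))"

text \<open>The free module on a set of generators; the fields \<open>mult\<close> and \<open>one\<close> of the record are
  irrelevant for modules.\<close>

definition free_module :: "('k, 'm) ring_scheme \<Rightarrow> 'i set \<Rightarrow> ('k, 'i \<Rightarrow> 'k) module" where
  "free_module K J = \<lparr>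
     carrier = {f \<in> J \<rightarrow>\<^sub>E carrier K. finite {i \<in> J. f i \<noteq> \<zero>\<^bsub>K\<^esub>}},
     monoid.mult = undefined, one = undefined,
     ring.zero = (\<lambda>i\<in>J. \<zero>\<^bsub>K\<^esub>),
     ring.add = (\<lambda>f g. \<lambda>i\<in>J. f i \<oplus>\<^bsub>K\<^esub> g i),
     smult = (\<lambda>r f. \<lambda>i\<in>J. r \<otimes>\<^bsub>K\<^esub> f i)\<rparr>"

text \<open>Projective modules as the direct summands (retracts) of free modules. A retract of some free
  module is also a retract of the free module on its own underlying set, so nothing is lost by
  taking the generators from the type of the elements.\<close>

definition projective_module :: "('k, 'm) ring_scheme \<Rightarrow> ('k, 'a, 'p) module_scheme \<Rightarrow> bool" where
  "projective_module K P \<longleftrightarrow> module K P \<and>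
     (\<exists>(J :: 'a set) s p. linear_map K P (free_module K J) s \<and> linear_map K (free_module K J) P p \<and>
        (\<forall>x\<in>carrier P. p (s x) = x))"

section \<open>Non-unital algebras\<close>

text \<open>The field \<open>one\<close> of the record \<open>A\<close> is never used.\<close>

locale nonunital_algebra = module K A for K (structure) and A (structure) +
  assumes mult_bilinear: "bilinear_map K A A A (\<lambda>a b. a \<otimes>\<^bsub>A\<^esub> b)"
    and mult_assoc: "\<lbrakk>a \<in> carrier A; b \<in> carrier A; c \<in> carrier A\<rbrakk>
      \<Longrightarrow> (a \<otimes>\<^bsub>A\<^esub> b) \<otimes>\<^bsub>A\<^esub> c = a \<otimes>\<^bsub>A\<^esub> (b \<otimes>\<^bsub>A\<^esub> c)"

text \<open>In the next four definitions \<open>act\<close> is a right action of \<open>A\<close> on \<open>M\<close>,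
  respectively a left action; \<open>M = MA\<close> is read with finite sums of products.\<close>

definition right_idempotent ::
    "('k, 'b, 'q) module_scheme \<Rightarrow> ('k, 'a, 'p) module_scheme \<Rightarrow> ('b \<Rightarrow> 'a \<Rightarrow> 'b) \<Rightarrow> bool"
  where "right_idempotent M A act \<longleftrightarrow>
    (\<forall>m\<in>carrier M. \<exists>(n::nat). \<exists>x\<in>{..<n} \<rightarrow> carrier M. \<exists>y\<in>{..<n} \<rightarrow> carrier A.
        m = (\<Oplus>\<^bsub>M\<^esub>i\<in>{..<n}. act (x i) (y i)))"

definition left_idempotent ::
    "('k, 'b, 'q) module_scheme \<Rightarrow> ('k, 'a, 'p) module_scheme \<Rightarrow> ('a \<Rightarrow> 'b \<Rightarrow> 'b) \<Rightarrow> bool"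
  where "left_idempotent M A act \<longleftrightarrow>
    (\<forall>m\<in>carrier M. \<exists>(n::nat). \<exists>x\<in>{..<n} \<rightarrow> carrier M. \<exists>y\<in>{..<n} \<rightarrow> carrier A.
        m = (\<Oplus>\<^bsub>M\<^esub>i\<in>{..<n}. act (y i) (x i)))"

definition right_nondegenerate ::
    "('k, 'b, 'q) module_scheme \<Rightarrow> ('k, 'a, 'p) module_scheme \<Rightarrow> ('b \<Rightarrow> 'a \<Rightarrow> 'b) \<Rightarrow> bool"
  where "right_nondegenerate M A act \<longleftrightarrow>
    (\<forall>m\<in>carrier M. (\<forall>a\<in>carrier A. act m a = \<zero>\<^bsub>M\<^esub>) \<longrightarrow> m = \<zero>\<^bsub>M\<^esub>)"

definition left_nondegenerate ::
    "('k, 'b, 'q) module_scheme \<Rightarrow> ('k, 'a, 'p) module_scheme \<Rightarrow> ('a \<Rightarrow> 'b \<Rightarrow> 'b) \<Rightarrow> bool"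
  where "left_nondegenerate M A act \<longleftrightarrow>
    (\<forall>m\<in>carrier M. (\<forall>a\<in>carrier A. act a m = \<zero>\<^bsub>M\<^esub>) \<longrightarrow> m = \<zero>\<^bsub>M\<^esub>)"

definition idempotent_algebra :: "('k, 'a, 'p) module_scheme \<Rightarrow> bool" where
  "idempotent_algebra A \<longleftrightarrow> right_idempotent A A (\<lambda>a b. a \<otimes>\<^bsub>A\<^esub> b)"

definition nondegenerate_algebra :: "('k, 'a, 'p) module_scheme \<Rightarrow> bool" where
  "nondegenerate_algebra A \<longleftrightarrow>
     right_nondegenerate A A (\<lambda>a b. a \<otimes>\<^bsub>A\<^esub> b) \<and> left_nondegenerate A A (\<lambda>b a. b \<otimes>\<^bsub>A\<^esub> a)"

section \<open>Extensions\<close>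

text \<open>An extension structure of \<open>src\<close> on the algebra \<open>tgt\<close>: \<open>lact b a\<close> is $b \cdot a$ and
  \<open>ract a b\<close> is $a \cdot b$, for $b$ in \<open>src\<close> and $a$ in \<open>tgt\<close>.\<close>

record ('k, 'u) extension =
  src :: "('k, 'u) module"
  tgt :: "('k, 'u) module"
  lact :: "'u \<Rightarrow> 'u \<Rightarrow> 'u"
  ract :: "'u \<Rightarrow> 'u \<Rightarrow> 'u"

text \<open>The actions are required to be extensional (\<open>undefined\<close> off the carriers), so that equality of
  records is equality of extension structures.\<close>

definition is_extension :: "('k, 'm) ring_scheme \<Rightarrow> ('k, 'u) extension \<Rightarrow> bool" where
  "is_extension K f \<longleftrightarrow>
    (let B = src f; A = tgt f; l = lact f; r = ract f in
      l \<in> carrier B \<rightarrow>\<^sub>E (carrier A \<rightarrow>\<^sub>E carrier A) \<and>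
      r \<in> carrier A \<rightarrow>\<^sub>E (carrier B \<rightarrow>\<^sub>E carrier A) \<and>
      bilinear_map K B A A l \<and>
      bilinear_map K A B A r \<and>
      (\<forall>b\<in>carrier B. \<forall>b'\<in>carrier B. \<forall>a\<in>carrier A.
         l (b \<otimes>\<^bsub>B\<^esub> b') a = l b (l b' a) \<and>
         r a (b \<otimes>\<^bsub>B\<^esub> b') = r (r a b) b' \<and>
         r (l b a) b' = l b (r a b')) \<and>
      (\<forall>b\<in>carrier B. \<forall>a\<in>carrier A. \<forall>a'\<in>carrier A.
         l b (a \<otimes>\<^bsub>A\<^esub> a') = l b a \<otimes>\<^bsub>A\<^esub> a' \<and>
         r (a \<otimes>\<^bsub>A\<^esub> a') b = a \<otimes>\<^bsub>A\<^esub> r a' b \<and>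
         r a b \<otimes>\<^bsub>A\<^esub> a' = a \<otimes>\<^bsub>A\<^esub> l b a'))"

definition idempotent_extension :: "('k, 'u) extension \<Rightarrow> bool" where
  "idempotent_extension f \<longleftrightarrow>
     right_idempotent (tgt f) (src f) (ract f) \<and> left_idempotent (tgt f) (src f) (lact f)"

definition nondegenerate_extension :: "('k, 'u) extension \<Rightarrow> bool" where
  "nondegenerate_extension f \<longleftrightarrow>
     right_nondegenerate (tgt f) (src f) (ract f) \<and> left_nondegenerate (tgt f) (src f) (lact f)"

section \<open>The category of non-degenerate idempotent projective algebras\<close>

definition ndi_Ob :: "('k, 'm) ring_scheme \<Rightarrow> ('k, 'u) module set" where
  "ndi_Ob K = {A. nonunital_algebra K A \<and> nondegenerate_algebra A \<and> idempotent_algebra A \<and>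
                  projective_module K A}"

definition ndi_Hom ::
    "('k, 'm) ring_scheme \<Rightarrow> ('k, 'u) module \<Rightarrow> ('k, 'u) module \<Rightarrow> ('k, 'u) extension set"
  where "ndi_Hom K B A = {f. src f = B \<and> tgt f = A \<and> is_extension K f \<and>
      nondegenerate_extension f \<and> idempotent_extension f \<and> projective_module K (tgt f)}"

text \<open>The description operator expresses that the result must not depend on the chosen
  decomposition of \<open>r\<close>.\<close>

definition ndi_Comp :: "('k, 'u) extension \<Rightarrow> ('k, 'u) extension \<Rightarrow> ('k, 'u) extension" where
  "ndi_Comp g f = (let B = src f; A = tgt f; R = tgt g in \<lparr>
     src = B, tgt = R,
     lact = (\<lambda>b\<in>carrier B. \<lambda>r\<in>carrier R. THE s.
       \<exists>(n::nat). \<exists>x\<in>{..<n} \<rightarrow> carrier R. \<exists>a\<in>{..<n} \<rightarrow> carrier A.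
         r = (\<Oplus>\<^bsub>R\<^esub>i\<in>{..<n}. lact g (a i) (x i)) \<and>
         s = (\<Oplus>\<^bsub>R\<^esub>i\<in>{..<n}. lact g (lact f b (a i)) (x i))),
     ract = (\<lambda>r\<in>carrier R. \<lambda>b\<in>carrier B. THE s.
       \<exists>(n::nat). \<exists>x\<in>{..<n} \<rightarrow> carrier R. \<exists>a\<in>{..<n} \<rightarrow> carrier A.
         r = (\<Oplus>\<^bsub>R\<^esub>i\<in>{..<n}. ract g (x i) (a i)) \<and>
         s = (\<Oplus>\<^bsub>R\<^esub>i\<in>{..<n}. ract g (x i) (ract f (a i) b)))\<rparr>)"

definition ndi_Id :: "('k, 'u) module \<Rightarrow> ('k, 'u) extension" where
  "ndi_Id A = \<lparr>
     src = A, tgt = A,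
     lact = (\<lambda>b\<in>carrier A. \<lambda>a\<in>carrier A. b \<otimes>\<^bsub>A\<^esub> a),
     ract = (\<lambda>a\<in>carrier A. \<lambda>b\<in>carrier A. a \<otimes>\<^bsub>A\<^esub> b)\<rparr>"

section \<open>Tensor products\<close>

text \<open>$A \otimes_k B$ is the free abelian group on $A \times B$ modulo biadditivity and
  $ra \otimes b = a \otimes rb$.\<close>

definition tensor_relations ::
    "('k, 'm) ring_scheme \<Rightarrow> ('k, 'a, 'p) module_scheme \<Rightarrow> ('k, 'b, 'q) module_scheme
      \<Rightarrow> ('a \<times> 'b \<Rightarrow>\<^sub>0 int) set"
  where "tensor_relations K A B =
     {frag_of (a \<oplus>\<^bsub>A\<^esub> a', b) - frag_of (a, b) - frag_of (a', b) | a a' b.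
        a \<in> carrier A \<and> a' \<in> carrier A \<and> b \<in> carrier B} \<union>
     {frag_of (a, b \<oplus>\<^bsub>B\<^esub> b') - frag_of (a, b) - frag_of (a, b') | a b b'.
        a \<in> carrier A \<and> b \<in> carrier B \<and> b' \<in> carrier B} \<union>
     {frag_of (r \<odot>\<^bsub>A\<^esub> a, b) - frag_of (a, r \<odot>\<^bsub>B\<^esub> b) | r a b.
        r \<in> carrier K \<and> a \<in> carrier A \<and> b \<in> carrier B}"

definition tensor_kernel ::
    "('k, 'm) ring_scheme \<Rightarrow> ('k, 'a, 'p) module_scheme \<Rightarrow> ('k, 'b, 'q) module_scheme
      \<Rightarrow> ('a \<times> 'b \<Rightarrow>\<^sub>0 int) set"
  where "tensor_kernel K A B =
     generate (free_Abelian_group (carrier A \<times> carrier B)) (tensor_relations K A B)"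

definition tensor_group ::
    "('k, 'm) ring_scheme \<Rightarrow> ('k, 'a, 'p) module_scheme \<Rightarrow> ('k, 'b, 'q) module_scheme
      \<Rightarrow> ('a \<times> 'b \<Rightarrow>\<^sub>0 int) set monoid"
  where "tensor_group K A B = free_Abelian_group (carrier A \<times> carrier B) Mod tensor_kernel K A B"

definition pure_tensor ::
    "('k, 'm) ring_scheme \<Rightarrow> ('k, 'a, 'p) module_scheme \<Rightarrow> ('k, 'b, 'q) module_scheme
      \<Rightarrow> 'a \<Rightarrow> 'b \<Rightarrow> ('a \<times> 'b \<Rightarrow>\<^sub>0 int) set"
  where "pure_tensor K A B a b =
     tensor_kernel K A B #>\<^bsub>free_Abelian_group (carrier A \<times> carrier B)\<^esub> frag_of (a, b)"

text \<open>The homomorphism $A \otimes B \to G$, $a \otimes b \mapsto h(a, b)$, into a (multiplicatively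
  written) commutative group $G$ that is induced by a biadditive balanced map $h$.\<close>

definition tensor_lift ::
    "('c, 'n) monoid_scheme \<Rightarrow> ('a \<Rightarrow> 'b \<Rightarrow> 'c) \<Rightarrow> ('a \<times> 'b \<Rightarrow>\<^sub>0 int) set \<Rightarrow> 'c"
  where "tensor_lift G h x =
     the_elem ((\<lambda>p. \<Otimes>\<^bsub>G\<^esub>z\<in>Poly_Mapping.keys p.
                      h (fst z) (snd z) [^]\<^bsub>G\<^esub> Poly_Mapping.lookup p z) ` x)"

definition tensor_algebra ::
    "('k, 'm) ring_scheme \<Rightarrow> ('k, 'a, 'p) module_scheme \<Rightarrow> ('k, 'b, 'q) module_scheme
      \<Rightarrow> ('k, ('a \<times> 'b \<Rightarrow>\<^sub>0 int) set) module"
  where "tensor_algebra K A B = (let T = tensor_group K A B; t = pure_tensor K A B in \<lparr>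
     carrier = carrier T,
     monoid.mult = (\<lambda>x y. tensor_lift T (\<lambda>a b. tensor_lift T
                        (\<lambda>a' b'. t (a \<otimes>\<^bsub>A\<^esub> a') (b \<otimes>\<^bsub>B\<^esub> b')) y) x),
     one = undefined,
     ring.zero = \<one>\<^bsub>T\<^esub>,
     ring.add = (\<lambda>x y. x \<otimes>\<^bsub>T\<^esub> y),
     smult = (\<lambda>r x. tensor_lift T (\<lambda>a b. t (r \<odot>\<^bsub>A\<^esub> a) b) x)\<rparr>)"

text \<open>The algebra $k$.\<close>

definition base_algebra :: "('k, 'm) ring_scheme \<Rightarrow> ('k, 'k) module" where
  "base_algebra K = \<lparr>carrier = carrier K, monoid.mult = monoid.mult K, one = \<one>\<^bsub>K\<^esub>, ring.zero = \<zero>\<^bsub>K\<^esub>,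
     ring.add = ring.add K, smult = monoid.mult K\<rparr>"

subsection \<open>Transport into the universe of objects\<close>

text \<open>The objects of the category are algebras whose elements have a fixed type \<open>'u\<close>, the universe.
  The algebras \<open>tensor_algebra K A B\<close> and \<open>base_algebra K\<close> have elements of other types and are
  replaced by isomorphic copies along an arbitrarily chosen injection into \<open>'u\<close>. Such injections
  exist as soon as \<open>'u\<close> is infinite and not smaller than \<open>K\<close>.\<close>

definition to_univ :: "('k, 'c, 'p) module_scheme \<Rightarrow> 'c \<Rightarrow> 'u" where
  "to_univ M = (SOME f. inj_on f (carrier M))"

definition of_univ :: "('k, 'c, 'p) module_scheme \<Rightarrow> 'u \<Rightarrow> 'c" where
  "of_univ M = inv_into (carrier M) (to_univ M)"

definition univ_copy :: "('k, 'c, 'p) module_scheme \<Rightarrow> ('k, 'u) module" where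
  "univ_copy M = \<lparr>
     carrier = to_univ M ` carrier M,
     monoid.mult = (\<lambda>x y. to_univ M (of_univ M x \<otimes>\<^bsub>M\<^esub> of_univ M y)),
     one = to_univ M \<one>\<^bsub>M\<^esub>,
     ring.zero = to_univ M \<zero>\<^bsub>M\<^esub>,
     ring.add = (\<lambda>x y. to_univ M (of_univ M x \<oplus>\<^bsub>M\<^esub> of_univ M y)),
     smult = (\<lambda>r x. to_univ M (r \<odot>\<^bsub>M\<^esub> of_univ M x))\<rparr>"

definition ndi_unit :: "('k, 'm) ring_scheme \<Rightarrow> ('k, 'u) module" where
  "ndi_unit K = univ_copy (base_algebra K)"

definition ndi_tensor ::
    "('k, 'm) ring_scheme \<Rightarrow> ('k, 'u) module \<Rightarrow> ('k, 'u) module \<Rightarrow> ('k, 'u) module"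
  where "ndi_tensor K A B = univ_copy (tensor_algebra K A B)"

definition ndi_pure ::
    "('k, 'm) ring_scheme \<Rightarrow> ('k, 'u) module \<Rightarrow> ('k, 'u) module \<Rightarrow> 'u \<Rightarrow> 'u \<Rightarrow> 'u"
  where "ndi_pure K A B a b = to_univ (tensor_algebra K A B) (pure_tensor K A B a b)"

text \<open>\<open>ndi_lift K A B M h\<close> is the additive map from \<open>ndi_tensor K A B\<close> to \<open>M\<close> that is given by
  \<open>h a b\<close> on the pure tensors \<open>ndi_pure K A B a b\<close>.\<close>

definition ndi_lift ::
    "('k, 'm) ring_scheme \<Rightarrow> ('k, 'u) module \<Rightarrow> ('k, 'u) module \<Rightarrow> ('k, 'u) module
      \<Rightarrow> ('u \<Rightarrow> 'u \<Rightarrow> 'u) \<Rightarrow> 'u \<Rightarrow> 'u"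
  where "ndi_lift K A B M h x =
     tensor_lift (add_monoid M) h (of_univ (tensor_algebra K A B) x)"

section \<open>The monoidal structure\<close>

definition ndi_tensor_Hom ::
    "('k, 'm) ring_scheme \<Rightarrow> ('k, 'u) extension \<Rightarrow> ('k, 'u) extension \<Rightarrow> ('k, 'u) extension"
  where "ndi_tensor_Hom K f f' =
    (let B = src f; B' = src f'; A = tgt f; A' = tgt f';
         BB = ndi_tensor K B B'; AA = ndi_tensor K A A'; t = ndi_pure K A A' in \<lparr>
     src = BB, tgt = AA,
     lact = (\<lambda>x\<in>carrier BB. \<lambda>y\<in>carrier AA.
       ndi_lift K B B' AA (\<lambda>b b'. ndi_lift K A A' AA (\<lambda>a a'. t (lact f b a) (lact f' b' a')) y) x),
     ract = (\<lambda>y\<in>carrier AA. \<lambda>x\<in>carrier BB.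
       ndi_lift K A A' AA (\<lambda>a a'. ndi_lift K B B' AA (\<lambda>b b'. t (ract f a b) (ract f' a' b')) x) y)\<rparr>)"

text \<open>The extension induced by an algebra homomorphism \<open>\<phi>\<close>: $b \cdot a = \varphi(b) a$ and
  $a \cdot b = a \varphi(b)$. The associativity and unit constraints are induced in this way by the
  canonical isomorphisms of algebras.\<close>

definition extension_of_map ::
    "('k, 'u) module \<Rightarrow> ('k, 'u) module \<Rightarrow> ('u \<Rightarrow> 'u) \<Rightarrow> ('k, 'u) extension"
  where "extension_of_map B A \<phi> = \<lparr>
     src = B, tgt = A,
     lact = (\<lambda>b\<in>carrier B. \<lambda>a\<in>carrier A. \<phi> b \<otimes>\<^bsub>A\<^esub> a),
     ract = (\<lambda>a\<in>carrier A. \<lambda>b\<in>carrier B. a \<otimes>\<^bsub>A\<^esub> \<phi> b)\<rparr>"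

definition ndi_assoc ::
    "('k, 'm) ring_scheme \<Rightarrow> ('k, 'u) module \<Rightarrow> ('k, 'u) module \<Rightarrow> ('k, 'u) module
      \<Rightarrow> ('k, 'u) extension"
  where "ndi_assoc K A B C =
    (let AB = ndi_tensor K A B; BC = ndi_tensor K B C; R = ndi_tensor K A BC in
      extension_of_map (ndi_tensor K AB C) R
        (ndi_lift K AB C R (\<lambda>x c. ndi_lift K A B R
           (\<lambda>a b. ndi_pure K A BC a (ndi_pure K B C b c)) x)))"

definition ndi_lunit :: "('k, 'm) ring_scheme \<Rightarrow> ('k, 'u) module \<Rightarrow> ('k, 'u) extension" where
  "ndi_lunit K A = extension_of_map (ndi_tensor K (ndi_unit K) A) A
     (ndi_lift K (ndi_unit K) A A (\<lambda>r a. of_univ (base_algebra K) r \<odot>\<^bsub>A\<^esub> a))"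

definition ndi_runit :: "('k, 'm) ring_scheme \<Rightarrow> ('k, 'u) module \<Rightarrow> ('k, 'u) extension" where
  "ndi_runit K A = extension_of_map (ndi_tensor K A (ndi_unit K)) A
     (ndi_lift K A (ndi_unit K) A (\<lambda>a r. of_univ (base_algebra K) r \<odot>\<^bsub>A\<^esub> a))"

end

theory Submission
  imports Defs
begin

text \<open>
  The proof rests on four observations.

  \<^item> \<^emph>\<open>A morphism is determined by its left action\<close> (\<open>ndi_Hom_eqI\<close>), because
  $(a \cdot b)a' = a(b \cdot a')$ and $A$ is non-degenerate. Every equation between morphisms is
  therefore an equation between left actions. For $f$ from $A$ to $B$ and $g$ from $B$ to $C$, the
  identity $b \cdot \sum (a \cdot b_i) \cdot c_i = (b \cdot a) \cdot \sum b_i \cdot c_i$ shows that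
  $a \cdot c = \sum (a \cdot b_i) \cdot c_i$ depends only on $c = \sum b_i \cdot c_i$, since $C$ is
  non-degenerate over $B$. So $g \circ f$ exists, and it is the only morphism with
  $a \cdot (b \cdot c) = (a \cdot b) \cdot c$ (\<open>ndi_Comp_eqI\<close>). The category axioms follow at once.

  \<^item> \<^emph>\<open>One construction and one law give all algebraic identities for tensor products.\<close> The
  multiplication of $A \otimes B$ and both actions of $f \otimes f'$ are tensor products of two bilinear
  maps (\<open>tensor_action\<close>), and an identity of the form $k(h(p,q),s) = j(p,i(q,s))$ passes from two
  quadruples of bilinear maps to their tensor products (\<open>tensor_action_assoc\<close>), as both sides are
  trilinear and agree on pure tensors. Associativity of $A \otimes B$, the six laws of an extension and
  the interchange law are all instances.

  \<^item> \<^emph>\<open>Projectivity makes tensor products non-degenerate.\<close> If $(\varphi_j, e_j)$ is a dual basis of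
  $N$, then $x = \sum_j (\mathrm{id} \otimes \varphi_j)(x) \otimes e_j$ for $x \in M \otimes N$
  (\<open>contraction_expansion\<close>), and $\mathrm{id} \otimes \varphi_j$ commutes with operators on $M$. Hence an
  element that is killed by $f \otimes \mathrm{id}$ for all $f$ in a family without common kernel
  vanishes (\<open>eq_zero_if_left_factor_annihilated\<close>). For projective $M$ and $N$ this can be applied to
  both factors in turn.

  \<^item> \<^emph>\<open>The constraints are induced by isomorphisms of algebras\<close>, and inducing is compatible with
  composition and tensor products (\<open>ndi_Comp_extension_of_map\<close>, \<open>tensor_Hom_extension_of_map\<close>). So
  pentagon and triangle are equalities of linear maps, visible on pure tensors. A naturality square
  commutes as soon as $\beta(a \cdot b) = \alpha(a) \cdot \beta(b)$
  (\<open>ndi_Comp_extension_of_map_square\<close>), which is again checked on pure tensors.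

  The copies in the universe exist because $A \otimes B$ is a quotient of a free abelian group on at most
  as many generators as the infinite universe has elements (\<open>tensor_lepoll\<close>).
\<close>

section \<open>Linear and bilinear maps\<close>

lemma linear_mapI:
  assumes "\<And>x. x \<in> carrier M \<Longrightarrow> f x \<in> carrier N"
    and "\<And>x y. \<lbrakk>x \<in> carrier M; y \<in> carrier M\<rbrakk> \<Longrightarrow> f (x \<oplus>\<^bsub>M\<^esub> y) = f x \<oplus>\<^bsub>N\<^esub> f y"
    and "\<And>r x. \<lbrakk>r \<in> carrier K; x \<in> carrier M\<rbrakk> \<Longrightarrow> f (r \<odot>\<^bsub>M\<^esub> x) = r \<odot>\<^bsub>N\<^esub> f x"
  shows "linear_map K M N f"
  using assms unfolding linear_map_def by blast

lemma
  assumes "linear_map K M N f"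
  shows linear_map_closed: "x \<in> carrier M \<Longrightarrow> f x \<in> carrier N"
    and linear_map_add: "\<lbrakk>x \<in> carrier M; y \<in> carrier M\<rbrakk> \<Longrightarrow> f (x \<oplus>\<^bsub>M\<^esub> y) = f x \<oplus>\<^bsub>N\<^esub> f y"
    and linear_map_smult: "\<lbrakk>r \<in> carrier K; x \<in> carrier M\<rbrakk> \<Longrightarrow> f (r \<odot>\<^bsub>M\<^esub> x) = r \<odot>\<^bsub>N\<^esub> f x"
  using assms unfolding linear_map_def by blast+

lemma linear_map_zero:
  assumes "linear_map K M N f" "module K M" "module K N"
  shows "f \<zero>\<^bsub>M\<^esub> = \<zero>\<^bsub>N\<^esub>"
proof -
  interpret M: module K M by fact
  interpret N: module K N by fact
  have "f \<zero>\<^bsub>M\<^esub> = f (\<zero>\<^bsub>K\<^esub> \<odot>\<^bsub>M\<^esub> \<zero>\<^bsub>M\<^esub>)" by simp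
  also have "\<dots> = \<zero>\<^bsub>K\<^esub> \<odot>\<^bsub>N\<^esub> f \<zero>\<^bsub>M\<^esub>"
    by (rule linear_map_smult[OF assms(1)]) simp_all
  also have "\<dots> = \<zero>\<^bsub>N\<^esub>" by (simp add: linear_map_closed[OF assms(1)])
  finally show ?thesis .
qed

lemma linear_map_finsum:
  assumes f: "linear_map K M N f" and "module K M" "module K N"
    and "finite I" "g \<in> I \<rightarrow> carrier M"
  shows "f (\<Oplus>\<^bsub>M\<^esub>i\<in>I. g i) = (\<Oplus>\<^bsub>N\<^esub>i\<in>I. f (g i))"
proof -
  interpret M: module K M by fact
  interpret N: module K N by fact
  show ?thesis using assms(4,5)
  proof (induction I rule: finite_induct)
    case empty
    show ?case by (simp add: linear_map_zero[OF assms(1-3)])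
  next
    case (insert i I)
    then have "g \<in> I \<rightarrow> carrier M" "g i \<in> carrier M" "(\<lambda>i. f (g i)) \<in> I \<rightarrow> carrier N" "f (g i) \<in> carrier N"
      by (auto intro: linear_map_closed[OF f])
    with insert show ?case
      by (simp add: linear_map_add[OF f])
  qed
qed

lemma linear_map_id: "linear_map K M M (\<lambda>x. x)"
  by (rule linear_mapI) simp_all

lemma linear_map_compose:
  "\<lbrakk>linear_map K M N f; linear_map K N P g\<rbrakk> \<Longrightarrow> linear_map K M P (\<lambda>x. g (f x))"
  by (rule linear_mapI) (simp_all add: linear_map_closed linear_map_add linear_map_smult)

lemma linear_map_cong:
  assumes "linear_map K M N f" "module K M" "\<And>x. x \<in> carrier M \<Longrightarrow> g x = f x"
  shows "linear_map K M N g"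
proof -
  interpret M: module K M by fact
  show ?thesis
    by (rule linear_mapI)
      (use assms in \<open>simp_all add: linear_map_closed linear_map_add linear_map_smult\<close>)
qed

lemma linear_map_sum:
  assumes "linear_map K M N f" "linear_map K M N g" "module K N"
  shows "linear_map K M N (\<lambda>x. f x \<oplus>\<^bsub>N\<^esub> g x)"
proof -
  interpret N: module K N by fact
  show ?thesis
    by (rule linear_mapI)
      (simp_all add: linear_map_closed[OF assms(1)] linear_map_closed[OF assms(2)]
        linear_map_add[OF assms(1)] linear_map_add[OF assms(2)] N.smult_r_distr
        linear_map_smult[OF assms(1)] linear_map_smult[OF assms(2)] N.a_ac)
qed

lemma linear_map_scaled:
  assumes "linear_map K M N f" "module K N" "r \<in> carrier K"
  shows "linear_map K M N (\<lambda>x. r \<odot>\<^bsub>N\<^esub> f x)"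
proof -
  interpret N: module K N by fact
  show ?thesis
    by (rule linear_mapI)
      (simp_all add: assms(3) linear_map_closed[OF assms(1)] linear_map_add[OF assms(1)]
        linear_map_smult[OF assms(1)] N.smult_r_distr N.smult_assoc1[symmetric] N.R.m_comm)
qed

lemma bilinear_mapI:
  assumes "\<And>x. x \<in> carrier M \<Longrightarrow> linear_map K N P (\<lambda>y. h x y)"
    and "\<And>y. y \<in> carrier N \<Longrightarrow> linear_map K M P (\<lambda>x. h x y)"
  shows "bilinear_map K M N P h"
  using assms unfolding bilinear_map_def by blast

lemma
  assumes "bilinear_map K M N P h"
  shows bilinear_map_right: "x \<in> carrier M \<Longrightarrow> linear_map K N P (\<lambda>y. h x y)"
    and bilinear_map_left: "y \<in> carrier N \<Longrightarrow> linear_map K M P (\<lambda>x. h x y)"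
    and bilinear_map_closed: "\<lbrakk>x \<in> carrier M; y \<in> carrier N\<rbrakk> \<Longrightarrow> h x y \<in> carrier P"
    and bilinear_map_add_left: "\<lbrakk>x \<in> carrier M; x' \<in> carrier M; y \<in> carrier N\<rbrakk>
        \<Longrightarrow> h (x \<oplus>\<^bsub>M\<^esub> x') y = h x y \<oplus>\<^bsub>P\<^esub> h x' y"
    and bilinear_map_add_right: "\<lbrakk>x \<in> carrier M; y \<in> carrier N; y' \<in> carrier N\<rbrakk>
        \<Longrightarrow> h x (y \<oplus>\<^bsub>N\<^esub> y') = h x y \<oplus>\<^bsub>P\<^esub> h x y'"
    and bilinear_map_smult_left: "\<lbrakk>r \<in> carrier K; x \<in> carrier M; y \<in> carrier N\<rbrakk>
        \<Longrightarrow> h (r \<odot>\<^bsub>M\<^esub> x) y = r \<odot>\<^bsub>P\<^esub> h x y"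
    and bilinear_map_smult_right: "\<lbrakk>r \<in> carrier K; x \<in> carrier M; y \<in> carrier N\<rbrakk>
        \<Longrightarrow> h x (r \<odot>\<^bsub>N\<^esub> y) = r \<odot>\<^bsub>P\<^esub> h x y"
  using assms unfolding bilinear_map_def linear_map_def by blast+

lemma bilinear_map_compose:
  assumes "bilinear_map K M N P h" "linear_map K M' M f" "linear_map K N' N g" "linear_map K P P' k"
  shows "bilinear_map K M' N' P' (\<lambda>x y. k (h (f x) (g y)))"
  by (rule bilinear_mapI; rule linear_mapI)
    (simp_all add: linear_map_closed[OF assms(2)] linear_map_closed[OF assms(3)] linear_map_closed[OF assms(4)]
      linear_map_add[OF assms(2)] linear_map_add[OF assms(3)] linear_map_add[OF assms(4)]
      linear_map_smult[OF assms(2)] linear_map_smult[OF assms(3)] linear_map_smult[OF assms(4)]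
      bilinear_map_closed[OF assms(1)] bilinear_map_add_left[OF assms(1)] bilinear_map_add_right[OF assms(1)]
      bilinear_map_smult_left[OF assms(1)] bilinear_map_smult_right[OF assms(1)])

lemma bilinear_map_flip: "bilinear_map K M N P h \<Longrightarrow> bilinear_map K N M P (\<lambda>y x. h x y)"
  unfolding bilinear_map_def by blast

lemma bilinear_map_cong:
  assumes "bilinear_map K M N P h" "module K M" "module K N"
    "\<And>x y. \<lbrakk>x \<in> carrier M; y \<in> carrier N\<rbrakk> \<Longrightarrow> h' x y = h x y"
  shows "bilinear_map K M N P h'"
  using assms by (intro bilinear_mapI) (auto intro: linear_map_cong bilinear_map_left bilinear_map_right)

lemma bilinear_map_smult:
  assumes "module K M" shows "bilinear_map K (base_algebra K) M M (\<lambda>r x. r \<odot>\<^bsub>M\<^esub> x)"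
proof -
  interpret M: module K M by fact
  show ?thesis
    by (rule bilinear_mapI; rule linear_mapI)
      (simp_all add: base_algebra_def M.smult_l_distr M.smult_r_distr M.smult_assoc1[symmetric] M.R.m_comm)
qed

section \<open>Finite sums\<close>

text \<open>The additive closure of \<open>S\<close>. It replaces indexed families in the idempotency conditions, so that
statements about $MA$ can be proved by rule induction.\<close>

inductive_set finite_sums :: "('k, 'a, 'p) module_scheme \<Rightarrow> 'a set \<Rightarrow> 'a set" for M S where
  zero: "\<zero>\<^bsub>M\<^esub> \<in> finite_sums M S"
| add: "\<lbrakk>s \<in> S; x \<in> finite_sums M S\<rbrakk> \<Longrightarrow> s \<oplus>\<^bsub>M\<^esub> x \<in> finite_sums M S"

lemma finite_sums_closed:
  assumes "abelian_group M" "S \<subseteq> carrier M" "x \<in> finite_sums M S"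
  shows "x \<in> carrier M"
proof -
  interpret abelian_group M by fact
  show ?thesis using assms(3) by induction (use assms(2) in auto)
qed

lemma finite_sums_add:
  assumes "abelian_group M" "S \<subseteq> carrier M" "x \<in> finite_sums M S" "y \<in> finite_sums M S"
  shows "x \<oplus>\<^bsub>M\<^esub> y \<in> finite_sums M S"
proof -
  interpret abelian_group M by fact
  note c = finite_sums_closed[OF assms(1,2)]
  show ?thesis using assms(3)
  proof induction
    case zero
    show ?case by (simp add: c assms(4))
  next
    case (add s x)
    then have "s \<oplus>\<^bsub>M\<^esub> x \<oplus>\<^bsub>M\<^esub> y = s \<oplus>\<^bsub>M\<^esub> (x \<oplus>\<^bsub>M\<^esub> y)"
      using c[OF add(2)] c[OF assms(4)] assms(2) by (simp add: a_assoc subsetD)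
    then show ?case using add by (simp add: finite_sums.add)
  qed
qed

lemma finite_sums_incl:
  assumes "abelian_group M" "S \<subseteq> carrier M" "s \<in> S"
  shows "s \<in> finite_sums M S"
proof -
  interpret abelian_group M by fact
  show ?thesis using finite_sums.add[OF assms(3) finite_sums.zero, of M] assms by auto
qed

lemma finite_sums_induct [consumes 3, case_names zero incl add]:
  assumes "abelian_group M" "S \<subseteq> carrier M" "x \<in> finite_sums M S"
    and "P \<zero>\<^bsub>M\<^esub>" "\<And>s. s \<in> S \<Longrightarrow> P s"
    and "\<And>x y. \<lbrakk>x \<in> carrier M; y \<in> carrier M; P x; P y\<rbrakk> \<Longrightarrow> P (x \<oplus>\<^bsub>M\<^esub> y)"
  shows "P x"
  using assms(3)
  by induction (use assms finite_sums_closed[OF assms(1,2)] in auto)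

lemma finite_sums_iff_finsum:
  fixes M :: "('k, 'b, 'q) module_scheme" and A :: "('k, 'a, 'p) module_scheme"
  assumes "abelian_group M" and act: "\<And>a x. \<lbrakk>a \<in> carrier A; x \<in> carrier M\<rbrakk> \<Longrightarrow> act a x \<in> carrier M"
  shows "m \<in> finite_sums M {act a x | a x. a \<in> carrier A \<and> x \<in> carrier M} \<longleftrightarrow>
    (\<exists>(n::nat). \<exists>x\<in>{..<n} \<rightarrow> carrier M. \<exists>y\<in>{..<n} \<rightarrow> carrier A.
        m = (\<Oplus>\<^bsub>M\<^esub>i\<in>{..<n}. act (y i) (x i)))" (is "m \<in> finite_sums M ?S \<longleftrightarrow> ?R m")
proof
  interpret abelian_group M by fact
  assume "m \<in> finite_sums M ?S"
  then show "?R m"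
  proof induction
    case zero
    show ?case by (intro exI[of _ 0]) auto
  next
    case (add s m)
    then obtain n x y where n: "x \<in> {..<n::nat} \<rightarrow> carrier M" "y \<in> {..<n} \<rightarrow> carrier A"
      "m = (\<Oplus>\<^bsub>M\<^esub>i\<in>{..<n}. act (y i) (x i))" by blast
    from add obtain a z where s: "s = act a z" "a \<in> carrier A" "z \<in> carrier M" by auto
    \<comment> \<open>The new product is appended at index \<open>n\<close>.\<close>
    let ?x = "x(n := z)" and ?y = "y(n := a)"
    have eq: "(\<Oplus>\<^bsub>M\<^esub>i\<in>{..<n}. act (?y i) (?x i)) = m"
      unfolding n(3) using n(1,2) act by (intro add.finprod_cong') (auto simp: Pi_iff)
    have "(\<Oplus>\<^bsub>M\<^esub>i\<in>{..<Suc n}. act (?y i) (?x i)) = act a z \<oplus>\<^bsub>M\<^esub> (\<Oplus>\<^bsub>M\<^esub>i\<in>{..<n}. act (?y i) (?x i))"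
      unfolding lessThan_Suc
      by (subst finsum_insert) (use n(1,2) s act in \<open>auto simp: Pi_iff\<close>)
    then have "s \<oplus>\<^bsub>M\<^esub> m = (\<Oplus>\<^bsub>M\<^esub>i\<in>{..<Suc n}. act (?y i) (?x i))"
      by (simp only: eq s(1))
    moreover have "?x \<in> {..<Suc n} \<rightarrow> carrier M" "?y \<in> {..<Suc n} \<rightarrow> carrier A"
      using n(1,2) s by (auto simp: Pi_def less_Suc_eq)
    ultimately show ?case by blast
  qed
next
  interpret abelian_group M by fact
  assume "?R m"
  then obtain n x y where n: "x \<in> {..<n::nat} \<rightarrow> carrier M" "y \<in> {..<n} \<rightarrow> carrier A"
      "m = (\<Oplus>\<^bsub>M\<^esub>i\<in>{..<n}. act (y i) (x i))" by blast
  have "I \<subseteq> {..<n} \<Longrightarrow> (\<Oplus>\<^bsub>M\<^esub>i\<in>I. act (y i) (x i)) \<in> finite_sums M ?S" if "finite I" for I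
    using that
  proof induction
    case empty
    show ?case by (simp add: finite_sums.zero)
  next
    case (insert i I)
    have "(\<Oplus>\<^bsub>M\<^esub>i\<in>insert i I. act (y i) (x i)) = act (y i) (x i) \<oplus>\<^bsub>M\<^esub> (\<Oplus>\<^bsub>M\<^esub>i\<in>I. act (y i) (x i))"
      by (rule finsum_insert) (use insert n(1,2) act in \<open>auto simp: Pi_iff subset_iff\<close>)
    moreover have "act (y i) (x i) \<in> ?S" using insert n(1,2) by blast
    ultimately show ?case using insert by (simp add: finite_sums.add)
  qed
  from this[of "{..<n}"] show "m \<in> finite_sums M ?S" by (simp add: n(3))
qed

lemma left_idempotent_iff:
  assumes "abelian_group M" "\<And>a x. \<lbrakk>a \<in> carrier A; x \<in> carrier M\<rbrakk> \<Longrightarrow> act a x \<in> carrier M"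
  shows "left_idempotent M A act \<longleftrightarrow>
    carrier M \<subseteq> finite_sums M {act a x | a x. a \<in> carrier A \<and> x \<in> carrier M}"
  using finite_sums_iff_finsum[of M A act, OF assms] by (simp add: left_idempotent_def subset_iff Ball_def)

lemma right_idempotent_flip: "right_idempotent M A act \<longleftrightarrow> left_idempotent M A (\<lambda>a x. act x a)"
  unfolding right_idempotent_def left_idempotent_def ..

lemma right_nondegenerate_flip: "right_nondegenerate M A act \<longleftrightarrow> left_nondegenerate M A (\<lambda>a x. act x a)"
  unfolding right_nondegenerate_def left_nondegenerate_def ..

text \<open>If $M = AM$, then a property of $M$ that is stable under sums has to be checked only on the products
$a \cdot x$.\<close>

lemma left_idempotent_induct [consumes 4, case_names zero act add]:
  assumes "left_idempotent M A act" "module K M" "bilinear_map K A M M act" "m \<in> carrier M"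
    and "P \<zero>\<^bsub>M\<^esub>" "\<And>a x. \<lbrakk>a \<in> carrier A; x \<in> carrier M\<rbrakk> \<Longrightarrow> P (act a x)"
    "\<And>x y. \<lbrakk>x \<in> carrier M; y \<in> carrier M; P x; P y\<rbrakk> \<Longrightarrow> P (x \<oplus>\<^bsub>M\<^esub> y)"
  shows "P m"
proof -
  interpret M: module K M by fact
  note closed = bilinear_map_closed[OF assms(3)]
  have "m \<in> finite_sums M {act a x | a x. a \<in> carrier A \<and> x \<in> carrier M}"
    using left_idempotent_iff[of M A act, OF M.M.abelian_group_axioms closed] assms(1,4) by blast
  from M.M.abelian_group_axioms _ this show ?thesis
    by (rule finite_sums_induct) (use assms(5-7) closed in auto)
qed

lemma linear_map_eqI_idempotent:
  assumes "left_idempotent M A act" "module K M" "module K N" "bilinear_map K A M M act"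
    "linear_map K M N f" "linear_map K M N g"
    "\<And>a x. \<lbrakk>a \<in> carrier A; x \<in> carrier M\<rbrakk> \<Longrightarrow> f (act a x) = g (act a x)"
    "m \<in> carrier M"
  shows "f m = g m"
  using assms(1,2,4,8)
proof (induction rule: left_idempotent_induct)
  case zero
  show ?case using assms(2,3,5,6) by (simp add: linear_map_zero)
next
  case (add x y)
  then show ?case by (simp add: linear_map_add[OF assms(5)] linear_map_add[OF assms(6)])
qed (rule assms(7))

section \<open>The tensor product of modules\<close>

locale module_pair = A: module K A + B: module K B
  for K :: "('k, 'm) ring_scheme" and A :: "('k, 'a, 'p) module_scheme" and B :: "('k, 'b, 'q) module_scheme"
begin

abbreviation "F \<equiv> free_Abelian_group (carrier A \<times> carrier B)"
abbreviation "T \<equiv> tensor_group K A B"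
abbreviation "pure \<equiv> pure_tensor K A B"
abbreviation "coset c \<equiv> tensor_kernel K A B #>\<^bsub>F\<^esub> c"

lemma diff_closed: "\<lbrakk>c \<in> carrier F; d \<in> carrier F\<rbrakk> \<Longrightarrow> c - d \<in> carrier F"
  using keys_diff[of c d] by auto

lemma tensor_relations_carrier: "tensor_relations K A B \<subseteq> carrier F"
  unfolding tensor_relations_def
  by (auto intro!: diff_closed simp del: carrier_free_Abelian_group_iff)

lemma normal_tensor_kernel: "tensor_kernel K A B \<lhd> F"
proof -
  have "subgroup (tensor_kernel K A B) F"
    unfolding tensor_kernel_def
    by (rule group.generate_is_subgroup[OF group_free_Abelian_group tensor_relations_carrier])
  then show ?thesis
    by (simp add: comm_group.normal_iff_subgroup[OF abelian_free_Abelian_group])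
qed

lemma comm_group_T: "comm_group T"
  unfolding tensor_group_def
  by (rule comm_group.abelian_FactGroup[OF abelian_free_Abelian_group])
    (rule normal_imp_subgroup[OF normal_tensor_kernel])

sublocale T: comm_group T by (rule comm_group_T)

lemma coset_hom: "coset \<in> hom F T"
  unfolding tensor_group_def by (rule normal.r_coset_hom_Mod[OF normal_tensor_kernel])

sublocale cl: group_hom F T "\<lambda>c. coset c"
  by (simp add: group_hom_def group_hom_axioms_def coset_hom T.is_group)

lemma carrier_T: "carrier T = coset ` carrier F"
  unfolding tensor_group_def FactGroup_def by (auto simp: RCOSETS_def)

lemma T_cases:
  assumes "x \<in> carrier T" obtains c where "c \<in> carrier F" "x = coset c"
  using assms unfolding carrier_T by (rule imageE) (rule that)

lemma coset_relation:
  assumes "c \<in> tensor_relations K A B" shows "coset c = \<one>\<^bsub>T\<^esub>"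
proof -
  have "c \<in> tensor_kernel K A B"
    unfolding tensor_kernel_def by (rule generate.incl[OF assms])
  then show ?thesis
    unfolding tensor_group_def
    by (simp add: group.coset_join2 group_free_Abelian_group normal_imp_subgroup[OF normal_tensor_kernel]
        subgroup.mem_carrier[OF normal_imp_subgroup[OF normal_tensor_kernel]] del: carrier_free_Abelian_group_iff)
qed

lemma coset_diff:
  assumes "c \<in> carrier F" "d \<in> carrier F"
  shows "coset (c - d) = coset c \<otimes>\<^bsub>T\<^esub> inv\<^bsub>T\<^esub> coset d"
proof -
  have d: "- d \<in> carrier F" "inv\<^bsub>F\<^esub> d = - d" using assms by simp_all
  have "coset (c \<otimes>\<^bsub>F\<^esub> inv\<^bsub>F\<^esub> d) = coset c \<otimes>\<^bsub>T\<^esub> inv\<^bsub>T\<^esub> coset d"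
    using assms cl.hom_mult[of c "inv\<^bsub>F\<^esub> d"] cl.hom_inv[of d] cl.G.inv_closed[of d] by metis
  then show ?thesis by (simp add: d)
qed

lemma eq_mult_if_quotient_one:
  assumes "x \<otimes>\<^bsub>T\<^esub> inv\<^bsub>T\<^esub> y \<otimes>\<^bsub>T\<^esub> inv\<^bsub>T\<^esub> z = \<one>\<^bsub>T\<^esub>"
    and c: "x \<in> carrier T" "y \<in> carrier T" "z \<in> carrier T"
  shows "x = y \<otimes>\<^bsub>T\<^esub> z"
proof -
  have "x \<otimes>\<^bsub>T\<^esub> inv\<^bsub>T\<^esub> y = z"
    using T.inv_solve_right[of "\<one>\<^bsub>T\<^esub>" "x \<otimes>\<^bsub>T\<^esub> inv\<^bsub>T\<^esub> y" z] assms by simp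
  then show ?thesis
    using T.inv_solve_right[of z x y] c by (simp add: T.m_comm)
qed

lemma pure_closed: "\<lbrakk>a \<in> carrier A; b \<in> carrier B\<rbrakk> \<Longrightarrow> pure a b \<in> carrier T"
  unfolding pure_tensor_def by (rule cl.hom_closed) simp

lemma pure_add_left:
  assumes "a \<in> carrier A" "a' \<in> carrier A" "b \<in> carrier B"
  shows "pure (a \<oplus>\<^bsub>A\<^esub> a') b = pure a b \<otimes>\<^bsub>T\<^esub> pure a' b"
proof -
  have "coset (frag_of (a \<oplus>\<^bsub>A\<^esub> a', b) - frag_of (a, b) - frag_of (a', b)) = \<one>\<^bsub>T\<^esub>"
    by (rule coset_relation) (use assms in \<open>auto simp: tensor_relations_def\<close>)
  moreover have "frag_of (a \<oplus>\<^bsub>A\<^esub> a', b) - frag_of (a, b) \<in> carrier F"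
    using assms keys_diff[of "frag_of (a \<oplus>\<^bsub>A\<^esub> a', b)" "frag_of (a, b)"] by auto
  ultimately have "pure (a \<oplus>\<^bsub>A\<^esub> a') b \<otimes>\<^bsub>T\<^esub> inv\<^bsub>T\<^esub> pure a b \<otimes>\<^bsub>T\<^esub> inv\<^bsub>T\<^esub> pure a' b = \<one>\<^bsub>T\<^esub>"
    using assms by (simp add: coset_diff pure_tensor_def del: carrier_free_Abelian_group_iff)
  then show ?thesis by (rule eq_mult_if_quotient_one) (use assms in \<open>simp_all add: pure_closed\<close>)
qed

lemma pure_add_right:
  assumes "a \<in> carrier A" "b \<in> carrier B" "b' \<in> carrier B"
  shows "pure a (b \<oplus>\<^bsub>B\<^esub> b') = pure a b \<otimes>\<^bsub>T\<^esub> pure a b'"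
proof -
  have "coset (frag_of (a, b \<oplus>\<^bsub>B\<^esub> b') - frag_of (a, b) - frag_of (a, b')) = \<one>\<^bsub>T\<^esub>"
    by (rule coset_relation) (use assms in \<open>auto simp: tensor_relations_def\<close>)
  moreover have "frag_of (a, b \<oplus>\<^bsub>B\<^esub> b') - frag_of (a, b) \<in> carrier F"
    using assms keys_diff[of "frag_of (a, b \<oplus>\<^bsub>B\<^esub> b')" "frag_of (a, b)"] by auto
  ultimately have "pure a (b \<oplus>\<^bsub>B\<^esub> b') \<otimes>\<^bsub>T\<^esub> inv\<^bsub>T\<^esub> pure a b \<otimes>\<^bsub>T\<^esub> inv\<^bsub>T\<^esub> pure a b' = \<one>\<^bsub>T\<^esub>"
    using assms by (simp add: coset_diff pure_tensor_def del: carrier_free_Abelian_group_iff)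
  then show ?thesis by (rule eq_mult_if_quotient_one) (use assms in \<open>simp_all add: pure_closed\<close>)
qed

lemma pure_balanced:
  assumes "r \<in> carrier K" "a \<in> carrier A" "b \<in> carrier B"
  shows "pure (r \<odot>\<^bsub>A\<^esub> a) b = pure a (r \<odot>\<^bsub>B\<^esub> b)"
proof -
  have "coset (frag_of (r \<odot>\<^bsub>A\<^esub> a, b) - frag_of (a, r \<odot>\<^bsub>B\<^esub> b)) = \<one>\<^bsub>T\<^esub>"
    by (rule coset_relation) (use assms in \<open>auto simp: tensor_relations_def\<close>)
  then have "pure (r \<odot>\<^bsub>A\<^esub> a) b \<otimes>\<^bsub>T\<^esub> inv\<^bsub>T\<^esub> pure a (r \<odot>\<^bsub>B\<^esub> b) = \<one>\<^bsub>T\<^esub>"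
    using assms by (simp add: coset_diff pure_tensor_def del: carrier_free_Abelian_group_iff)
  then show ?thesis
    using T.inv_solve_right[of "\<one>\<^bsub>T\<^esub>" "pure (r \<odot>\<^bsub>A\<^esub> a) b" "pure a (r \<odot>\<^bsub>B\<^esub> b)"] assms
    by (simp add: pure_closed)
qed

text \<open>The inverse of a pure tensor is a pure tensor, so sums of pure tensors, without differences, exhaust
the tensor product.\<close>

lemma T_induct [consumes 1, case_names pure add]:
  assumes "x \<in> carrier T"
    and pure: "\<And>a b. \<lbrakk>a \<in> carrier A; b \<in> carrier B\<rbrakk> \<Longrightarrow> P (pure a b)"
    and add: "\<And>x y. \<lbrakk>x \<in> carrier T; y \<in> carrier T; P x; P y\<rbrakk> \<Longrightarrow> P (x \<otimes>\<^bsub>T\<^esub> y)"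
  shows "P x"
proof -
  have one: "pure \<zero>\<^bsub>A\<^esub> b = \<one>\<^bsub>T\<^esub>" if "b \<in> carrier B" for b
    using pure_add_left[of "\<zero>\<^bsub>A\<^esub>" "\<zero>\<^bsub>A\<^esub>" b] pure_closed[of "\<zero>\<^bsub>A\<^esub>" b] that
    by (simp add: T.l_cancel_one)
  have inv: "inv\<^bsub>T\<^esub> pure a b = pure (\<ominus>\<^bsub>A\<^esub> a) b" if "a \<in> carrier A" "b \<in> carrier B" for a b
    using pure_add_left[of "\<ominus>\<^bsub>A\<^esub> a" a b] that
    by (intro T.inv_equality) (simp_all add: A.M.l_neg one pure_closed)
  obtain c where c: "Poly_Mapping.keys c \<subseteq> carrier A \<times> carrier B" "x = coset c"
    using assms(1) by (auto simp: carrier_T)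
  have "P (coset c) \<and> P (inv\<^bsub>T\<^esub> coset c)"
  proof (rule free_Abelian_group_induct[OF c(1), where P = "\<lambda>c. P (coset c) \<and> P (inv\<^bsub>T\<^esub> coset c)"])
    have "coset 0 = \<one>\<^bsub>T\<^esub>" using cl.hom_one by simp
    then show "P (coset 0) \<and> P (inv\<^bsub>T\<^esub> coset 0)"
      using pure[of "\<zero>\<^bsub>A\<^esub>" "\<zero>\<^bsub>B\<^esub>"] one[of "\<zero>\<^bsub>B\<^esub>"] by simp
  next
    fix c d
    assume *: "Poly_Mapping.keys c \<subseteq> carrier A \<times> carrier B" "Poly_Mapping.keys d \<subseteq> carrier A \<times> carrier B"
      "P (coset c) \<and> P (inv\<^bsub>T\<^esub> coset c)" "P (coset d) \<and> P (inv\<^bsub>T\<^esub> coset d)"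
    then have c: "coset c \<in> carrier T" "coset d \<in> carrier T" by simp_all
    have eq: "coset (c - d) = coset c \<otimes>\<^bsub>T\<^esub> inv\<^bsub>T\<^esub> coset d" using * by (simp add: coset_diff)
    show "P (coset (c - d)) \<and> P (inv\<^bsub>T\<^esub> coset (c - d))" using * c unfolding eq
      by (auto intro!: add simp: T.inv_mult)
  next
    fix z assume "z \<in> carrier A \<times> carrier B"
    then show "P (coset (frag_of z)) \<and> P (inv\<^bsub>T\<^esub> coset (frag_of z))"
      using pure pure[of "\<ominus>\<^bsub>A\<^esub> fst z" "snd z"] inv[of "fst z" "snd z"]
      by (cases z) (auto simp: pure_tensor_def)
  qed
  then show ?thesis using c by simp
qed

text \<open>The universal property. The evaluation \<open>\<Phi>\<close> of formal sums is a homomorphism on the free abelian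
group and kills the defining relations, so it is constant on cosets; its value is the only element
of the image of a coset, which is what \<open>tensor_lift\<close> returns.\<close>

lemma
  assumes "comm_group G"
    and closed: "\<And>a b. \<lbrakk>a \<in> carrier A; b \<in> carrier B\<rbrakk> \<Longrightarrow> h a b \<in> carrier G"
    and addl: "\<And>a a' b. \<lbrakk>a \<in> carrier A; a' \<in> carrier A; b \<in> carrier B\<rbrakk> \<Longrightarrow> h (a \<oplus>\<^bsub>A\<^esub> a') b = h a b \<otimes>\<^bsub>G\<^esub> h a' b"
    and addr: "\<And>a b b'. \<lbrakk>a \<in> carrier A; b \<in> carrier B; b' \<in> carrier B\<rbrakk> \<Longrightarrow> h a (b \<oplus>\<^bsub>B\<^esub> b') = h a b \<otimes>\<^bsub>G\<^esub> h a b'"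
    and bal: "\<And>r a b. \<lbrakk>r \<in> carrier K; a \<in> carrier A; b \<in> carrier B\<rbrakk> \<Longrightarrow> h (r \<odot>\<^bsub>A\<^esub> a) b = h a (r \<odot>\<^bsub>B\<^esub> b)"
  shows tensor_lift_hom: "tensor_lift G h \<in> hom T G"
    and tensor_lift_pure: "\<lbrakk>a \<in> carrier A; b \<in> carrier B\<rbrakk> \<Longrightarrow> tensor_lift G h (pure a b) = h a b"
proof -
  interpret G: comm_group G by fact
  define \<Phi> where "\<Phi> p = (\<Otimes>\<^bsub>G\<^esub>z\<in>Poly_Mapping.keys p. h (fst z) (snd z) [^]\<^bsub>G\<^esub> Poly_Mapping.lookup p z)"
    for p :: "'a \<times> 'b \<Rightarrow>\<^sub>0 int"
  have hz: "h (fst z) (snd z) \<in> carrier G" if "z \<in> carrier A \<times> carrier B" for z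
    using that closed by auto
  have \<Phi>_eq: "\<Phi> p = (\<Otimes>\<^bsub>G\<^esub>z\<in>S. h (fst z) (snd z) [^]\<^bsub>G\<^esub> Poly_Mapping.lookup p z)"
    if "finite S" "Poly_Mapping.keys p \<subseteq> S" "S \<subseteq> carrier A \<times> carrier B" for p S
    unfolding \<Phi>_def using that hz
    by (intro G.finprod_mono_neutral_cong_left) (auto simp: in_keys_iff subset_iff int_pow_0 intro!: G.int_pow_closed)
  have hom: "\<Phi> \<in> hom F G"
  proof (rule homI)
    fix p assume "p \<in> carrier F"
    then show "\<Phi> p \<in> carrier G"
      unfolding \<Phi>_def using hz by (intro G.finprod_closed) auto
  next
    fix p q assume pq: "p \<in> carrier F" "q \<in> carrier F"
    let ?S = "Poly_Mapping.keys p \<union> Poly_Mapping.keys q"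
    have S: "finite ?S" "?S \<subseteq> carrier A \<times> carrier B" using pq by auto
    have "\<Phi> (p + q) = (\<Otimes>\<^bsub>G\<^esub>z\<in>?S. h (fst z) (snd z) [^]\<^bsub>G\<^esub> Poly_Mapping.lookup (p + q) z)"
      using S keys_add[of p q] by (intro \<Phi>_eq) auto
    also have "\<dots> = (\<Otimes>\<^bsub>G\<^esub>z\<in>?S. h (fst z) (snd z) [^]\<^bsub>G\<^esub> Poly_Mapping.lookup p z
        \<otimes>\<^bsub>G\<^esub> h (fst z) (snd z) [^]\<^bsub>G\<^esub> Poly_Mapping.lookup q z)"
      using S hz by (intro G.finprod_cong') (auto simp: lookup_add G.int_pow_mult Pi_def)
    also have "\<dots> = \<Phi> p \<otimes>\<^bsub>G\<^esub> \<Phi> q"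
      using S hz by (subst G.finprod_multf) (auto simp: \<Phi>_eq[OF S(1) _ S(2)] Pi_def)
    finally show "\<Phi> (p \<otimes>\<^bsub>F\<^esub> q) = \<Phi> p \<otimes>\<^bsub>G\<^esub> \<Phi> q" by simp
  qed
  interpret \<Phi>: group_hom F G \<Phi>
    by (simp add: group_hom_def group_hom_axioms_def hom)
  have \<Phi>_diff: "\<Phi> (c - d) = \<Phi> c \<otimes>\<^bsub>G\<^esub> inv\<^bsub>G\<^esub> \<Phi> d" if "c \<in> carrier F" "d \<in> carrier F" for c d
  proof -
    have "\<Phi> (c \<otimes>\<^bsub>F\<^esub> inv\<^bsub>F\<^esub> d) = \<Phi> c \<otimes>\<^bsub>G\<^esub> inv\<^bsub>G\<^esub> \<Phi> d"
      using that \<Phi>.hom_mult[of c "inv\<^bsub>F\<^esub> d"] \<Phi>.hom_inv[of d] cl.G.inv_closed[of d] by metis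
    then show ?thesis using that by simp
  qed
  have \<Phi>_frag: "\<Phi> (frag_of (a, b)) = h a b" if "a \<in> carrier A" "b \<in> carrier B" for a b
    unfolding \<Phi>_def using that closed[OF that] by (simp add: G.int_pow_1)
  have ker: "\<Phi> c = \<one>\<^bsub>G\<^esub>" if "c \<in> tensor_kernel K A B" for c
    using that unfolding tensor_kernel_def
  proof (induction rule: generate.induct)
    case one
    show ?case by (rule \<Phi>.hom_one)
  next
    have cancel: "x \<otimes>\<^bsub>G\<^esub> y \<otimes>\<^bsub>G\<^esub> inv\<^bsub>G\<^esub> x \<otimes>\<^bsub>G\<^esub> inv\<^bsub>G\<^esub> y = \<one>\<^bsub>G\<^esub>"
      if "x \<in> carrier G" "y \<in> carrier G" for x y
      using that by (simp add: G.m_comm[of x y] G.m_assoc[of y x "inv\<^bsub>G\<^esub> x"])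
    have rel: "\<Phi> c = \<one>\<^bsub>G\<^esub>" if "c \<in> tensor_relations K A B" for c
      using that closed unfolding tensor_relations_def
      by (auto simp: \<Phi>_diff diff_closed \<Phi>_frag addl addr bal cancel simp del: carrier_free_Abelian_group_iff)
    {
      case (incl c)
      then show ?case by (rule rel)
    next
      case (inv c)
      then have "c \<in> carrier F" using tensor_relations_carrier by (rule subsetD[rotated])
      then show ?case using rel[OF inv] by (simp only: \<Phi>.hom_inv G.inv_one)
    }
  next
    case (eng c d)
    then have "c \<in> carrier F" "d \<in> carrier F"
      by (simp_all only: cl.G.generate_in_carrier[OF tensor_relations_carrier])
    with eng show ?case by (simp only: \<Phi>.hom_mult G.l_one G.one_closed)
  qed
  have val: "tensor_lift G h (coset c) = \<Phi> c" if c: "c \<in> carrier F" for c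
  proof -
    have "\<Phi> ` coset c = {\<Phi> c}"
    proof -
      have "\<Phi> x = \<Phi> c" if x: "x \<in> coset c" for x
      proof -
        obtain n where n: "n \<in> tensor_kernel K A B" "x = n \<otimes>\<^bsub>F\<^esub> c"
          using x unfolding r_coset_def by blast
        then have "n \<in> carrier F"
          by (intro subgroup.mem_carrier[OF normal_imp_subgroup[OF normal_tensor_kernel]])
        then show ?thesis using ker[OF n(1)] c
          by (simp add: n(2) \<Phi>.hom_mult del: mult_free_Abelian_group carrier_free_Abelian_group_iff)
      qed
      moreover have "c \<in> coset c"
        using cl.G.rcos_self[OF c normal_imp_subgroup[OF normal_tensor_kernel]] .
      ultimately show ?thesis by blast
    qed
    then show ?thesis unfolding tensor_lift_def \<Phi>_def by simp
  qed
  have closed: "tensor_lift G h x \<in> carrier G" if "x \<in> carrier T" for x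
  proof -
    obtain c where c: "c \<in> carrier F" "x = coset c" using \<open>x \<in> carrier T\<close> by (rule T_cases)
    show ?thesis unfolding c(2) val[OF c(1)] by (rule \<Phi>.hom_closed[OF c(1)])
  qed
  have mult: "tensor_lift G h (x \<otimes>\<^bsub>T\<^esub> y) = tensor_lift G h x \<otimes>\<^bsub>G\<^esub> tensor_lift G h y"
    if "x \<in> carrier T" "y \<in> carrier T" for x y
  proof -
    obtain c where c: "c \<in> carrier F" "x = coset c" using \<open>x \<in> carrier T\<close> by (rule T_cases)
    obtain d where d: "d \<in> carrier F" "y = coset d" using \<open>y \<in> carrier T\<close> by (rule T_cases)
    note cd = c(1) d(1) c(2) d(2)
    have "x \<otimes>\<^bsub>T\<^esub> y = coset (c \<otimes>\<^bsub>F\<^esub> d)"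
      unfolding cd(3,4) by (rule cl.hom_mult[OF cd(1,2), symmetric])
    then have "tensor_lift G h (x \<otimes>\<^bsub>T\<^esub> y) = \<Phi> (c \<otimes>\<^bsub>F\<^esub> d)"
      using val[OF cl.G.m_closed[OF cd(1,2)]] by (rule ssubst)
    then show ?thesis
      unfolding cd(3,4) val[OF cd(1)] val[OF cd(2)] \<Phi>.hom_mult[OF cd(1,2)] .
  qed
  show "tensor_lift G h \<in> hom T G" using closed mult by (rule homI)
  show "tensor_lift G h (pure a b) = h a b" if "a \<in> carrier A" "b \<in> carrier B"
  proof -
    have "frag_of (a, b) \<in> carrier F" using that by simp
    then show ?thesis unfolding pure_tensor_def by (simp only: val \<Phi>_frag that)
  qed
qed

end

context module_pair
begin

lemma carrier_tensor: "carrier (tensor_algebra K A B) = carrier T"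
  and add_tensor: "x \<oplus>\<^bsub>tensor_algebra K A B\<^esub> y = x \<otimes>\<^bsub>T\<^esub> y"
  and zero_tensor: "\<zero>\<^bsub>tensor_algebra K A B\<^esub> = \<one>\<^bsub>T\<^esub>"
  and smult_tensor: "r \<odot>\<^bsub>tensor_algebra K A B\<^esub> x = tensor_lift T (\<lambda>a b. pure (r \<odot>\<^bsub>A\<^esub> a) b) x"
  by (simp_all add: tensor_algebra_def Let_def)

text \<open>The tensor product carries two presentations of the same group: as \<open>tensor_group\<close> and as the additive
group of the record \<open>tensor_algebra\<close>. The multiplication and the scalar multiplication of that record
are defined through the first one, while lifts into a module use the second.\<close>

lemma tensor_lift_T: "tensor_lift T h = tensor_lift (add_monoid (tensor_algebra K A B)) h"
  by (simp add: fun_eq_iff tensor_lift_def finprod_def int_pow_def nat_pow_def m_inv_def tensor_algebra_def Let_def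
      cong: if_cong)

lemma
  assumes "r \<in> carrier K"
  shows smult_tensor_hom: "(\<lambda>x. r \<odot>\<^bsub>tensor_algebra K A B\<^esub> x) \<in> hom T T"
    and smult_tensor_pure: "\<lbrakk>a \<in> carrier A; b \<in> carrier B\<rbrakk>
      \<Longrightarrow> r \<odot>\<^bsub>tensor_algebra K A B\<^esub> pure a b = pure (r \<odot>\<^bsub>A\<^esub> a) b"
proof -
  have bal: "pure (r \<odot>\<^bsub>A\<^esub> (s \<odot>\<^bsub>A\<^esub> a)) b = pure (r \<odot>\<^bsub>A\<^esub> a) (s \<odot>\<^bsub>B\<^esub> b)"
    if "s \<in> carrier K" "a \<in> carrier A" "b \<in> carrier B" for s a b
  proof -
    have "r \<odot>\<^bsub>A\<^esub> (s \<odot>\<^bsub>A\<^esub> a) = s \<odot>\<^bsub>A\<^esub> (r \<odot>\<^bsub>A\<^esub> a)"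
      using that assms by (simp add: A.smult_assoc1[symmetric] A.R.m_comm)
    then show ?thesis using that assms by (simp add: pure_balanced)
  qed
  note h = pure_closed pure_add_left pure_add_right A.smult_r_distr A.smult_closed assms
  show "(\<lambda>x. r \<odot>\<^bsub>tensor_algebra K A B\<^esub> x) \<in> hom T T"
    unfolding smult_tensor by (rule tensor_lift_hom[OF comm_group_T _ _ _ bal]) (simp_all add: h)
  show "r \<odot>\<^bsub>tensor_algebra K A B\<^esub> pure a b = pure (r \<odot>\<^bsub>A\<^esub> a) b"
    if "a \<in> carrier A" "b \<in> carrier B"
    unfolding smult_tensor by (rule tensor_lift_pure[OF comm_group_T _ _ _ bal]) (simp_all add: h that)
qed

lemma tensor_module: "module K (tensor_algebra K A B)"
proof (rule moduleI)
  show "cring K" by (rule A.R.is_cring)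
  show "abelian_group (tensor_algebra K A B)"
  proof (rule abelian_groupI)
    fix x assume x: "x \<in> carrier (tensor_algebra K A B)"
    show "\<exists>y\<in>carrier (tensor_algebra K A B). y \<oplus>\<^bsub>tensor_algebra K A B\<^esub> x = \<zero>\<^bsub>tensor_algebra K A B\<^esub>"
      using x by (intro bexI[of _ "inv\<^bsub>T\<^esub> x"]) (simp_all add: carrier_tensor add_tensor zero_tensor)
  qed (simp_all add: carrier_tensor add_tensor zero_tensor T.m_ac)
  show "r \<odot>\<^bsub>tensor_algebra K A B\<^esub> x \<in> carrier (tensor_algebra K A B)"
    if "r \<in> carrier K" "x \<in> carrier (tensor_algebra K A B)" for r x
    using that hom_in_carrier[OF smult_tensor_hom] by (simp add: carrier_tensor)
  show "r \<odot>\<^bsub>tensor_algebra K A B\<^esub> (x \<oplus>\<^bsub>tensor_algebra K A B\<^esub> y)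
      = r \<odot>\<^bsub>tensor_algebra K A B\<^esub> x \<oplus>\<^bsub>tensor_algebra K A B\<^esub> r \<odot>\<^bsub>tensor_algebra K A B\<^esub> y"
    if "r \<in> carrier K" "x \<in> carrier (tensor_algebra K A B)" "y \<in> carrier (tensor_algebra K A B)" for r x y
    using that hom_mult[OF smult_tensor_hom] by (simp add: carrier_tensor add_tensor)
  show "(r \<oplus>\<^bsub>K\<^esub> s) \<odot>\<^bsub>tensor_algebra K A B\<^esub> x
      = r \<odot>\<^bsub>tensor_algebra K A B\<^esub> x \<oplus>\<^bsub>tensor_algebra K A B\<^esub> s \<odot>\<^bsub>tensor_algebra K A B\<^esub> x"
    if rs: "r \<in> carrier K" "s \<in> carrier K" and x: "x \<in> carrier (tensor_algebra K A B)" for r s x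
    using x unfolding carrier_tensor add_tensor
  proof (induction rule: T_induct)
    case (pure a b)
    then show ?case using rs by (simp add: smult_tensor_pure A.smult_l_distr pure_add_left)
  next
    case (add x y)
    then show ?case
      using rs hom_in_carrier[OF smult_tensor_hom] by (simp add: hom_mult[OF smult_tensor_hom] T.m_ac)
  qed
  show "(r \<otimes>\<^bsub>K\<^esub> s) \<odot>\<^bsub>tensor_algebra K A B\<^esub> x
      = r \<odot>\<^bsub>tensor_algebra K A B\<^esub> (s \<odot>\<^bsub>tensor_algebra K A B\<^esub> x)"
    if rs: "r \<in> carrier K" "s \<in> carrier K" and x: "x \<in> carrier (tensor_algebra K A B)" for r s x
    using x unfolding carrier_tensor
  proof (induction rule: T_induct)
    case (pure a b)
    then show ?case using rs by (simp add: smult_tensor_pure A.smult_assoc1)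
  next
    case (add x y)
    then show ?case
      using rs hom_in_carrier[OF smult_tensor_hom] by (simp add: hom_mult[OF smult_tensor_hom])
  qed
  show "\<one>\<^bsub>K\<^esub> \<odot>\<^bsub>tensor_algebra K A B\<^esub> x = x" if x: "x \<in> carrier (tensor_algebra K A B)" for x
    using x unfolding carrier_tensor
  proof (induction rule: T_induct)
    case (pure a b)
    then show ?case by (simp add: smult_tensor_pure)
  next
    case (add x y)
    then show ?case by (simp add: hom_mult[OF smult_tensor_hom])
  qed
qed

lemma pure_tensor_bilinear: "bilinear_map K A B (tensor_algebra K A B) pure"
  by (rule bilinear_mapI; rule linear_mapI)
    (simp_all add: carrier_tensor add_tensor pure_closed pure_add_left pure_add_right smult_tensor_pure pure_balanced)

lemmas tensor_induct = T_induct[folded carrier_tensor add_tensor, consumes 1, case_names pure add]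

lemma
  assumes "module K M" and h: "bilinear_map K A B M h"
  shows tensor_lift_linear: "linear_map K (tensor_algebra K A B) M (tensor_lift (add_monoid M) h)"
    and tensor_lift_eq: "\<lbrakk>a \<in> carrier A; b \<in> carrier B\<rbrakk> \<Longrightarrow> tensor_lift (add_monoid M) h (pure a b) = h a b"
proof -
  interpret M: module K M by fact
  note hs = bilinear_map_closed[OF h] bilinear_map_add_left[OF h] bilinear_map_add_right[OF h]
    bilinear_map_smult_left[OF h] bilinear_map_smult_right[OF h]
  have hom: "tensor_lift (add_monoid M) h \<in> hom T (add_monoid M)"
    by (rule tensor_lift_hom[OF M.a_comm_group]) (simp_all add: hs)
  show eq: "tensor_lift (add_monoid M) h (pure a b) = h a b" if "a \<in> carrier A" "b \<in> carrier B" for a b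
    by (rule tensor_lift_pure[OF M.a_comm_group]) (simp_all add: hs that)
  have closed: "tensor_lift (add_monoid M) h x \<in> carrier M" if "x \<in> carrier T" for x
    using hom_in_carrier[OF hom that] by simp
  have plus: "tensor_lift (add_monoid M) h (x \<otimes>\<^bsub>T\<^esub> y) = tensor_lift (add_monoid M) h x \<oplus>\<^bsub>M\<^esub> tensor_lift (add_monoid M) h y"
    if "x \<in> carrier T" "y \<in> carrier T" for x y
    using hom_mult[OF hom that] by simp
  have sm: "tensor_lift (add_monoid M) h (r \<odot>\<^bsub>tensor_algebra K A B\<^esub> x) = r \<odot>\<^bsub>M\<^esub> tensor_lift (add_monoid M) h x"
    if r: "r \<in> carrier K" and "x \<in> carrier T" for r x
    using that(2)
  proof (induction rule: T_induct)
    case (pure a b)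
    then show ?case using r by (simp add: smult_tensor_pure eq hs)
  next
    case (add x y)
    then show ?case
      using r hom_in_carrier[OF smult_tensor_hom[OF r]]
      by (simp add: hom_mult[OF smult_tensor_hom] plus closed M.smult_r_distr)
  qed
  show "linear_map K (tensor_algebra K A B) M (tensor_lift (add_monoid M) h)"
    by (rule linear_mapI) (simp_all add: carrier_tensor add_tensor closed plus sm)
qed

lemma tensor_linear_eqI:
  assumes "linear_map K (tensor_algebra K A B) M f" "linear_map K (tensor_algebra K A B) M g"
    and "\<And>a b. \<lbrakk>a \<in> carrier A; b \<in> carrier B\<rbrakk> \<Longrightarrow> f (pure a b) = g (pure a b)"
    and "x \<in> carrier (tensor_algebra K A B)"
  shows "f x = g x"
  using assms(4)
  by (induction rule: tensor_induct)
    (simp_all add: assms(3) linear_map_add[OF assms(1)] linear_map_add[OF assms(2)])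

end

definition quadrilinear_map where
  "quadrilinear_map K A B C D M q \<longleftrightarrow>
    (\<forall>a\<in>carrier A. \<forall>b\<in>carrier B. bilinear_map K C D M (q a b)) \<and>
    (\<forall>c\<in>carrier C. \<forall>d\<in>carrier D. bilinear_map K A B M (\<lambda>a b. q a b c d))"

text \<open>The two sides of each linearity identity in \<open>c\<close> are linear in \<open>x\<close> and agree on pure tensors.\<close>

lemma tensor_lift_bilinear:
  assumes m: "module K A" "module K B" "module K C" "module K M"
    and h: "\<And>c. c \<in> carrier C \<Longrightarrow> bilinear_map K A B M (h c)"
    and h': "\<And>a b. \<lbrakk>a \<in> carrier A; b \<in> carrier B\<rbrakk> \<Longrightarrow> linear_map K C M (\<lambda>c. h c a b)"
  shows "bilinear_map K (tensor_algebra K A B) C M (\<lambda>x c. tensor_lift (add_monoid M) (h c) x)"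
proof (rule bilinear_mapI)
  interpret AB: module_pair K A B using m by (simp add: module_pair_def)
  interpret C: module K C by (rule m(3))
  note lin = AB.tensor_lift_linear[OF m(4) h]
  note val = AB.tensor_lift_eq[OF m(4) h]
  let ?L = "\<lambda>c. tensor_lift (add_monoid M) (h c)"
  show "linear_map K (tensor_algebra K A B) M (\<lambda>x. ?L c x)" if "c \<in> carrier C" for c
    by (rule lin[OF that])
  show "linear_map K C M (\<lambda>c. ?L c x)" if x: "x \<in> carrier (tensor_algebra K A B)" for x
  proof (rule linear_mapI)
    show "?L c x \<in> carrier M" if "c \<in> carrier C" for c
      by (rule linear_map_closed[OF lin[OF that] x])
    show "?L (c \<oplus>\<^bsub>C\<^esub> c') x = ?L c x \<oplus>\<^bsub>M\<^esub> ?L c' x" if "c \<in> carrier C" "c' \<in> carrier C" for c c'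
      by (rule AB.tensor_linear_eqI[OF lin linear_map_sum[OF lin lin m(4)] _ x])
        (simp_all add: that val linear_map_add[OF h'])
    show "?L (r \<odot>\<^bsub>C\<^esub> c) x = r \<odot>\<^bsub>M\<^esub> ?L c x" if "r \<in> carrier K" "c \<in> carrier C" for r c
      by (rule AB.tensor_linear_eqI[OF lin linear_map_scaled[OF lin m(4)] _ x])
        (simp_all add: that val linear_map_smult[OF h'])
  qed
qed

text \<open>The inner lift is linear in \<open>y\<close> and, as a lift that depends on parameters, also in \<open>a\<close> and in \<open>b\<close>.
The nested lift has the shape in which the multiplication of a tensor product and the actions of a
tensor product of extensions are defined.\<close>

lemma tensor_lift_twice_bilinear:
  assumes m: "module K A" "module K B" "module K C" "module K D" "module K M"
    and q: "quadrilinear_map K A B C D M q"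
  shows "bilinear_map K (tensor_algebra K A B) (tensor_algebra K C D) M
    (\<lambda>x y. tensor_lift (add_monoid M) (\<lambda>a b. tensor_lift (add_monoid M) (q a b) y) x)"
proof -
  interpret CD: module_pair K C D using m by (simp add: module_pair_def)
  have q1: "bilinear_map K C D M (q a b)" if "a \<in> carrier A" "b \<in> carrier B" for a b
    using q that by (simp add: quadrilinear_map_def)
  have q2: "bilinear_map K A B M (\<lambda>a b. q a b c d)" if "c \<in> carrier C" "d \<in> carrier D" for c d
    using q that by (simp add: quadrilinear_map_def)
  have inner: "bilinear_map K A B M (\<lambda>a b. tensor_lift (add_monoid M) (q a b) y)"
    if y: "y \<in> carrier (tensor_algebra K C D)" for y
  proof (rule bilinear_mapI)
    show "linear_map K B M (\<lambda>b. tensor_lift (add_monoid M) (q a b) y)" if a: "a \<in> carrier A" for a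
      by (rule bilinear_map_right[OF tensor_lift_bilinear[OF m(3,4,2,5) q1[OF a] bilinear_map_right[OF q2 a]] y])
    show "linear_map K A M (\<lambda>a. tensor_lift (add_monoid M) (q a b) y)" if b: "b \<in> carrier B" for b
      by (rule bilinear_map_right[OF tensor_lift_bilinear[OF m(3,4,1,5) q1[OF _ b] bilinear_map_left[OF q2 b]] y])
  qed
  show ?thesis
    by (rule tensor_lift_bilinear[OF m(1,2) CD.tensor_module m(5) inner CD.tensor_lift_linear[OF m(5) q1]])
qed

lemma tensor_lift_twice_pure:
  assumes "module K A" "module K B" "module K C" "module K D" "module K M"
    and q: "quadrilinear_map K A B C D M q"
    and "a \<in> carrier A" "b \<in> carrier B" "c \<in> carrier C" "d \<in> carrier D"
  shows "tensor_lift (add_monoid M) (\<lambda>a b. tensor_lift (add_monoid M) (q a b) (pure_tensor K C D c d))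
      (pure_tensor K A B a b) = q a b c d"
proof -
  interpret AB: module_pair K A B using assms by (simp add: module_pair_def)
  interpret CD: module_pair K C D using assms by (simp add: module_pair_def)
  have q1: "bilinear_map K C D M (q a b)" if "a \<in> carrier A" "b \<in> carrier B" for a b
    using q that by (simp add: quadrilinear_map_def)
  have q2: "bilinear_map K A B M (\<lambda>a b. q a b c d)"
    using q assms by (simp add: quadrilinear_map_def)
  have inner: "tensor_lift (add_monoid M) (q a b) (pure_tensor K C D c d) = q a b c d"
    if "a \<in> carrier A" "b \<in> carrier B" for a b
    using CD.tensor_lift_eq[OF assms(5) q1[OF that]] assms by blast
  have "bilinear_map K A B M (\<lambda>a b. tensor_lift (add_monoid M) (q a b) (pure_tensor K C D c d))"
    by (rule bilinear_map_cong[OF q2 assms(1,2)]) (simp add: inner)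
  then show ?thesis
    using AB.tensor_lift_eq[OF assms(5)] assms inner by simp
qed

section \<open>Copies inside the universe\<close>

lemma inj_on_to_univ:
  assumes "carrier M \<lesssim> (UNIV :: 'u set)"
  shows "inj_on (to_univ M :: _ \<Rightarrow> 'u) (carrier M)"
proof -
  obtain f :: "_ \<Rightarrow> 'u" where "inj_on f (carrier M)" using assms unfolding lepoll_def by blast
  then show ?thesis unfolding to_univ_def by (rule someI[of "\<lambda>f. inj_on f (carrier M)"])
qed

context
  fixes M :: "('k, 'c, 'p) module_scheme" and u :: "'c \<Rightarrow> 'u"
  assumes u_def: "u = to_univ M" and inj: "inj_on u (carrier M)"
begin

lemma of_univ_to_univ: "x \<in> carrier M \<Longrightarrow> of_univ M (u x) = x"
  using inv_into_f_f[OF inj] by (simp add: of_univ_def u_def)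

lemma carrier_univ_copy: "carrier (univ_copy M) = u ` carrier M"
  by (simp add: univ_copy_def u_def)

lemma
  shows zero_univ_copy: "\<zero>\<^bsub>univ_copy M\<^esub> = u \<zero>\<^bsub>M\<^esub>"
  and add_univ_copy: "\<lbrakk>x \<in> carrier M; y \<in> carrier M\<rbrakk> \<Longrightarrow> u x \<oplus>\<^bsub>univ_copy M\<^esub> u y = u (x \<oplus>\<^bsub>M\<^esub> y)"
  and smult_univ_copy: "x \<in> carrier M \<Longrightarrow> r \<odot>\<^bsub>univ_copy M\<^esub> u x = u (r \<odot>\<^bsub>M\<^esub> x)"
  and mult_univ_copy: "\<lbrakk>x \<in> carrier M; y \<in> carrier M\<rbrakk> \<Longrightarrow> u x \<otimes>\<^bsub>univ_copy M\<^esub> u y = u (x \<otimes>\<^bsub>M\<^esub> y)"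
  using of_univ_to_univ by (simp_all add: univ_copy_def u_def)

lemma
  assumes "module K M"
  shows module_univ_copy: "module K (univ_copy M :: ('k, 'u) module)"
    and to_univ_linear: "linear_map K M (univ_copy M) u"
    and of_univ_linear: "linear_map K (univ_copy M :: ('k, 'u) module) M (of_univ M)"
proof -
  interpret M: module K M by fact
  note simps = carrier_univ_copy zero_univ_copy add_univ_copy smult_univ_copy
  show "module K (univ_copy M :: ('k, 'u) module)"
  proof (rule moduleI)
    show "cring K" by (rule M.R.is_cring)
    show "abelian_group (univ_copy M :: ('k, 'u) module)"
    proof (rule abelian_groupI)
      fix x :: 'u assume "x \<in> carrier (univ_copy M)"
      then obtain z where z: "z \<in> carrier M" "x = u z" by (auto simp: simps)
      then have "u (\<ominus>\<^bsub>M\<^esub> z) \<oplus>\<^bsub>univ_copy M\<^esub> x = \<zero>\<^bsub>univ_copy M\<^esub>"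
        by (simp add: simps M.l_neg)
      then show "\<exists>y\<in>carrier (univ_copy M). y \<oplus>\<^bsub>univ_copy M\<^esub> x = \<zero>\<^bsub>univ_copy M\<^esub>"
        using z by (intro bexI[of _ "u (\<ominus>\<^bsub>M\<^esub> z)"]) (auto simp: simps)
    qed (auto simp: simps M.a_ac)
  qed (auto simp: simps M.smult_l_distr M.smult_r_distr M.smult_assoc1)
  show "linear_map K M (univ_copy M) u"
    by (rule linear_mapI) (simp_all add: simps)
  show "linear_map K (univ_copy M :: ('k, 'u) module) M (of_univ M)"
    by (rule linear_mapI) (auto simp: simps of_univ_to_univ)
qed

end

section \<open>Tensor products inside the universe\<close>

text \<open>The parameter \<open>U\<close> only fixes the type \<open>'u\<close> of the elements of all objects.\<close>

locale ndi_universe =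
  fixes K :: "('k, 'm) ring_scheme" and U :: "'u itself"
  assumes cring_K: "cring K"
    and infinite_universe: "infinite (UNIV :: 'u set)"
    and scalars_lepoll: "carrier K \<lesssim> (UNIV :: 'u set)"
begin

abbreviation tensor_obj :: "('k, 'u) module \<Rightarrow> ('k, 'u) module \<Rightarrow> ('k, 'u) module"  (infixr "\<boxtimes>" 70)
  where "A \<boxtimes> B \<equiv> ndi_tensor K A B"

abbreviation pure :: "('k, 'u) module \<Rightarrow> ('k, 'u) module \<Rightarrow> 'u \<Rightarrow> 'u \<Rightarrow> 'u"
  where "pure A B \<equiv> ndi_pure K A B"

text \<open>$A \otimes B$ is a quotient of the free abelian group on $A \times B$, and the free abelian group on an
infinite set is equipotent to that set.\<close>

lemma tensor_lepoll:
  fixes A B :: "('k, 'u) module"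
  assumes "module K A" "module K B"
  shows "carrier (tensor_algebra K A B) \<lesssim> (UNIV :: 'u set)"
proof -
  interpret X: module_pair K A B using assms by (simp add: module_pair_def)
  let ?UU = "UNIV :: ('u \<times> 'u) set"
  have UU: "?UU \<lesssim> (UNIV :: 'u set)"
    using card_of_Times_same_infinite[OF infinite_universe]
    by (simp add: eqpoll_iff_card_of_ordIso[symmetric] eqpoll_imp_lepoll)
  have "carrier (tensor_algebra K A B) \<lesssim> carrier X.F"
    unfolding X.carrier_tensor X.carrier_T by (rule image_lepoll)
  also have "carrier X.F \<lesssim> carrier (free_Abelian_group ?UU)"
    by (rule subset_imp_lepoll) auto
  also have "carrier (free_Abelian_group ?UU) \<approx> ?UU"
    by (rule eqpoll_free_Abelian_group_infinite) (use infinite_universe in \<open>simp add: finite_prod\<close>)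
  also note UU
  finally show ?thesis .
qed

lemma
  assumes "module K A" "module K B"
  shows inj_on_to_univ_tensor: "inj_on (to_univ (tensor_algebra K A B) :: _ \<Rightarrow> 'u) (carrier (tensor_algebra K A B))"
    and ndi_tensor_module: "module K (A \<boxtimes> B)"
    and pure_bilinear: "bilinear_map K A B (A \<boxtimes> B) (pure A B)"
    and pure_closed: "\<lbrakk>a \<in> carrier A; b \<in> carrier B\<rbrakk> \<Longrightarrow> pure A B a b \<in> carrier (A \<boxtimes> B)"
proof -
  interpret X: module_pair K A B using assms by (simp add: module_pair_def)
  show inj: "inj_on (to_univ (tensor_algebra K A B) :: _ \<Rightarrow> 'u) (carrier (tensor_algebra K A B))"
    by (rule inj_on_to_univ[OF tensor_lepoll[OF assms]])
  show "module K (A \<boxtimes> B)"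
    unfolding ndi_tensor_def by (rule module_univ_copy[OF refl inj X.tensor_module])
  show bil: "bilinear_map K A B (A \<boxtimes> B) (pure A B)"
    unfolding ndi_tensor_def ndi_pure_def
    by (rule bilinear_map_compose[OF X.pure_tensor_bilinear linear_map_id linear_map_id
          to_univ_linear[OF refl inj X.tensor_module]])
  show "\<lbrakk>a \<in> carrier A; b \<in> carrier B\<rbrakk> \<Longrightarrow> pure A B a b \<in> carrier (A \<boxtimes> B)"
    by (rule bilinear_map_closed[OF bil])
qed

lemma ndi_tensor_induct [consumes 3, case_names pure add]:
  assumes "module K A" "module K B" "x \<in> carrier (A \<boxtimes> B)"
    and pure: "\<And>a b. \<lbrakk>a \<in> carrier A; b \<in> carrier B\<rbrakk> \<Longrightarrow> P (pure A B a b)"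
    and add: "\<And>x y. \<lbrakk>x \<in> carrier (A \<boxtimes> B); y \<in> carrier (A \<boxtimes> B); P x; P y\<rbrakk>
      \<Longrightarrow> P (x \<oplus>\<^bsub>A \<boxtimes> B\<^esub> y)"
  shows "P x"
proof -
  interpret X: module_pair K A B using assms by (simp add: module_pair_def)
  note inj = inj_on_to_univ_tensor[OF assms(1,2)]
  let ?u = "to_univ (tensor_algebra K A B) :: _ \<Rightarrow> 'u"
  note copy = carrier_univ_copy[OF refl inj] add_univ_copy[OF refl inj]
  obtain z where z: "z \<in> carrier (tensor_algebra K A B)" "x = ?u z"
    using assms(3) unfolding ndi_tensor_def copy by blast
  have "P (?u z)" using z(1)
  proof (induction rule: X.tensor_induct)
    case (pure a b)
    then show ?case using assms(4) unfolding ndi_pure_def by blast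
  next
    case (add z w)
    have "P (?u z \<oplus>\<^bsub>A \<boxtimes> B\<^esub> ?u w)"
      by (rule assms(5)) (use add in \<open>simp_all add: ndi_tensor_def copy\<close>)
    then show ?case using add by (simp add: ndi_tensor_def copy)
  qed
  then show ?thesis by (simp add: z)
qed

lemma
  assumes "module K A" "module K B" "module K M" and h: "bilinear_map K A B M h"
  shows ndi_lift_linear: "linear_map K (A \<boxtimes> B) M (ndi_lift K A B M h)"
    and ndi_lift_pure: "\<lbrakk>a \<in> carrier A; b \<in> carrier B\<rbrakk> \<Longrightarrow> ndi_lift K A B M h (pure A B a b) = h a b"
proof -
  interpret X: module_pair K A B using assms by (simp add: module_pair_def)
  note inj = inj_on_to_univ_tensor[OF assms(1,2)]
  show "linear_map K (A \<boxtimes> B) M (ndi_lift K A B M h)"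
    unfolding ndi_lift_def ndi_tensor_def
    by (rule linear_map_compose[OF of_univ_linear[OF refl inj X.tensor_module]])
      (rule X.tensor_lift_linear[OF assms(3) h])
  show "ndi_lift K A B M h (pure A B a b) = h a b" if "a \<in> carrier A" "b \<in> carrier B"
    using that bilinear_map_closed[OF X.pure_tensor_bilinear]
    by (simp add: ndi_lift_def ndi_pure_def of_univ_to_univ[OF refl inj] X.tensor_lift_eq[OF assms(3) h])
qed

lemma ndi_linear_eqI:
  assumes "module K A" "module K B" "linear_map K (A \<boxtimes> B) M f" "linear_map K (A \<boxtimes> B) M g"
    and "\<And>a b. \<lbrakk>a \<in> carrier A; b \<in> carrier B\<rbrakk> \<Longrightarrow> f (pure A B a b) = g (pure A B a b)"
    and "x \<in> carrier (A \<boxtimes> B)"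
  shows "f x = g x"
  using assms(1,2,6)
  by (induction rule: ndi_tensor_induct)
    (simp_all add: assms(5) linear_map_add[OF assms(3)] linear_map_add[OF assms(4)])

lemma ndi_bilinear_eqI:
  assumes "module K A" "module K B" "module K C" "module K D"
    and f: "bilinear_map K (A \<boxtimes> B) (C \<boxtimes> D) M f" and g: "bilinear_map K (A \<boxtimes> B) (C \<boxtimes> D) M g"
    and eq: "\<And>a b c d. \<lbrakk>a \<in> carrier A; b \<in> carrier B; c \<in> carrier C; d \<in> carrier D\<rbrakk>
      \<Longrightarrow> f (pure A B a b) (pure C D c d) = g (pure A B a b) (pure C D c d)"
    and x: "x \<in> carrier (A \<boxtimes> B)" and y: "y \<in> carrier (C \<boxtimes> D)"
  shows "f x y = g x y"
proof (rule ndi_linear_eqI[OF assms(1,2) bilinear_map_left[OF f y] bilinear_map_left[OF g y] _ x])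
  fix a b assume ab: "a \<in> carrier A" "b \<in> carrier B"
  note p = pure_closed[OF assms(1,2) ab]
  show "f (pure A B a b) y = g (pure A B a b) y"
    by (rule ndi_linear_eqI[OF assms(3,4) bilinear_map_right[OF f p] bilinear_map_right[OF g p] _ y])
      (simp add: eq ab)
qed

text \<open>The tensor product $(P \otimes Q) \times (M \otimes N) \to M' \otimes N'$ of two bilinear maps
$h \colon P \times M \to M'$ and $h' \colon Q \times N \to N'$.\<close>

definition tensor_action ::
    "('k, 'u) module \<Rightarrow> ('k, 'u) module \<Rightarrow> ('k, 'u) module \<Rightarrow> ('k, 'u) module \<Rightarrow> ('k, 'u) module \<Rightarrow> ('k, 'u) module
      \<Rightarrow> ('u \<Rightarrow> 'u \<Rightarrow> 'u) \<Rightarrow> ('u \<Rightarrow> 'u \<Rightarrow> 'u) \<Rightarrow> 'u \<Rightarrow> 'u \<Rightarrow> 'u"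
  where "tensor_action P Q M N M' N' h h' x y =
    ndi_lift K P Q (M' \<boxtimes> N') (\<lambda>p q. ndi_lift K M N (M' \<boxtimes> N') (\<lambda>m n. pure M' N' (h p m) (h' q n)) y) x"

lemma
  assumes m: "module K P" "module K Q" "module K M" "module K N" "module K M'" "module K N'"
    and h: "bilinear_map K P M M' h" and h': "bilinear_map K Q N N' h'"
  shows tensor_action_bilinear:
      "bilinear_map K (P \<boxtimes> Q) (M \<boxtimes> N) (M' \<boxtimes> N') (tensor_action P Q M N M' N' h h')"
    and tensor_action_pure: "\<lbrakk>p \<in> carrier P; q \<in> carrier Q; x \<in> carrier M; y \<in> carrier N\<rbrakk>
      \<Longrightarrow> tensor_action P Q M N M' N' h h' (pure P Q p q) (pure M N x y) = pure M' N' (h p x) (h' q y)"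
proof -
  interpret PQ: module_pair K P Q using assms by (simp add: module_pair_def)
  interpret MN: module_pair K M N using assms by (simp add: module_pair_def)
  note injPQ = inj_on_to_univ_tensor[OF m(1,2)]
  note injMN = inj_on_to_univ_tensor[OF m(3,4)]
  note tm = ndi_tensor_module[OF m(5,6)]
  have pure': "bilinear_map K M N (M' \<boxtimes> N') (\<lambda>x y. pure M' N' (f x) (g y))"
    if "linear_map K M M' f" "linear_map K N N' g" for M N f g
    using bilinear_map_compose[OF pure_bilinear[OF m(5,6)] that linear_map_id] .
  have q: "quadrilinear_map K P Q M N (M' \<boxtimes> N') (\<lambda>p q m n. pure M' N' (h p m) (h' q n))"
    unfolding quadrilinear_map_def
    by (auto intro!: pure' bilinear_map_left[OF h] bilinear_map_right[OF h] bilinear_map_left[OF h'] bilinear_map_right[OF h'])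
  show "bilinear_map K (P \<boxtimes> Q) (M \<boxtimes> N) (M' \<boxtimes> N') (tensor_action P Q M N M' N' h h')"
    unfolding tensor_action_def ndi_lift_def
    using bilinear_map_compose[OF tensor_lift_twice_bilinear[OF m(1-4) tm q]
        of_univ_linear[OF refl injPQ PQ.tensor_module] of_univ_linear[OF refl injMN MN.tensor_module]
        linear_map_id]
    unfolding ndi_tensor_def .
  show "tensor_action P Q M N M' N' h h' (pure P Q p q) (pure M N x y) = pure M' N' (h p x) (h' q y)"
    if "p \<in> carrier P" "q \<in> carrier Q" "x \<in> carrier M" "y \<in> carrier N"
    using tensor_lift_twice_pure[OF m(1-4) tm q that] that
      bilinear_map_closed[OF PQ.pure_tensor_bilinear] bilinear_map_closed[OF MN.pure_tensor_bilinear]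
    by (simp add: tensor_action_def ndi_lift_def ndi_pure_def of_univ_to_univ[OF refl injPQ] of_univ_to_univ[OF refl injMN])
qed

text \<open>Both sides are bilinear and agree on pure tensors.\<close>

lemma tensor_mult:
  assumes m: "module K A" "module K B"
    and A: "bilinear_map K A A A (monoid.mult A)" and B: "bilinear_map K B B B (monoid.mult B)"
    and xy: "x \<in> carrier (A \<boxtimes> B)" "y \<in> carrier (A \<boxtimes> B)"
  shows "x \<otimes>\<^bsub>A \<boxtimes> B\<^esub> y = tensor_action A B A B A B (monoid.mult A) (monoid.mult B) x y"
proof -
  interpret X: module_pair K A B using m by (simp add: module_pair_def)
  note inj = inj_on_to_univ_tensor[OF m]
  note tm = X.tensor_module
  let ?X = "tensor_algebra K A B"
  let ?q = "\<lambda>a b a' b'. pure_tensor K A B (a \<otimes>\<^bsub>A\<^esub> a') (b \<otimes>\<^bsub>B\<^esub> b')"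
  have pure': "bilinear_map K A B ?X (\<lambda>x y. pure_tensor K A B (f x) (g y))"
    if "linear_map K A A f" "linear_map K B B g" for f g
    using bilinear_map_compose[OF X.pure_tensor_bilinear that linear_map_id] .
  have q: "quadrilinear_map K A B A B ?X ?q"
    unfolding quadrilinear_map_def
    by (auto intro!: pure' bilinear_map_left[OF A] bilinear_map_right[OF A] bilinear_map_left[OF B] bilinear_map_right[OF B])
  have mult: "x \<otimes>\<^bsub>?X\<^esub> y = tensor_lift (add_monoid ?X) (\<lambda>a b. tensor_lift (add_monoid ?X) (?q a b) y) x" for x y
    by (simp add: X.tensor_lift_T[symmetric]) (simp add: tensor_algebra_def Let_def)
  have bil: "bilinear_map K ?X ?X ?X (monoid.mult ?X)"
    unfolding mult[abs_def] by (rule tensor_lift_twice_bilinear[OF m m tm q])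
  have bil': "bilinear_map K (A \<boxtimes> B) (A \<boxtimes> B) (A \<boxtimes> B) (\<lambda>x y. x \<otimes>\<^bsub>A \<boxtimes> B\<^esub> y)"
    using bilinear_map_compose[OF bil of_univ_linear[OF refl inj tm] of_univ_linear[OF refl inj tm]
        to_univ_linear[OF refl inj tm]]
    unfolding ndi_tensor_def by (simp add: univ_copy_def)
  have "pure A B a b \<otimes>\<^bsub>A \<boxtimes> B\<^esub> pure A B a' b' = pure A B (a \<otimes>\<^bsub>A\<^esub> a') (b \<otimes>\<^bsub>B\<^esub> b')"
    if "a \<in> carrier A" "b \<in> carrier B" "a' \<in> carrier A" "b' \<in> carrier B" for a b a' b'
  proof -
    have "pure_tensor K A B a b \<otimes>\<^bsub>?X\<^esub> pure_tensor K A B a' b' = ?q a b a' b'"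
      unfolding mult by (rule tensor_lift_twice_pure[OF m m tm q that])
    then show ?thesis
      using that bilinear_map_closed[OF X.pure_tensor_bilinear]
      by (simp add: ndi_tensor_def ndi_pure_def mult_univ_copy[OF refl inj])
  qed
  then show ?thesis
    using ndi_bilinear_eqI[OF m m bil' tensor_action_bilinear[OF m m m A B] _ xy]
    by (simp add: tensor_action_pure[OF m m m A B])
qed

lemma ndi_trilinear_eqI:
  assumes m: "module K P" "module K P'" "module K Q" "module K Q'" "module K S" "module K S'"
    and F: "\<And>y z. \<lbrakk>y \<in> carrier (Q \<boxtimes> Q'); z \<in> carrier (S \<boxtimes> S')\<rbrakk> \<Longrightarrow> linear_map K (P \<boxtimes> P') M (\<lambda>x. F x y z)"
      "\<And>x z. \<lbrakk>x \<in> carrier (P \<boxtimes> P'); z \<in> carrier (S \<boxtimes> S')\<rbrakk> \<Longrightarrow> linear_map K (Q \<boxtimes> Q') M (\<lambda>y. F x y z)"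
      "\<And>x y. \<lbrakk>x \<in> carrier (P \<boxtimes> P'); y \<in> carrier (Q \<boxtimes> Q')\<rbrakk> \<Longrightarrow> linear_map K (S \<boxtimes> S') M (\<lambda>z. F x y z)"
    and G: "\<And>y z. \<lbrakk>y \<in> carrier (Q \<boxtimes> Q'); z \<in> carrier (S \<boxtimes> S')\<rbrakk> \<Longrightarrow> linear_map K (P \<boxtimes> P') M (\<lambda>x. G x y z)"
      "\<And>x z. \<lbrakk>x \<in> carrier (P \<boxtimes> P'); z \<in> carrier (S \<boxtimes> S')\<rbrakk> \<Longrightarrow> linear_map K (Q \<boxtimes> Q') M (\<lambda>y. G x y z)"
      "\<And>x y. \<lbrakk>x \<in> carrier (P \<boxtimes> P'); y \<in> carrier (Q \<boxtimes> Q')\<rbrakk> \<Longrightarrow> linear_map K (S \<boxtimes> S') M (\<lambda>z. G x y z)"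
    and eq: "\<And>p p' q q' s s'. \<lbrakk>p \<in> carrier P; p' \<in> carrier P'; q \<in> carrier Q; q' \<in> carrier Q';
        s \<in> carrier S; s' \<in> carrier S'\<rbrakk>
      \<Longrightarrow> F (pure P P' p p') (pure Q Q' q q') (pure S S' s s') = G (pure P P' p p') (pure Q Q' q q') (pure S S' s s')"
    and xyz: "x \<in> carrier (P \<boxtimes> P')" "y \<in> carrier (Q \<boxtimes> Q')" "z \<in> carrier (S \<boxtimes> S')"
  shows "F x y z = G x y z"
proof (rule ndi_linear_eqI[OF m(1,2) F(1)[OF xyz(2,3)] G(1)[OF xyz(2,3)] _ xyz(1)])
  fix p p' assume p: "p \<in> carrier P" "p' \<in> carrier P'"
  have "bilinear_map K (Q \<boxtimes> Q') (S \<boxtimes> S') M (F (pure P P' p p'))"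
    "bilinear_map K (Q \<boxtimes> Q') (S \<boxtimes> S') M (G (pure P P' p p'))"
    using F G pure_closed[OF m(1,2) p] by (auto intro!: bilinear_mapI)
  then show "F (pure P P' p p') y z = G (pure P P' p p') y z"
    by (rule ndi_bilinear_eqI[OF m(3-6) _ _ _ xyz(2,3)]) (rule eq[OF p])
qed

text \<open>Associativity laws survive tensor products: both sides are trilinear, and on pure tensors the
identity holds factor by factor. With suitable choices of the four bilinear maps this covers the
associativity of an algebra, each bimodule and compatibility law of an extension, and the law that
characterizes composites.\<close>

lemma tensor_action_assoc:
  assumes m: "module K P" "module K P'" "module K Q" "module K Q'" "module K R" "module K R'"
      "module K S" "module K S'" "module K V" "module K V'" "module K W" "module K W'"
    and h: "bilinear_map K P Q R h" "bilinear_map K P' Q' R' h'"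
    and k: "bilinear_map K R S W k" "bilinear_map K R' S' W' k'"
    and i: "bilinear_map K Q S V i" "bilinear_map K Q' S' V' i'"
    and j: "bilinear_map K P V W j" "bilinear_map K P' V' W' j'"
    and eq: "\<And>p q s. \<lbrakk>p \<in> carrier P; q \<in> carrier Q; s \<in> carrier S\<rbrakk> \<Longrightarrow> k (h p q) s = j p (i q s)"
    and eq': "\<And>p q s. \<lbrakk>p \<in> carrier P'; q \<in> carrier Q'; s \<in> carrier S'\<rbrakk> \<Longrightarrow> k' (h' p q) s = j' p (i' q s)"
    and xyz: "x \<in> carrier (P \<boxtimes> P')" "y \<in> carrier (Q \<boxtimes> Q')" "z \<in> carrier (S \<boxtimes> S')"
  shows "tensor_action R R' S S' W W' k k' (tensor_action P P' Q Q' R R' h h' x y) z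
    = tensor_action P P' V V' W W' j j' x (tensor_action Q Q' S S' V V' i i' y z)"
proof -
  note H = tensor_action_bilinear[OF m(1-6) h]
  note KK = tensor_action_bilinear[OF m(5-8) m(11,12) k]
  note I = tensor_action_bilinear[OF m(3,4) m(7-10) i]
  note J = tensor_action_bilinear[OF m(1,2) m(9-12) j]
  show ?thesis
  proof (rule ndi_trilinear_eqI[OF m(1-4,7,8) _ _ _ _ _ _ _ xyz, where M = "W \<boxtimes> W'"
      and F = "\<lambda>x y z. tensor_action R R' S S' W W' k k' (tensor_action P P' Q Q' R R' h h' x y) z"
      and G = "\<lambda>x y z. tensor_action P P' V V' W W' j j' x (tensor_action Q Q' S S' V V' i i' y z)"],
      goal_cases)
    case (1 y z)
    then show ?case by (intro linear_map_compose[OF bilinear_map_left[OF H] bilinear_map_left[OF KK]])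
  next
    case (2 x z)
    then show ?case by (intro linear_map_compose[OF bilinear_map_right[OF H] bilinear_map_left[OF KK]])
  next
    case (3 x y)
    then show ?case by (intro bilinear_map_right[OF KK] bilinear_map_closed[OF H])
  next
    case (4 y z)
    then show ?case by (intro bilinear_map_left[OF J] bilinear_map_closed[OF I])
  next
    case (5 x z)
    then show ?case by (intro linear_map_compose[OF bilinear_map_left[OF I] bilinear_map_right[OF J]])
  next
    case (6 x y)
    then show ?case by (intro linear_map_compose[OF bilinear_map_right[OF I] bilinear_map_right[OF J]])
  next
    case (7 p p' q q' s s')
    then show ?case
      by (simp add: tensor_action_pure[OF m(1-6) h] tensor_action_pure[OF m(5-8) m(11,12) k]
          tensor_action_pure[OF m(3,4) m(7-10) i] tensor_action_pure[OF m(1,2) m(9-12) j]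
          bilinear_map_closed[OF h(1)] bilinear_map_closed[OF h(2)] bilinear_map_closed[OF i(1)]
          bilinear_map_closed[OF i(2)] eq eq')
  qed
qed

definition tensor_map ::
    "('k, 'u) module \<Rightarrow> ('k, 'u) module \<Rightarrow> ('k, 'u) module \<Rightarrow> ('k, 'u) module
      \<Rightarrow> ('u \<Rightarrow> 'u) \<Rightarrow> ('u \<Rightarrow> 'u) \<Rightarrow> 'u \<Rightarrow> 'u"
  where "tensor_map M N M' N' f g = ndi_lift K M N (M' \<boxtimes> N') (\<lambda>m n. pure M' N' (f m) (g n))"

lemma
  assumes m: "module K M" "module K N" "module K M'" "module K N'"
    and f: "linear_map K M M' f" and g: "linear_map K N N' g"
  shows tensor_map_linear: "linear_map K (M \<boxtimes> N) (M' \<boxtimes> N') (tensor_map M N M' N' f g)"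
    and tensor_map_pure: "\<lbrakk>x \<in> carrier M; y \<in> carrier N\<rbrakk>
      \<Longrightarrow> tensor_map M N M' N' f g (pure M N x y) = pure M' N' (f x) (g y)"
proof -
  note bil = bilinear_map_compose[OF pure_bilinear[OF m(3,4)] f g linear_map_id]
  note tm = ndi_tensor_module[OF m(3,4)]
  show "linear_map K (M \<boxtimes> N) (M' \<boxtimes> N') (tensor_map M N M' N' f g)"
    unfolding tensor_map_def by (rule ndi_lift_linear[OF m(1,2) tm bil])
  show "tensor_map M N M' N' f g (pure M N x y) = pure M' N' (f x) (g y)"
    if "x \<in> carrier M" "y \<in> carrier N"
    unfolding tensor_map_def by (rule ndi_lift_pure[OF m(1,2) tm bil that])
qed

end

section \<open>Dual bases\<close>

text \<open>Projectivity in terms of coordinates. The finite set of indices of an expansion need not be the exact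
support, so that it can be enlarged when elements are added.\<close>

definition dual_basis ::
    "('k, 'm) ring_scheme \<Rightarrow> ('k, 'a, 'p) module_scheme \<Rightarrow> 'i set \<Rightarrow> ('i \<Rightarrow> 'a \<Rightarrow> 'k) \<Rightarrow> ('i \<Rightarrow> 'a) \<Rightarrow> bool"
  where "dual_basis K P J \<phi> e \<longleftrightarrow>
    (\<forall>j\<in>J. linear_map K P (base_algebra K) (\<phi> j)) \<and> e \<in> J \<rightarrow> carrier P \<and>
    (\<forall>x\<in>carrier P. \<exists>S. finite S \<and> S \<subseteq> J \<and> (\<forall>j\<in>J - S. \<phi> j x = \<zero>\<^bsub>K\<^esub>) \<and>
        x = (\<Oplus>\<^bsub>P\<^esub>j\<in>S. \<phi> j x \<odot>\<^bsub>P\<^esub> e j))"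

text \<open>For a retract \<open>p \<circ> s = id\<close> of a free module the generators are the images under \<open>p\<close> of the standard
basis \<open>\<delta>\<close>, and the coordinate forms are the components of \<open>s\<close>.\<close>

lemma projective_module_imp_dual_basis:
  fixes P :: "('k, 'a, 'p) module_scheme"
  assumes "projective_module K P"
  obtains J :: "'a set" and \<phi> e where "dual_basis K P J \<phi> e"
proof -
  interpret P: module K P using assms by (simp add: projective_module_def)
  from assms obtain J :: "'a set" and s p where
    s: "linear_map K P (free_module K J) s" and p: "linear_map K (free_module K J) P p"
    and ps: "\<And>x. x \<in> carrier P \<Longrightarrow> p (s x) = x"
    unfolding projective_module_def by blast
  let ?L = "free_module K J"
  define \<delta> where "\<delta> j = (\<lambda>i\<in>J. if i = j then \<one>\<^bsub>K\<^esub> else \<zero>\<^bsub>K\<^esub>)" for j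
  have \<delta>: "\<delta> j \<in> carrier ?L" for j
    unfolding free_module_def \<delta>_def by (auto intro: finite_subset[of _ "{j}"])
  have p_expand: "p f = (\<Oplus>\<^bsub>P\<^esub>j\<in>S. f j \<odot>\<^bsub>P\<^esub> p (\<delta> j))"
    if "finite S" "S \<subseteq> J" "f \<in> carrier ?L" "\<And>j. j \<in> J - S \<Longrightarrow> f j = \<zero>\<^bsub>K\<^esub>" for S f
    using that
  proof (induction S arbitrary: f rule: finite_induct)
    case empty
    have f: "f = \<zero>\<^bsub>K\<^esub> \<odot>\<^bsub>?L\<^esub> f"
      using empty by (auto simp: free_module_def PiE_iff extensional_def fun_eq_iff)
    have "p f = \<zero>\<^bsub>K\<^esub> \<odot>\<^bsub>P\<^esub> p f"
      using linear_map_smult[OF p _ empty(2), of "\<zero>\<^bsub>K\<^esub>"] f by simp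
    then show ?case using linear_map_closed[OF p empty(2)] by simp
  next
    case (insert j S)
    \<comment> \<open>Split off the coordinate \<open>j\<close>; the rest is supported in \<open>S\<close>.\<close>
    define g where "g = (\<lambda>i\<in>J. if i = j then \<zero>\<^bsub>K\<^esub> else f i)"
    have j: "j \<in> J" using insert by blast
    have fc: "f i \<in> carrier K" if "i \<in> J" for i
      using insert(5) that by (auto simp: free_module_def)
    have g: "g \<in> carrier ?L"
      using insert(5) fc unfolding free_module_def g_def
      by (auto elim!: finite_subset[rotated])
    have fg: "f = f j \<odot>\<^bsub>?L\<^esub> \<delta> j \<oplus>\<^bsub>?L\<^esub> g"
      using insert(5) fc j by (auto simp: free_module_def g_def \<delta>_def PiE_iff extensional_def fun_eq_iff)
    have sm: "f j \<odot>\<^bsub>?L\<^esub> \<delta> j \<in> carrier ?L"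
      using fc[OF j] unfolding free_module_def \<delta>_def by (auto intro: finite_subset[of _ "{j}"])
    have p\<delta>: "p (\<delta> i) \<in> carrier P" for i by (rule linear_map_closed[OF p \<delta>])
    have "p f = p (f j \<odot>\<^bsub>?L\<^esub> \<delta> j \<oplus>\<^bsub>?L\<^esub> g)" using fg by simp
    also have "\<dots> = f j \<odot>\<^bsub>P\<^esub> p (\<delta> j) \<oplus>\<^bsub>P\<^esub> p g"
      by (simp add: linear_map_add[OF p sm g] linear_map_smult[OF p fc[OF j] \<delta>])
    also have "p g = (\<Oplus>\<^bsub>P\<^esub>i\<in>S. g i \<odot>\<^bsub>P\<^esub> p (\<delta> i))"
      by (rule insert.IH[OF _ g]) (use insert.prems in \<open>auto simp: g_def\<close>)
    also have "\<dots> = (\<Oplus>\<^bsub>P\<^esub>i\<in>S. f i \<odot>\<^bsub>P\<^esub> p (\<delta> i))"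
      by (rule P.M.add.finprod_cong') (use insert fc p\<delta> in \<open>auto simp: g_def\<close>)
    also have "f j \<odot>\<^bsub>P\<^esub> p (\<delta> j) \<oplus>\<^bsub>P\<^esub> \<dots> = (\<Oplus>\<^bsub>P\<^esub>i\<in>insert j S. f i \<odot>\<^bsub>P\<^esub> p (\<delta> i))"
      by (rule P.M.finsum_insert[symmetric]) (use insert fc p\<delta> in auto)
    finally show ?case .
  qed
  have "dual_basis K P J (\<lambda>j x. s x j) (\<lambda>j. p (\<delta> j))"
    unfolding dual_basis_def
  proof (intro conjI ballI funcsetI)
    fix j assume j: "j \<in> J"
    show "linear_map K P (base_algebra K) (\<lambda>x. s x j)"
    proof (rule linear_mapI)
      show "s x j \<in> carrier (base_algebra K)" if "x \<in> carrier P" for x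
        using linear_map_closed[OF s that] j by (auto simp: free_module_def base_algebra_def)
    qed (simp_all add: linear_map_add[OF s] linear_map_smult[OF s] free_module_def base_algebra_def j)
    show "p (\<delta> j) \<in> carrier P" by (rule linear_map_closed[OF p \<delta>])
  next
    fix x assume x: "x \<in> carrier P"
    let ?S = "{j \<in> J. s x j \<noteq> \<zero>\<^bsub>K\<^esub>}"
    have sx: "s x \<in> carrier ?L" by (rule linear_map_closed[OF s x])
    then have fin: "finite ?S" by (simp add: free_module_def)
    have "x = (\<Oplus>\<^bsub>P\<^esub>j\<in>?S. s x j \<odot>\<^bsub>P\<^esub> p (\<delta> j))"
    proof -
      have "p (s x) = (\<Oplus>\<^bsub>P\<^esub>j\<in>?S. s x j \<odot>\<^bsub>P\<^esub> p (\<delta> j))"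
        by (rule p_expand[OF fin _ sx]) auto
      then show ?thesis by (simp only: ps[OF x])
    qed
    then show "\<exists>S. finite S \<and> S \<subseteq> J \<and> (\<forall>j\<in>J - S. s x j = \<zero>\<^bsub>K\<^esub>) \<and> x = (\<Oplus>\<^bsub>P\<^esub>j\<in>S. s x j \<odot>\<^bsub>P\<^esub> p (\<delta> j))"
      using fin by (intro exI[of _ ?S]) auto
  qed
  then show thesis by (rule that)
qed

lemma dual_basis_imp_projective_module:
  fixes P :: "('k, 'a, 'p) module_scheme" and J :: "'a set"
  assumes "module K P" and db: "dual_basis K P J \<phi> e"
  shows "projective_module K P"
proof -
  interpret P: module K P by fact
  let ?L = "free_module K J"
  have \<phi>: "linear_map K P (base_algebra K) (\<phi> j)" and e: "e j \<in> carrier P" if "j \<in> J" for j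
    using db that by (auto simp: dual_basis_def)
  have \<phi>c: "\<phi> j x \<in> carrier K" if "j \<in> J" "x \<in> carrier P" for j x
    using linear_map_closed[OF \<phi>[OF that(1)] that(2)] by (simp add: base_algebra_def)
  define s where "s x = (\<lambda>j\<in>J. \<phi> j x)" for x
  define p where "p f = (\<Oplus>\<^bsub>P\<^esub>j\<in>{j \<in> J. f j \<noteq> \<zero>\<^bsub>K\<^esub>}. f j \<odot>\<^bsub>P\<^esub> e j)" for f
  have p_eq: "p f = (\<Oplus>\<^bsub>P\<^esub>j\<in>S. f j \<odot>\<^bsub>P\<^esub> e j)"
    if "finite S" "S \<subseteq> J" "\<And>j. j \<in> J \<Longrightarrow> f j \<in> carrier K" "\<And>j. j \<in> J - S \<Longrightarrow> f j = \<zero>\<^bsub>K\<^esub>" for f S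
    unfolding p_def by (rule P.M.add.finprod_mono_neutral_cong_left) (use that e in auto)
  have s_L: "s x \<in> carrier ?L" if x: "x \<in> carrier P" for x
  proof -
    obtain S where "finite S" "\<forall>j\<in>J - S. \<phi> j x = \<zero>\<^bsub>K\<^esub>"
      using db x unfolding dual_basis_def by blast
    then have "finite {j \<in> J. s x j \<noteq> \<zero>\<^bsub>K\<^esub>}"
      by (elim finite_subset[rotated]) (auto simp: s_def)
    then show ?thesis using \<phi>c x by (simp add: free_module_def s_def)
  qed
  have s: "linear_map K P ?L s"
  proof (rule linear_mapI)
    show "s (x \<oplus>\<^bsub>P\<^esub> y) = s x \<oplus>\<^bsub>?L\<^esub> s y" if "x \<in> carrier P" "y \<in> carrier P" for x y
      using that linear_map_add[OF \<phi>] by (auto simp: s_def free_module_def base_algebra_def)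
    show "s (r \<odot>\<^bsub>P\<^esub> x) = r \<odot>\<^bsub>?L\<^esub> s x" if "r \<in> carrier K" "x \<in> carrier P" for r x
      using that linear_map_smult[OF \<phi>] by (auto simp: s_def free_module_def base_algebra_def)
  qed (rule s_L)
  have fin: "finite {j \<in> J. f j \<noteq> \<zero>\<^bsub>K\<^esub>}" and fc: "\<And>j. j \<in> J \<Longrightarrow> f j \<in> carrier K" if "f \<in> carrier ?L" for f
    using that by (auto simp: free_module_def)
  have p: "linear_map K ?L P p"
  proof (rule linear_mapI)
    fix f assume f: "f \<in> carrier ?L"
    show "p f \<in> carrier P"
      unfolding p_def using e fc[OF f] by (auto intro!: P.M.finsum_closed)
    fix g assume g: "g \<in> carrier ?L"
    let ?S = "{j \<in> J. f j \<noteq> \<zero>\<^bsub>K\<^esub>} \<union> {j \<in> J. g j \<noteq> \<zero>\<^bsub>K\<^esub>}"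
    have S: "finite ?S" "?S \<subseteq> J" using fin f g by auto
    have "p (f \<oplus>\<^bsub>?L\<^esub> g) = (\<Oplus>\<^bsub>P\<^esub>j\<in>?S. (f \<oplus>\<^bsub>?L\<^esub> g) j \<odot>\<^bsub>P\<^esub> e j)"
      by (rule p_eq[OF S]) (use fc f g in \<open>auto simp: free_module_def\<close>)
    also have "\<dots> = (\<Oplus>\<^bsub>P\<^esub>j\<in>?S. f j \<odot>\<^bsub>P\<^esub> e j \<oplus>\<^bsub>P\<^esub> g j \<odot>\<^bsub>P\<^esub> e j)"
      by (rule P.M.add.finprod_cong')
        (use fc[OF f] fc[OF g] e in \<open>auto simp: free_module_def P.smult_l_distr\<close>)
    also have "\<dots> = p f \<oplus>\<^bsub>P\<^esub> p g"
    proof -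
      have "p f = (\<Oplus>\<^bsub>P\<^esub>j\<in>?S. f j \<odot>\<^bsub>P\<^esub> e j)" "p g = (\<Oplus>\<^bsub>P\<^esub>j\<in>?S. g j \<odot>\<^bsub>P\<^esub> e j)"
        by (rule p_eq[OF S]; use fc f g in auto)+
      moreover have "(\<Oplus>\<^bsub>P\<^esub>j\<in>?S. f j \<odot>\<^bsub>P\<^esub> e j \<oplus>\<^bsub>P\<^esub> g j \<odot>\<^bsub>P\<^esub> e j)
          = (\<Oplus>\<^bsub>P\<^esub>j\<in>?S. f j \<odot>\<^bsub>P\<^esub> e j) \<oplus>\<^bsub>P\<^esub> (\<Oplus>\<^bsub>P\<^esub>j\<in>?S. g j \<odot>\<^bsub>P\<^esub> e j)"
        by (rule P.M.finsum_addf) (use fc[OF f] fc[OF g] e in auto)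
      ultimately show ?thesis by simp
    qed
    finally show "p (f \<oplus>\<^bsub>?L\<^esub> g) = p f \<oplus>\<^bsub>P\<^esub> p g" .
  next
    fix r f assume r: "r \<in> carrier K" and f: "f \<in> carrier ?L"
    let ?S = "{j \<in> J. f j \<noteq> \<zero>\<^bsub>K\<^esub>}"
    have S: "finite ?S" "?S \<subseteq> J" using fin f by auto
    have "p (r \<odot>\<^bsub>?L\<^esub> f) = (\<Oplus>\<^bsub>P\<^esub>j\<in>?S. (r \<odot>\<^bsub>?L\<^esub> f) j \<odot>\<^bsub>P\<^esub> e j)"
      by (rule p_eq[OF S]) (use fc f r in \<open>auto simp: free_module_def\<close>)
    also have "\<dots> = (\<Oplus>\<^bsub>P\<^esub>j\<in>?S. r \<odot>\<^bsub>P\<^esub> (f j \<odot>\<^bsub>P\<^esub> e j))"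
      by (rule P.M.add.finprod_cong') (use fc[OF f] e r in \<open>auto simp: free_module_def P.smult_assoc1\<close>)
    also have "\<dots> = r \<odot>\<^bsub>P\<^esub> p f"
      unfolding p_def
      by (rule P.finsum_smult_ldistr[symmetric]) (use fc[OF f] e r S in auto)
    finally show "p (r \<odot>\<^bsub>?L\<^esub> f) = r \<odot>\<^bsub>P\<^esub> p f" .
  qed
  have "p (s x) = x" if x: "x \<in> carrier P" for x
  proof -
    obtain S where S: "finite S" "S \<subseteq> J" "\<forall>j\<in>J - S. \<phi> j x = \<zero>\<^bsub>K\<^esub>" "x = (\<Oplus>\<^bsub>P\<^esub>j\<in>S. \<phi> j x \<odot>\<^bsub>P\<^esub> e j)"
      using db x unfolding dual_basis_def by blast
    have "p (s x) = (\<Oplus>\<^bsub>P\<^esub>j\<in>S. s x j \<odot>\<^bsub>P\<^esub> e j)"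
      by (rule p_eq[OF S(1,2)]) (use S \<phi>c x in \<open>auto simp: s_def\<close>)
    also have "\<dots> = (\<Oplus>\<^bsub>P\<^esub>j\<in>S. \<phi> j x \<odot>\<^bsub>P\<^esub> e j)"
      by (rule P.M.add.finprod_cong') (use S(2) \<phi>c e x in \<open>auto simp: s_def\<close>)
    finally show ?thesis using S(4) by simp
  qed
  then show ?thesis unfolding projective_module_def using assms(1) s p by blast
qed

text \<open>\<open>projective_module\<close> takes the generators of the free module from the type of the elements, so a dual
basis indexed by pairs of elements has to be moved there.\<close>

lemma dual_basis_reindex:
  assumes "module K P" and db: "dual_basis K P J \<phi> e" and g: "inj_on g J"
  shows "dual_basis K P (g ` J) (\<lambda>i. \<phi> (inv_into J g i)) (\<lambda>i. e (inv_into J g i))"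
  unfolding dual_basis_def
proof (intro conjI ballI funcsetI)
  interpret P: module K P by fact
  have \<phi>: "linear_map K P (base_algebra K) (\<phi> j)" and e: "e j \<in> carrier P" if "j \<in> J" for j
    using db that by (auto simp: dual_basis_def)
  show "linear_map K P (base_algebra K) (\<phi> (inv_into J g i))" "e (inv_into J g i) \<in> carrier P" if "i \<in> g ` J" for i
    using \<phi> e inv_into_into[OF that] by blast+
  fix x assume x: "x \<in> carrier P"
  have \<phi>c: "\<phi> j x \<in> carrier K" if "j \<in> J" for j
    using linear_map_closed[OF \<phi>[OF that] x] by (simp add: base_algebra_def)
  obtain S where S: "finite S" "S \<subseteq> J" "\<forall>j\<in>J - S. \<phi> j x = \<zero>\<^bsub>K\<^esub>" "x = (\<Oplus>\<^bsub>P\<^esub>j\<in>S. \<phi> j x \<odot>\<^bsub>P\<^esub> e j)"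
    using db x unfolding dual_basis_def by blast
  have inv: "inv_into J g (g j) = j" if "j \<in> J" for j using inv_into_f_f[OF g that] .
  let ?f = "\<lambda>i. \<phi> (inv_into J g i) x \<odot>\<^bsub>P\<^esub> e (inv_into J g i)"
  have "(\<Oplus>\<^bsub>P\<^esub>i\<in>g ` S. ?f i) = (\<Oplus>\<^bsub>P\<^esub>j\<in>S. ?f (g j))"
    by (rule P.M.finsum_reindex) (use S(2) \<phi>c e inv inj_on_subset[OF g S(2)] in \<open>auto simp: subset_iff\<close>)
  also have "\<dots> = (\<Oplus>\<^bsub>P\<^esub>j\<in>S. \<phi> j x \<odot>\<^bsub>P\<^esub> e j)"
    by (rule P.M.add.finprod_cong') (use S(2) \<phi>c e inv in \<open>auto simp: subset_iff\<close>)
  finally have "x = (\<Oplus>\<^bsub>P\<^esub>i\<in>g ` S. ?f i)" using S(4) by simp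
  moreover have "\<phi> (inv_into J g i) x = \<zero>\<^bsub>K\<^esub>" if "i \<in> g ` J - g ` S" for i
    using that S(3) inv by auto
  ultimately show "\<exists>S'. finite S' \<and> S' \<subseteq> g ` J \<and> (\<forall>i\<in>g ` J - S'. \<phi> (inv_into J g i) x = \<zero>\<^bsub>K\<^esub>) \<and>
      x = (\<Oplus>\<^bsub>P\<^esub>i\<in>S'. ?f i)"
    using S(1,2) by (intro exI[of _ "g ` S"]) auto
qed

lemma finsum_cartesian:
  assumes "abelian_group M" "finite I" "finite J" "\<And>i j. \<lbrakk>i \<in> I; j \<in> J\<rbrakk> \<Longrightarrow> g (i, j) \<in> carrier M"
  shows "(\<Oplus>\<^bsub>M\<^esub>z\<in>I \<times> J. g z) = (\<Oplus>\<^bsub>M\<^esub>j\<in>J. \<Oplus>\<^bsub>M\<^esub>i\<in>I. g (i, j))"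
proof -
  interpret abelian_group M by fact
  have "I \<times> J = (\<Union>j\<in>J. I \<times> {j})" by auto
  then have "(\<Oplus>\<^bsub>M\<^esub>z\<in>I \<times> J. g z) = (\<Oplus>\<^bsub>M\<^esub>z\<in>(\<Union>j\<in>J. I \<times> {j}). g z)" by simp
  also have "\<dots> = (\<Oplus>\<^bsub>M\<^esub>j\<in>J. \<Oplus>\<^bsub>M\<^esub>z\<in>I \<times> {j}. g z)"
    by (rule add.finprod_UN_disjoint) (use assms in \<open>auto simp: pairwise_def disjnt_def\<close>)
  also have "\<dots> = (\<Oplus>\<^bsub>M\<^esub>j\<in>J. \<Oplus>\<^bsub>M\<^esub>i\<in>I. g (i, j))"
  proof (rule add.finprod_cong')
    show "(\<lambda>j. \<Oplus>\<^bsub>M\<^esub>i\<in>I. g (i, j)) \<in> J \<rightarrow> carrier M"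
      using assms by (auto intro!: finsum_closed)
    fix j assume j: "j \<in> J"
    have "I \<times> {j} = (\<lambda>i. (i, j)) ` I" by auto
    then have "(\<Oplus>\<^bsub>M\<^esub>z\<in>I \<times> {j}. g z) = (\<Oplus>\<^bsub>M\<^esub>z\<in>(\<lambda>i. (i, j)) ` I. g z)" by simp
    also have "\<dots> = (\<Oplus>\<^bsub>M\<^esub>i\<in>I. g (i, j))"
      by (rule finsum_reindex) (use assms j in \<open>auto simp: inj_on_def\<close>)
    finally show "(\<Oplus>\<^bsub>M\<^esub>z\<in>I \<times> {j}. g z) = (\<Oplus>\<^bsub>M\<^esub>i\<in>I. g (i, j))" .
  qed simp
  finally show ?thesis .
qed

context ndi_universe
begin

text \<open>The map $\mathrm{id} \otimes \varphi \colon M \otimes N \to M \otimes k = M$.\<close>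

definition contraction ::
    "('k, 'u) module \<Rightarrow> ('k, 'u) module \<Rightarrow> ('u \<Rightarrow> 'k) \<Rightarrow> 'u \<Rightarrow> 'u"
  where "contraction M N \<phi> = ndi_lift K M N M (\<lambda>m n. \<phi> n \<odot>\<^bsub>M\<^esub> m)"

lemma
  assumes m: "module K M" "module K N" and \<phi>: "linear_map K N (base_algebra K) \<phi>"
  shows contraction_linear: "linear_map K (M \<boxtimes> N) M (contraction M N \<phi>)"
    and contraction_pure: "\<lbrakk>x \<in> carrier M; y \<in> carrier N\<rbrakk> \<Longrightarrow> contraction M N \<phi> (pure M N x y) = \<phi> y \<odot>\<^bsub>M\<^esub> x"
proof -
  have bil: "bilinear_map K M N M (\<lambda>m n. \<phi> n \<odot>\<^bsub>M\<^esub> m)"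
    using bilinear_map_flip[OF bilinear_map_compose[OF bilinear_map_smult[OF m(1)] \<phi> linear_map_id linear_map_id]] .
  show "linear_map K (M \<boxtimes> N) M (contraction M N \<phi>)"
    unfolding contraction_def by (rule ndi_lift_linear[OF m m(1) bil])
  show "contraction M N \<phi> (pure M N x y) = \<phi> y \<odot>\<^bsub>M\<^esub> x" if "x \<in> carrier M" "y \<in> carrier N"
    unfolding contraction_def by (rule ndi_lift_pure[OF m m(1) bil that])
qed

text \<open>On a pure tensor this is the expansion of the second factor in the dual basis, with the coefficients
moved to the first factor; the coefficients are linear in \<open>x\<close>, so the expansions of summands can be
added over the union of their index sets.\<close>

lemma contraction_expansion:
  assumes m: "module K M" "module K N" and db: "dual_basis K N J \<phi> e" and x: "x \<in> carrier (M \<boxtimes> N)"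
  shows "\<exists>S. finite S \<and> S \<subseteq> J \<and> (\<forall>j\<in>J - S. contraction M N (\<phi> j) x = \<zero>\<^bsub>M\<^esub>) \<and>
    x = (\<Oplus>\<^bsub>M \<boxtimes> N\<^esub>j\<in>S. pure M N (contraction M N (\<phi> j) x) (e j))"
proof -
  interpret M: module K M by fact
  interpret N: module K N by fact
  interpret MN: module K "M \<boxtimes> N" by (rule ndi_tensor_module[OF m])
  have \<phi>: "linear_map K N (base_algebra K) (\<phi> j)" and e: "e j \<in> carrier N" if "j \<in> J" for j
    using db that by (auto simp: dual_basis_def)
  note bil = pure_bilinear[OF m]
  note c = contraction_linear[OF m \<phi>]
  note pc = bilinear_map_closed[OF bil]
  note p0 = linear_map_zero[OF bilinear_map_left[OF bil] m(1) MN.module_axioms]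
  let ?t = "\<lambda>x j. pure M N (contraction M N (\<phi> j) x) (e j)"
  from m x show ?thesis
  proof (induction rule: ndi_tensor_induct)
    case (pure a b)
    have \<phi>c: "\<phi> j b \<in> carrier K" if "j \<in> J" for j
      using linear_map_closed[OF \<phi>[OF that] pure(2)] by (simp add: base_algebra_def)
    obtain S where S: "finite S" "S \<subseteq> J" "\<forall>j\<in>J - S. \<phi> j b = \<zero>\<^bsub>K\<^esub>" "b = (\<Oplus>\<^bsub>N\<^esub>j\<in>S. \<phi> j b \<odot>\<^bsub>N\<^esub> e j)"
      using db pure(2) unfolding dual_basis_def by blast
    have "pure M N a b = pure M N a (\<Oplus>\<^bsub>N\<^esub>j\<in>S. \<phi> j b \<odot>\<^bsub>N\<^esub> e j)" using S(4) by simp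
    also have "\<dots> = (\<Oplus>\<^bsub>M \<boxtimes> N\<^esub>j\<in>S. pure M N a (\<phi> j b \<odot>\<^bsub>N\<^esub> e j))"
      by (rule linear_map_finsum[OF bilinear_map_right[OF bil pure(1)] m(2) MN.module_axioms S(1)])
        (use S(2) \<phi>c e in auto)
    also have "\<dots> = (\<Oplus>\<^bsub>M \<boxtimes> N\<^esub>j\<in>S. ?t (pure M N a b) j)"
      by (rule MN.M.add.finprod_cong')
        (use S(2) \<phi>c e pure in \<open>auto simp: subset_iff contraction_pure[OF m \<phi>] pc
            bilinear_map_smult_left[OF bil] bilinear_map_smult_right[OF bil]\<close>)
    finally have "pure M N a b = (\<Oplus>\<^bsub>M \<boxtimes> N\<^esub>j\<in>S. ?t (pure M N a b) j)" .
    moreover have "\<forall>j\<in>J - S. contraction M N (\<phi> j) (pure M N a b) = \<zero>\<^bsub>M\<^esub>"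
      using S pure by (auto simp: contraction_pure[OF m \<phi>])
    ultimately show ?case using S by blast
  next
    case (add x y)
    then obtain S S' where S: "finite S" "S \<subseteq> J" "\<forall>j\<in>J - S. contraction M N (\<phi> j) x = \<zero>\<^bsub>M\<^esub>"
        "x = (\<Oplus>\<^bsub>M \<boxtimes> N\<^esub>j\<in>S. ?t x j)"
      and S': "finite S'" "S' \<subseteq> J" "\<forall>j\<in>J - S'. contraction M N (\<phi> j) y = \<zero>\<^bsub>M\<^esub>"
        "y = (\<Oplus>\<^bsub>M \<boxtimes> N\<^esub>j\<in>S'. ?t y j)" by blast
    have fin: "finite (S \<union> S')" "S \<union> S' \<subseteq> J" using S S' by auto
    have tc: "?t z j \<in> carrier (M \<boxtimes> N)" if "j \<in> J" "z \<in> carrier (M \<boxtimes> N)" for z j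
      using that by (auto intro!: pc linear_map_closed[OF c] e)
    have "x = (\<Oplus>\<^bsub>M \<boxtimes> N\<^esub>j\<in>S \<union> S'. ?t x j)"
      by (subst S(4), rule MN.M.add.finprod_mono_neutral_cong_left)
        (use S S' tc add e p0 in \<open>auto simp: subset_iff\<close>)
    moreover have "y = (\<Oplus>\<^bsub>M \<boxtimes> N\<^esub>j\<in>S \<union> S'. ?t y j)"
      by (subst S'(4), rule MN.M.add.finprod_mono_neutral_cong_left)
        (use S S' tc add e p0 in \<open>auto simp: subset_iff\<close>)
    ultimately have "x \<oplus>\<^bsub>M \<boxtimes> N\<^esub> y = (\<Oplus>\<^bsub>M \<boxtimes> N\<^esub>j\<in>S \<union> S'. ?t x j) \<oplus>\<^bsub>M \<boxtimes> N\<^esub> (\<Oplus>\<^bsub>M \<boxtimes> N\<^esub>j\<in>S \<union> S'. ?t y j)"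
      by simp
    also have "\<dots> = (\<Oplus>\<^bsub>M \<boxtimes> N\<^esub>j\<in>S \<union> S'. ?t x j \<oplus>\<^bsub>M \<boxtimes> N\<^esub> ?t y j)"
      by (rule MN.M.finsum_addf[symmetric]) (use fin tc add in auto)
    also have "\<dots> = (\<Oplus>\<^bsub>M \<boxtimes> N\<^esub>j\<in>S \<union> S'. ?t (x \<oplus>\<^bsub>M \<boxtimes> N\<^esub> y) j)"
    proof (rule MN.M.add.finprod_cong')
      show "(\<lambda>j. ?t (x \<oplus>\<^bsub>M \<boxtimes> N\<^esub> y) j) \<in> S \<union> S' \<rightarrow> carrier (M \<boxtimes> N)"
        using fin tc add by auto
      fix j assume "j \<in> S \<union> S'"
      then have j: "j \<in> J" using fin by auto
      show "?t x j \<oplus>\<^bsub>M \<boxtimes> N\<^esub> ?t y j = ?t (x \<oplus>\<^bsub>M \<boxtimes> N\<^esub> y) j"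
        using add(1,2) e[OF j] linear_map_closed[OF c[OF j]]
        by (simp add: linear_map_add[OF c[OF j]] bilinear_map_add_left[OF bil])
    qed simp
    finally have "x \<oplus>\<^bsub>M \<boxtimes> N\<^esub> y = (\<Oplus>\<^bsub>M \<boxtimes> N\<^esub>j\<in>S \<union> S'. ?t (x \<oplus>\<^bsub>M \<boxtimes> N\<^esub> y) j)" .
    moreover have "\<forall>j\<in>J - (S \<union> S'). contraction M N (\<phi> j) (x \<oplus>\<^bsub>M \<boxtimes> N\<^esub> y) = \<zero>\<^bsub>M\<^esub>"
      using S(3) S'(3) add(1,2) by (auto simp: linear_map_add[OF c])
    ultimately show ?case using fin by blast
  qed
qed

lemma eq_zero_if_contractions_zero:
  assumes m: "module K M" "module K N" and db: "dual_basis K N J \<phi> e" and x: "x \<in> carrier (M \<boxtimes> N)"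
    and zero: "\<And>j. j \<in> J \<Longrightarrow> contraction M N (\<phi> j) x = \<zero>\<^bsub>M\<^esub>"
  shows "x = \<zero>\<^bsub>M \<boxtimes> N\<^esub>"
proof -
  interpret MN: module K "M \<boxtimes> N" by (rule ndi_tensor_module[OF m])
  obtain S where S: "S \<subseteq> J" "x = (\<Oplus>\<^bsub>M \<boxtimes> N\<^esub>j\<in>S. pure M N (contraction M N (\<phi> j) x) (e j))"
    using contraction_expansion[OF m db x] by blast
  have "pure M N (contraction M N (\<phi> j) x) (e j) = \<zero>\<^bsub>M \<boxtimes> N\<^esub>" if "j \<in> S" for j
  proof -
    have "e j \<in> carrier N" using db that S(1) by (auto simp: dual_basis_def)
    then show ?thesis
      using linear_map_zero[OF bilinear_map_left[OF pure_bilinear[OF m]] m(1) MN.module_axioms]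
        zero that S(1) by auto
  qed
  then have "(\<Oplus>\<^bsub>M \<boxtimes> N\<^esub>j\<in>S. pure M N (contraction M N (\<phi> j) x) (e j)) = (\<Oplus>\<^bsub>M \<boxtimes> N\<^esub>j\<in>S. \<zero>\<^bsub>M \<boxtimes> N\<^esub>)"
    by (intro MN.M.add.finprod_cong') auto
  then show ?thesis using S(2) by simp
qed

text \<open>Expanding first along a dual basis of \<open>N\<close> and then expanding the coefficients along one of \<open>M\<close> gives a
dual basis of the tensor product, indexed by pairs. An injection of pairs into the infinite universe
turns the index set into a set of elements of the universe.\<close>

lemma projective_tensor:
  assumes "projective_module K M" "projective_module K N"
  shows "projective_module K (M \<boxtimes> N)"
proof -
  have m: "module K M" "module K N" using assms by (simp_all add: projective_module_def)
  interpret M: module K M by fact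
  interpret MN: module K "M \<boxtimes> N" by (rule ndi_tensor_module[OF m])
  obtain J :: "'u set" and \<phi> e where db: "dual_basis K N J \<phi> e"
    by (rule projective_module_imp_dual_basis[OF assms(2)])
  obtain I :: "'u set" and \<psi> d where db': "dual_basis K M I \<psi> d"
    by (rule projective_module_imp_dual_basis[OF assms(1)])
  have \<phi>: "linear_map K N (base_algebra K) (\<phi> j)" and e: "e j \<in> carrier N" if "j \<in> J" for j
    using db that by (auto simp: dual_basis_def)
  have \<psi>: "linear_map K M (base_algebra K) (\<psi> i)" and d: "d i \<in> carrier M" if "i \<in> I" for i
    using db' that by (auto simp: dual_basis_def)
  note bil = pure_bilinear[OF m]
  note c = contraction_linear[OF m \<phi>]
  let ?c = "\<lambda>j. contraction M N (\<phi> j)"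
  let ?\<Phi> = "\<lambda>(i, j) x. \<psi> i (?c j x)" and ?E = "\<lambda>(i, j). pure M N (d i) (e j)"
  have \<psi>c: "\<psi> i y \<in> carrier K" if "i \<in> I" "y \<in> carrier M" for i y
    using linear_map_closed[OF \<psi>[OF that(1)] that(2)] by (simp add: base_algebra_def)
  have \<psi>0: "\<psi> i \<zero>\<^bsub>M\<^esub> = \<zero>\<^bsub>K\<^esub>" if "i \<in> I" for i
  proof -
    have "\<psi> i (\<zero>\<^bsub>K\<^esub> \<odot>\<^bsub>M\<^esub> \<zero>\<^bsub>M\<^esub>) = \<zero>\<^bsub>K\<^esub> \<otimes>\<^bsub>K\<^esub> \<psi> i \<zero>\<^bsub>M\<^esub>"
      using linear_map_smult[OF \<psi>[OF that], of "\<zero>\<^bsub>K\<^esub>" "\<zero>\<^bsub>M\<^esub>"] by (simp add: base_algebra_def)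
    then show ?thesis using \<psi>c[OF that] by simp
  qed
  have "dual_basis K (M \<boxtimes> N) (I \<times> J) ?\<Phi> ?E"
    unfolding dual_basis_def
  proof (intro conjI ballI funcsetI)
    fix z assume "z \<in> I \<times> J"
    then show "linear_map K (M \<boxtimes> N) (base_algebra K) (?\<Phi> z)" "?E z \<in> carrier (M \<boxtimes> N)"
      by (auto intro!: linear_map_compose[OF c \<psi>] bilinear_map_closed[OF bil] d e)
  next
    fix x assume x: "x \<in> carrier (M \<boxtimes> N)"
    obtain S where S: "finite S" "S \<subseteq> J" "\<forall>j\<in>J - S. ?c j x = \<zero>\<^bsub>M\<^esub>"
        "x = (\<Oplus>\<^bsub>M \<boxtimes> N\<^esub>j\<in>S. pure M N (?c j x) (e j))"
      using contraction_expansion[OF m db x] by blast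
    have cx: "?c j x \<in> carrier M" if "j \<in> J" for j by (rule linear_map_closed[OF c[OF that] x])
    have "\<forall>j\<in>J. \<exists>R. finite R \<and> R \<subseteq> I \<and> (\<forall>i\<in>I - R. \<psi> i (?c j x) = \<zero>\<^bsub>K\<^esub>) \<and>
        ?c j x = (\<Oplus>\<^bsub>M\<^esub>i\<in>R. \<psi> i (?c j x) \<odot>\<^bsub>M\<^esub> d i)"
      using db' cx unfolding dual_basis_def by blast
    then obtain R where R: "\<And>j. j \<in> J \<Longrightarrow> finite (R j)" "\<And>j. j \<in> J \<Longrightarrow> R j \<subseteq> I"
        "\<And>j i. \<lbrakk>j \<in> J; i \<in> I - R j\<rbrakk> \<Longrightarrow> \<psi> i (?c j x) = \<zero>\<^bsub>K\<^esub>"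
        "\<And>j. j \<in> J \<Longrightarrow> ?c j x = (\<Oplus>\<^bsub>M\<^esub>i\<in>R j. \<psi> i (?c j x) \<odot>\<^bsub>M\<^esub> d i)"
      unfolding bchoice_iff by blast
    \<comment> \<open>One finite set of indices for the first factor that serves all \<open>j\<close> in \<open>S\<close> at once.\<close>
    define Q where "Q = (\<Union>j\<in>S. R j)"
    have Q: "finite Q" "Q \<subseteq> I" using R S unfolding Q_def by blast+
    have summand: "pure M N (?c j x) (e j) = (\<Oplus>\<^bsub>M \<boxtimes> N\<^esub>i\<in>Q. ?\<Phi> (i, j) x \<odot>\<^bsub>M \<boxtimes> N\<^esub> ?E (i, j))" if j: "j \<in> S" for j
    proof -
      have jJ: "j \<in> J" using j S by blast
      have "?c j x = (\<Oplus>\<^bsub>M\<^esub>i\<in>R j. \<psi> i (?c j x) \<odot>\<^bsub>M\<^esub> d i)" by (rule R(4)[OF jJ])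
      also have "\<dots> = (\<Oplus>\<^bsub>M\<^esub>i\<in>Q. \<psi> i (?c j x) \<odot>\<^bsub>M\<^esub> d i)"
        by (rule M.M.add.finprod_mono_neutral_cong_left)
          (use Q j jJ R(3)[OF jJ] \<psi>c cx d in \<open>auto simp: Q_def subset_iff\<close>)
      finally have "pure M N (?c j x) (e j) = pure M N (\<Oplus>\<^bsub>M\<^esub>i\<in>Q. \<psi> i (?c j x) \<odot>\<^bsub>M\<^esub> d i) (e j)"
        by (rule arg_cong)
      also have "\<dots> = (\<Oplus>\<^bsub>M \<boxtimes> N\<^esub>i\<in>Q. pure M N (\<psi> i (?c j x) \<odot>\<^bsub>M\<^esub> d i) (e j))"
        by (rule linear_map_finsum[OF bilinear_map_left[OF bil e[OF jJ]] m(1) MN.module_axioms Q(1)])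
          (use Q(2) \<psi>c cx jJ d in auto)
      also have "\<dots> = (\<Oplus>\<^bsub>M \<boxtimes> N\<^esub>i\<in>Q. ?\<Phi> (i, j) x \<odot>\<^bsub>M \<boxtimes> N\<^esub> ?E (i, j))"
        by (rule MN.M.add.finprod_cong')
          (use Q(2) \<psi>c cx jJ d e in \<open>auto simp: subset_iff bilinear_map_smult_left[OF bil] bilinear_map_closed[OF bil]\<close>)
      finally show ?thesis .
    qed
    have tc: "?\<Phi> (i, j) x \<odot>\<^bsub>M \<boxtimes> N\<^esub> ?E (i, j) \<in> carrier (M \<boxtimes> N)" if "i \<in> Q" "j \<in> S" for i j
      using that Q(2) S(2) \<psi>c cx d e bilinear_map_closed[OF bil] by (auto simp: subset_iff)
    have "x = (\<Oplus>\<^bsub>M \<boxtimes> N\<^esub>j\<in>S. \<Oplus>\<^bsub>M \<boxtimes> N\<^esub>i\<in>Q. ?\<Phi> (i, j) x \<odot>\<^bsub>M \<boxtimes> N\<^esub> ?E (i, j))"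
      by (subst S(4), rule MN.M.add.finprod_cong')
        (use summand tc in \<open>auto intro!: MN.M.finsum_closed\<close>)
    also have "\<dots> = (\<Oplus>\<^bsub>M \<boxtimes> N\<^esub>z\<in>Q \<times> S. ?\<Phi> z x \<odot>\<^bsub>M \<boxtimes> N\<^esub> ?E z)"
      by (rule finsum_cartesian[symmetric, OF MN.M.abelian_group_axioms Q(1) S(1),
            where g = "\<lambda>z. ?\<Phi> z x \<odot>\<^bsub>M \<boxtimes> N\<^esub> ?E z"]) (rule tc)
    finally have "x = (\<Oplus>\<^bsub>M \<boxtimes> N\<^esub>z\<in>Q \<times> S. ?\<Phi> z x \<odot>\<^bsub>M \<boxtimes> N\<^esub> ?E z)" .
    moreover have "?\<Phi> z x = \<zero>\<^bsub>K\<^esub>" if z_in: "z \<in> I \<times> J - Q \<times> S" for z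
    proof -
      obtain i j where z: "z = (i, j)" "i \<in> I" "j \<in> J" using z_in by blast
      show ?thesis
      proof (cases "j \<in> S")
        case True
        then have "i \<notin> R j" using z_in z by (auto simp: Q_def)
        then show ?thesis using R(3) z by auto
      next
        case False
        then show ?thesis using S(3) z \<psi>0 by auto
      qed
    qed
    ultimately show "\<exists>Q. finite Q \<and> Q \<subseteq> I \<times> J \<and> (\<forall>z\<in>I \<times> J - Q. ?\<Phi> z x = \<zero>\<^bsub>K\<^esub>) \<and>
        x = (\<Oplus>\<^bsub>M \<boxtimes> N\<^esub>z\<in>Q. ?\<Phi> z x \<odot>\<^bsub>M \<boxtimes> N\<^esub> ?E z)"
      using Q S(1,2) by (intro exI[of _ "Q \<times> S"]) auto
  qed
  moreover have "\<exists>g :: 'u \<times> 'u \<Rightarrow> 'u. inj g"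
    using card_of_Times_same_infinite[OF infinite_universe]
    by (simp add: eqpoll_iff_card_of_ordIso[symmetric]) (auto simp: eqpoll_def bij_betw_def)
  then obtain g :: "'u \<times> 'u \<Rightarrow> 'u" where "inj g" ..
  ultimately show ?thesis
    using dual_basis_imp_projective_module[OF MN.module_axioms
        dual_basis_reindex[OF MN.module_axioms _ inj_on_subset[OF \<open>inj g\<close>]]] by blast
qed

section \<open>Tensor products of nondegenerate and idempotent actions\<close>

text \<open>Contractions along \<open>N\<close> commute with $f \otimes \mathrm{id}$. So every contraction of \<open>x\<close> is killed by
all \<open>f a\<close>, hence zero, and \<open>x\<close> is recovered from its contractions.\<close>

lemma eq_zero_if_left_factor_annihilated:
  assumes m: "module K M" "module K N" and N: "projective_module K N"
    and f: "\<And>a. a \<in> I \<Longrightarrow> linear_map K M M (f a)"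
    and nondeg: "\<And>y. \<lbrakk>y \<in> carrier M; \<And>a. a \<in> I \<Longrightarrow> f a y = \<zero>\<^bsub>M\<^esub>\<rbrakk> \<Longrightarrow> y = \<zero>\<^bsub>M\<^esub>"
    and x: "x \<in> carrier (M \<boxtimes> N)"
    and zero: "\<And>a. a \<in> I \<Longrightarrow> tensor_map M N M N (f a) (\<lambda>n. n) x = \<zero>\<^bsub>M \<boxtimes> N\<^esub>"
  shows "x = \<zero>\<^bsub>M \<boxtimes> N\<^esub>"
proof -
  obtain J :: "'u set" and \<phi> e where db: "dual_basis K N J \<phi> e"
    by (rule projective_module_imp_dual_basis[OF N])
  have \<phi>: "linear_map K N (base_algebra K) (\<phi> j)" if "j \<in> J" for j
    using db that by (auto simp: dual_basis_def)
  have \<phi>c: "\<phi> j y \<in> carrier K" if "j \<in> J" "y \<in> carrier N" for j y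
    using linear_map_closed[OF \<phi>[OF that(1)] that(2)] by (simp add: base_algebra_def)
  note c = contraction_linear[OF m \<phi>]
  show ?thesis
  proof (rule eq_zero_if_contractions_zero[OF m db x], rule nondeg)
    fix j assume j: "j \<in> J"
    show "contraction M N (\<phi> j) x \<in> carrier M" by (rule linear_map_closed[OF c[OF j] x])
    fix a assume a: "a \<in> I"
    note t = tensor_map_linear[OF m m f[OF a] linear_map_id]
    have "f a (contraction M N (\<phi> j) x) = contraction M N (\<phi> j) (tensor_map M N M N (f a) (\<lambda>n. n) x)"
      by (rule ndi_linear_eqI[OF m linear_map_compose[OF c[OF j] f[OF a]] linear_map_compose[OF t c[OF j]] _ x])
        (simp add: contraction_pure[OF m \<phi>[OF j]] tensor_map_pure[OF m m f[OF a] linear_map_id]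
          linear_map_smult[OF f[OF a]] linear_map_closed[OF f[OF a]] \<phi>c[OF j])
    also have "\<dots> = \<zero>\<^bsub>M\<^esub>"
      unfolding zero[OF a] by (rule linear_map_zero[OF c[OF j] ndi_tensor_module[OF m] m(1)])
    finally show "f a (contraction M N (\<phi> j) x) = \<zero>\<^bsub>M\<^esub>" .
  qed
qed

definition swap :: "('k, 'u) module \<Rightarrow> ('k, 'u) module \<Rightarrow> 'u \<Rightarrow> 'u"
  where "swap M N = ndi_lift K M N (N \<boxtimes> M) (\<lambda>m n. pure N M n m)"

lemma
  assumes m: "module K M" "module K N"
  shows swap_linear: "linear_map K (M \<boxtimes> N) (N \<boxtimes> M) (swap M N)"
    and swap_pure: "\<lbrakk>x \<in> carrier M; y \<in> carrier N\<rbrakk> \<Longrightarrow> swap M N (pure M N x y) = pure N M y x"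
  unfolding swap_def
  by (rule ndi_lift_linear[OF m ndi_tensor_module[OF m(2,1)] bilinear_map_flip[OF pure_bilinear[OF m(2,1)]]],
      rule ndi_lift_pure[OF m ndi_tensor_module[OF m(2,1)] bilinear_map_flip[OF pure_bilinear[OF m(2,1)]]])

lemma swap_swap:
  assumes m: "module K M" "module K N" and "x \<in> carrier (M \<boxtimes> N)"
  shows "swap N M (swap M N x) = x"
  by (rule ndi_linear_eqI[OF m linear_map_compose[OF swap_linear[OF m] swap_linear[OF m(2,1)]] linear_map_id _ assms(3)])
    (simp add: swap_pure[OF m] swap_pure[OF m(2,1)])

text \<open>$h_a \otimes h'_b$ is the composite of $h_a \otimes \mathrm{id}$ and $\mathrm{id} \otimes h'_b$. If all of
these composites kill \<open>x\<close>, then \<open>eq_zero_if_left_factor_annihilated\<close> yields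
$(\mathrm{id} \otimes h'_b)(x) = 0$ for all $b$; after exchanging the factors it yields $x = 0$.\<close>

lemma left_nondegenerate_tensor:
  assumes p: "projective_module K M" "projective_module K N" and m': "module K P" "module K Q"
    and h: "bilinear_map K P M M h" and h': "bilinear_map K Q N N h'"
    and nd: "left_nondegenerate M P h" "left_nondegenerate N Q h'"
  shows "left_nondegenerate (M \<boxtimes> N) (P \<boxtimes> Q) (tensor_action P Q M N M N h h')"
  unfolding left_nondegenerate_def
proof (intro ballI impI)
  have m: "module K M" "module K N" using p by (simp_all add: projective_module_def)
  fix x assume x: "x \<in> carrier (M \<boxtimes> N)"
    and zero: "\<forall>z\<in>carrier (P \<boxtimes> Q). tensor_action P Q M N M N h h' z x = \<zero>\<^bsub>M \<boxtimes> N\<^esub>"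
  note act = tensor_action_bilinear[OF m' m m h h']
  note l = bilinear_map_right[OF h] and l' = bilinear_map_right[OF h']
  have nd1: "y = \<zero>\<^bsub>M\<^esub>" if "y \<in> carrier M" "\<And>a. a \<in> carrier P \<Longrightarrow> h a y = \<zero>\<^bsub>M\<^esub>" for y
    using nd(1) that by (simp add: left_nondegenerate_def)
  have nd2: "y = \<zero>\<^bsub>N\<^esub>" if "y \<in> carrier N" "\<And>a. a \<in> carrier Q \<Longrightarrow> h' a y = \<zero>\<^bsub>N\<^esub>" for y
    using nd(2) that by (simp add: left_nondegenerate_def)
  have first: "tensor_map M N M N (\<lambda>m. m) (h' b) x = \<zero>\<^bsub>M \<boxtimes> N\<^esub>" if b: "b \<in> carrier Q" for b
  proof (rule eq_zero_if_left_factor_annihilated[OF m p(2) l nd1])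
    note t = tensor_map_linear[OF m m linear_map_id l'[OF b]]
    show "tensor_map M N M N (\<lambda>m. m) (h' b) x \<in> carrier (M \<boxtimes> N)" by (rule linear_map_closed[OF t x])
    fix a assume a: "a \<in> carrier P"
    note s = tensor_map_linear[OF m m l[OF a] linear_map_id]
    note ab = pure_closed[OF m' a b]
    have "tensor_map M N M N (h a) (\<lambda>n. n) (tensor_map M N M N (\<lambda>m. m) (h' b) x)
        = tensor_action P Q M N M N h h' (pure P Q a b) x"
      by (rule ndi_linear_eqI[OF m linear_map_compose[OF t s] bilinear_map_right[OF act ab] _ x])
        (simp add: tensor_map_pure[OF m m linear_map_id l'[OF b]] tensor_map_pure[OF m m l[OF a] linear_map_id]
          tensor_action_pure[OF m' m m h h'] a b linear_map_closed[OF l'[OF b]])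
    also have "\<dots> = \<zero>\<^bsub>M \<boxtimes> N\<^esub>" using zero ab by blast
    finally show "tensor_map M N M N (h a) (\<lambda>n. n) (tensor_map M N M N (\<lambda>m. m) (h' b) x) = \<zero>\<^bsub>M \<boxtimes> N\<^esub>" .
  qed
  have "swap M N x = \<zero>\<^bsub>N \<boxtimes> M\<^esub>"
  proof (rule eq_zero_if_left_factor_annihilated[OF m(2,1) p(1) l' nd2])
    show "swap M N x \<in> carrier (N \<boxtimes> M)" by (rule linear_map_closed[OF swap_linear[OF m] x])
    fix b assume b: "b \<in> carrier Q"
    note t = tensor_map_linear[OF m m linear_map_id l'[OF b]]
    note s = tensor_map_linear[OF m(2,1) m(2,1) l'[OF b] linear_map_id]
    have "tensor_map N M N M (h' b) (\<lambda>n. n) (swap M N x) = swap M N (tensor_map M N M N (\<lambda>m. m) (h' b) x)"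
      by (rule ndi_linear_eqI[OF m linear_map_compose[OF swap_linear[OF m] s]
            linear_map_compose[OF t swap_linear[OF m]] _ x])
        (simp add: tensor_map_pure[OF m m linear_map_id l'[OF b]] swap_pure[OF m]
          tensor_map_pure[OF m(2,1) m(2,1) l'[OF b] linear_map_id] linear_map_closed[OF l'[OF b]])
    also have "\<dots> = \<zero>\<^bsub>N \<boxtimes> M\<^esub>"
      unfolding first[OF b]
      by (rule linear_map_zero[OF swap_linear[OF m] ndi_tensor_module[OF m] ndi_tensor_module[OF m(2,1)]])
    finally show "tensor_map N M N M (h' b) (\<lambda>n. n) (swap M N x) = \<zero>\<^bsub>N \<boxtimes> M\<^esub>" .
  qed
  then have "swap N M (swap M N x) = \<zero>\<^bsub>M \<boxtimes> N\<^esub>"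
    using linear_map_zero[OF swap_linear[OF m(2,1)] ndi_tensor_module[OF m(2,1)] ndi_tensor_module[OF m]] by simp
  then show "x = \<zero>\<^bsub>M \<boxtimes> N\<^esub>" by (simp add: swap_swap[OF m x])
qed

text \<open>A pure tensor $(p \cdot x) \otimes (q \cdot y)$ equals $(p \otimes q) \cdot (x \otimes y)$, and such tensors
generate $M \otimes N$ because \<open>M\<close> and \<open>N\<close> are idempotent.\<close>

lemma left_idempotent_tensor:
  assumes m: "module K M" "module K N" and m': "module K P" "module K Q"
    and h: "bilinear_map K P M M h" and h': "bilinear_map K Q N N h'"
    and id: "left_idempotent M P h" "left_idempotent N Q h'"
  shows "left_idempotent (M \<boxtimes> N) (P \<boxtimes> Q) (tensor_action P Q M N M N h h')"
proof -
  interpret M: module K M by fact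
  interpret N: module K N by fact
  interpret MN: module K "M \<boxtimes> N" by (rule ndi_tensor_module[OF m])
  note act = tensor_action_bilinear[OF m' m m h h']
  note bil = pure_bilinear[OF m]
  let ?S = "{tensor_action P Q M N M N h h' z x | z x. z \<in> carrier (P \<boxtimes> Q) \<and> x \<in> carrier (M \<boxtimes> N)}"
  have S: "?S \<subseteq> carrier (M \<boxtimes> N)" using bilinear_map_closed[OF act] by blast
  note add_fs = finite_sums_add[OF MN.M.abelian_group_axioms S]
  have 1: "pure M N (h p x) (h' q y) \<in> finite_sums (M \<boxtimes> N) ?S"
    if "p \<in> carrier P" "q \<in> carrier Q" "x \<in> carrier M" "y \<in> carrier N" for p q x y
  proof (rule finite_sums_incl[OF MN.M.abelian_group_axioms S])
    show "pure M N (h p x) (h' q y) \<in> ?S"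
      using tensor_action_pure[OF m' m m h h' that, symmetric]
        pure_closed[OF m' that(1,2)] pure_closed[OF m that(3,4)] by blast
  qed
  have 2: "pure M N (h p x) y \<in> finite_sums (M \<boxtimes> N) ?S"
    if p: "p \<in> carrier P" "x \<in> carrier M" and y: "y \<in> carrier N" for p x y
    using id(2) m(2) h' y
  proof (induction rule: left_idempotent_induct)
    case zero
    have "pure M N (h p x) \<zero>\<^bsub>N\<^esub> = \<zero>\<^bsub>M \<boxtimes> N\<^esub>"
      using linear_map_zero[OF bilinear_map_right[OF bil] m(2) MN.module_axioms] bilinear_map_closed[OF h p] by blast
    then show ?case by (simp add: finite_sums.zero)
  next
    case (act q y)
    then show ?case using 1 p by blast
  next
    case (add y y')
    then show ?case
      using bilinear_map_add_right[OF bil bilinear_map_closed[OF h p]] add_fs by simp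
  qed
  have 3: "pure M N x y \<in> finite_sums (M \<boxtimes> N) ?S"
    if x: "x \<in> carrier M" and y: "y \<in> carrier N" for x y
    using id(1) m(1) h x
  proof (induction rule: left_idempotent_induct)
    case zero
    have "pure M N \<zero>\<^bsub>M\<^esub> y = \<zero>\<^bsub>M \<boxtimes> N\<^esub>"
      using linear_map_zero[OF bilinear_map_left[OF bil y] m(1) MN.module_axioms] .
    then show ?case by (simp add: finite_sums.zero)
  next
    case (act p x)
    then show ?case using 2 y by blast
  next
    case (add x x')
    then show ?case using bilinear_map_add_left[OF bil _ _ y] add_fs by simp
  qed
  have "x \<in> finite_sums (M \<boxtimes> N) ?S" if "x \<in> carrier (M \<boxtimes> N)" for x
    using m that by (induction rule: ndi_tensor_induct) (auto intro: 3 add_fs)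
  then have "carrier (M \<boxtimes> N) \<subseteq> finite_sums (M \<boxtimes> N) ?S" by (rule subsetI)
  then show ?thesis
    using left_idempotent_iff[of "M \<boxtimes> N" "P \<boxtimes> Q", OF MN.M.abelian_group_axioms bilinear_map_closed[OF act]]
    by (rule iffD2[rotated])
qed

end

section \<open>Objects and morphisms\<close>

text \<open>Apply non-degeneracy to $m - n$. Identities for an action of $A$ on $C$ that is transported along an
action of $B$ are verified by this criterion, after letting elements of $B$ act.\<close>

lemma left_nondegenerate_eqI:
  assumes "left_nondegenerate M A act" "module K M" "bilinear_map K A M M act"
    and m: "m \<in> carrier M" "n \<in> carrier M"
    and eq: "\<And>a. a \<in> carrier A \<Longrightarrow> act a m = act a n"
  shows "m = n"
proof -
  interpret M: module K M by fact
  have "act a (m \<ominus>\<^bsub>M\<^esub> n) = \<zero>\<^bsub>M\<^esub>" if a: "a \<in> carrier A" for a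
  proof -
    have "act a (m \<ominus>\<^bsub>M\<^esub> n) = act a (n \<oplus>\<^bsub>M\<^esub> \<ominus>\<^bsub>M\<^esub> n)"
      using a m eq[OF a] by (simp add: a_minus_def bilinear_map_add_right[OF assms(3)] del: M.M.r_neg)
    also have "\<dots> = \<zero>\<^bsub>M\<^esub>"
      using linear_map_zero[OF bilinear_map_right[OF assms(3) a] assms(2) assms(2)] m by (simp add: M.M.r_neg)
    finally show ?thesis .
  qed
  then have "m \<ominus>\<^bsub>M\<^esub> n = \<zero>\<^bsub>M\<^esub>"
    using assms(1) m unfolding left_nondegenerate_def by blast
  then show ?thesis
    using m M.M.minus_equality[of m "\<ominus>\<^bsub>M\<^esub> n"] by (simp add: a_minus_def)
qed

lemma left_nondegenerate_cong:
  assumes "\<And>a x. \<lbrakk>a \<in> carrier A; x \<in> carrier M\<rbrakk> \<Longrightarrow> act a x = act' a x"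
  shows "left_nondegenerate M A act \<longleftrightarrow> left_nondegenerate M A act'"
  using assms by (simp add: left_nondegenerate_def)

lemma left_idempotent_cong:
  assumes "abelian_group M" and closed: "\<And>a x. \<lbrakk>a \<in> carrier A; x \<in> carrier M\<rbrakk> \<Longrightarrow> act' a x \<in> carrier M"
    and eq: "\<And>a x. \<lbrakk>a \<in> carrier A; x \<in> carrier M\<rbrakk> \<Longrightarrow> act a x = act' a x"
  shows "left_idempotent M A act \<longleftrightarrow> left_idempotent M A act'"
proof -
  have "{act a x | a x. a \<in> carrier A \<and> x \<in> carrier M} = {act' a x | a x. a \<in> carrier A \<and> x \<in> carrier M}"
    using eq by (intro Collect_cong) (metis (no_types))
  then show ?thesis
    using left_idempotent_iff[of M A act] left_idempotent_iff[of M A act'] assms by simp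
qed

lemma left_idempotent_flip:
  "left_idempotent A A (\<lambda>a b. h a b) \<longleftrightarrow> left_idempotent A A (\<lambda>a b. h b a)"
  unfolding left_idempotent_def by blast

text \<open>The right-handed conditions are expressed as left-handed ones for the flipped multiplication, so that
every result about left actions also applies to right actions.\<close>

lemma
  assumes "A \<in> ndi_Ob K"
  shows ndi_Ob_module: "module K A"
    and ndi_Ob_mult: "bilinear_map K A A A (monoid.mult A)"
    and ndi_Ob_assoc: "\<lbrakk>a \<in> carrier A; b \<in> carrier A; c \<in> carrier A\<rbrakk>
      \<Longrightarrow> (a \<otimes>\<^bsub>A\<^esub> b) \<otimes>\<^bsub>A\<^esub> c = a \<otimes>\<^bsub>A\<^esub> (b \<otimes>\<^bsub>A\<^esub> c)"
    and ndi_Ob_projective: "projective_module K A"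
    and ndi_Ob_left_nondegenerate: "left_nondegenerate A A (monoid.mult A)"
    and ndi_Ob_right_nondegenerate: "left_nondegenerate A A (\<lambda>a b. b \<otimes>\<^bsub>A\<^esub> a)"
    and ndi_Ob_left_idempotent: "left_idempotent A A (monoid.mult A)"
    and ndi_Ob_right_idempotent: "left_idempotent A A (\<lambda>a b. b \<otimes>\<^bsub>A\<^esub> a)"
proof -
  have *: "nonunital_algebra K A" "nondegenerate_algebra A" "idempotent_algebra A" "projective_module K A"
    using assms by (simp_all add: ndi_Ob_def)
  show "module K A" using *(1) by (simp add: nonunital_algebra_def)
  show "bilinear_map K A A A (monoid.mult A)" using nonunital_algebra.mult_bilinear[OF *(1)] .
  show "(a \<otimes>\<^bsub>A\<^esub> b) \<otimes>\<^bsub>A\<^esub> c = a \<otimes>\<^bsub>A\<^esub> (b \<otimes>\<^bsub>A\<^esub> c)"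
    if "a \<in> carrier A" "b \<in> carrier A" "c \<in> carrier A"
    using nonunital_algebra.mult_assoc[OF *(1) that] .
  show "projective_module K A" by fact
  show "left_nondegenerate A A (monoid.mult A)" "left_nondegenerate A A (\<lambda>a b. b \<otimes>\<^bsub>A\<^esub> a)"
    using *(2) by (simp_all add: nondegenerate_algebra_def right_nondegenerate_flip)
  show 1: "left_idempotent A A (\<lambda>a b. b \<otimes>\<^bsub>A\<^esub> a)"
    using *(3) by (simp add: idempotent_algebra_def right_idempotent_flip)
  show "left_idempotent A A (monoid.mult A)"
    using iffD2[OF left_idempotent_flip 1] .
qed

lemma ndi_ObI:
  assumes "projective_module K A" and "bilinear_map K A A A (monoid.mult A)"
    and "\<And>a b c. \<lbrakk>a \<in> carrier A; b \<in> carrier A; c \<in> carrier A\<rbrakk>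
      \<Longrightarrow> (a \<otimes>\<^bsub>A\<^esub> b) \<otimes>\<^bsub>A\<^esub> c = a \<otimes>\<^bsub>A\<^esub> (b \<otimes>\<^bsub>A\<^esub> c)"
    and "left_nondegenerate A A (monoid.mult A)" "left_nondegenerate A A (\<lambda>a b. b \<otimes>\<^bsub>A\<^esub> a)"
    and "left_idempotent A A (monoid.mult A)"
  shows "A \<in> ndi_Ob K"
  using assms iffD1[OF left_idempotent_flip assms(6)] unfolding ndi_Ob_def
  by (simp add: nonunital_algebra_def nonunital_algebra_axioms_def nondegenerate_algebra_def
      idempotent_algebra_def right_nondegenerate_flip right_idempotent_flip projective_module_def)

lemma
  assumes "f \<in> ndi_Hom K B A"
  shows ndi_Hom_src: "src f = B" and ndi_Hom_tgt: "tgt f = A"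
    and lact_bilinear: "bilinear_map K B A A (lact f)"
    and ract_bilinear: "bilinear_map K A B A (ract f)"
    and lact_extensional: "lact f \<in> carrier B \<rightarrow>\<^sub>E (carrier A \<rightarrow>\<^sub>E carrier A)"
    and ract_extensional: "ract f \<in> carrier A \<rightarrow>\<^sub>E (carrier B \<rightarrow>\<^sub>E carrier A)"
    and lact_mult_src: "\<lbrakk>b \<in> carrier B; b' \<in> carrier B; a \<in> carrier A\<rbrakk>
      \<Longrightarrow> lact f (b \<otimes>\<^bsub>B\<^esub> b') a = lact f b (lact f b' a)"
    and ract_mult_src: "\<lbrakk>b \<in> carrier B; b' \<in> carrier B; a \<in> carrier A\<rbrakk>
      \<Longrightarrow> ract f a (b \<otimes>\<^bsub>B\<^esub> b') = ract f (ract f a b) b'"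
    and ract_lact: "\<lbrakk>b \<in> carrier B; b' \<in> carrier B; a \<in> carrier A\<rbrakk>
      \<Longrightarrow> ract f (lact f b a) b' = lact f b (ract f a b')"
    and lact_mult: "\<lbrakk>b \<in> carrier B; a \<in> carrier A; a' \<in> carrier A\<rbrakk>
      \<Longrightarrow> lact f b (a \<otimes>\<^bsub>A\<^esub> a') = lact f b a \<otimes>\<^bsub>A\<^esub> a'"
    and ract_mult: "\<lbrakk>b \<in> carrier B; a \<in> carrier A; a' \<in> carrier A\<rbrakk>
      \<Longrightarrow> ract f (a \<otimes>\<^bsub>A\<^esub> a') b = a \<otimes>\<^bsub>A\<^esub> ract f a' b"
    and ract_mult_lact: "\<lbrakk>b \<in> carrier B; a \<in> carrier A; a' \<in> carrier A\<rbrakk>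
      \<Longrightarrow> ract f a b \<otimes>\<^bsub>A\<^esub> a' = a \<otimes>\<^bsub>A\<^esub> lact f b a'"
    and lact_nondegenerate: "left_nondegenerate A B (lact f)"
    and ract_nondegenerate: "left_nondegenerate A B (\<lambda>b a. ract f a b)"
    and lact_idempotent: "left_idempotent A B (lact f)"
    and ract_idempotent: "left_idempotent A B (\<lambda>b a. ract f a b)"
  using assms
  unfolding ndi_Hom_def is_extension_def Let_def nondegenerate_extension_def idempotent_extension_def
    right_nondegenerate_flip right_idempotent_flip
  by blast+

text \<open>Composites, identities, tensor products of morphisms and the morphisms induced by maps all have this
shape. It separates the algebraic content of \<open>is_extension\<close> from the extensionality of the actions.\<close>

definition extension_on ::
    "('k, 'u) module \<Rightarrow> ('k, 'u) module \<Rightarrow> ('u \<Rightarrow> 'u \<Rightarrow> 'u) \<Rightarrow> ('u \<Rightarrow> 'u \<Rightarrow> 'u) \<Rightarrow> ('k, 'u) extension"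
  where "extension_on B A l r = \<lparr>src = B, tgt = A,
    lact = (\<lambda>b\<in>carrier B. \<lambda>a\<in>carrier A. l b a), ract = (\<lambda>a\<in>carrier A. \<lambda>b\<in>carrier B. r a b)\<rparr>"

lemma lact_extension_on: "\<lbrakk>b \<in> carrier B; a \<in> carrier A\<rbrakk> \<Longrightarrow> lact (extension_on B A l r) b a = l b a"
  and ract_extension_on: "\<lbrakk>a \<in> carrier A; b \<in> carrier B\<rbrakk> \<Longrightarrow> ract (extension_on B A l r) a b = r a b"
  by (simp_all add: extension_on_def)

lemma extension_on_in_Hom:
  assumes "module K B" and p: "projective_module K A" and A: "bilinear_map K A A A (monoid.mult A)"
    and B: "bilinear_map K B B B (monoid.mult B)"
    and l: "bilinear_map K B A A l" and r: "bilinear_map K A B A r"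
    and 1: "\<And>b b' a. \<lbrakk>b \<in> carrier B; b' \<in> carrier B; a \<in> carrier A\<rbrakk> \<Longrightarrow> l (b \<otimes>\<^bsub>B\<^esub> b') a = l b (l b' a)"
    and 2: "\<And>b b' a. \<lbrakk>b \<in> carrier B; b' \<in> carrier B; a \<in> carrier A\<rbrakk> \<Longrightarrow> r a (b \<otimes>\<^bsub>B\<^esub> b') = r (r a b) b'"
    and 3: "\<And>b b' a. \<lbrakk>b \<in> carrier B; b' \<in> carrier B; a \<in> carrier A\<rbrakk> \<Longrightarrow> r (l b a) b' = l b (r a b')"
    and 4: "\<And>b a a'. \<lbrakk>b \<in> carrier B; a \<in> carrier A; a' \<in> carrier A\<rbrakk> \<Longrightarrow> l b (a \<otimes>\<^bsub>A\<^esub> a') = l b a \<otimes>\<^bsub>A\<^esub> a'"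
    and 5: "\<And>b a a'. \<lbrakk>b \<in> carrier B; a \<in> carrier A; a' \<in> carrier A\<rbrakk> \<Longrightarrow> r (a \<otimes>\<^bsub>A\<^esub> a') b = a \<otimes>\<^bsub>A\<^esub> r a' b"
    and 6: "\<And>b a a'. \<lbrakk>b \<in> carrier B; a \<in> carrier A; a' \<in> carrier A\<rbrakk> \<Longrightarrow> r a b \<otimes>\<^bsub>A\<^esub> a' = a \<otimes>\<^bsub>A\<^esub> l b a'"
    and nd: "left_nondegenerate A B l" "left_nondegenerate A B (\<lambda>b a. r a b)"
    and id: "left_idempotent A B l" "left_idempotent A B (\<lambda>b a. r a b)"
  shows "extension_on B A l r \<in> ndi_Hom K B A"
proof -
  let ?f = "extension_on B A l r"
  have m: "module K A" using p by (simp add: projective_module_def)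
  interpret A: module K A by (rule m)
  interpret B: module K B by fact
  note c = bilinear_map_closed[OF l] bilinear_map_closed[OF r] bilinear_map_closed[OF A] bilinear_map_closed[OF B]
  note eq = lact_extension_on[of _ B _ A l r] ract_extension_on[of _ A _ B l r]
  have "is_extension K ?f"
    unfolding is_extension_def Let_def
  proof (intro conjI ballI)
    show "bilinear_map K (src ?f) (tgt ?f) (tgt ?f) (lact ?f)"
      using bilinear_map_cong[OF l assms(1) m, of "lact ?f"] by (simp add: extension_on_def)
    show "bilinear_map K (tgt ?f) (src ?f) (tgt ?f) (ract ?f)"
      using bilinear_map_cong[OF r m assms(1), of "ract ?f"] by (simp add: extension_on_def)
  qed (simp_all add: extension_on_def c 1 2 3 4 5 6)
  moreover have "nondegenerate_extension ?f"
    using nd left_nondegenerate_cong[of B A "lact ?f" l] left_nondegenerate_cong[of B A "\<lambda>b a. ract ?f a b" "\<lambda>b a. r a b"]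
    by (simp add: nondegenerate_extension_def right_nondegenerate_flip eq) (simp add: extension_on_def)
  moreover have "left_idempotent A B (lact ?f)"
    using left_idempotent_cong[OF A.M.abelian_group_axioms, of B l "lact ?f"] id(1) c eq by simp
  moreover have "left_idempotent A B (\<lambda>b a. ract ?f a b)"
    using left_idempotent_cong[OF A.M.abelian_group_axioms, of B "\<lambda>b a. r a b" "\<lambda>b a. ract ?f a b"] id(2) c eq
    by simp
  ultimately show ?thesis
    using p by (simp add: ndi_Hom_def idempotent_extension_def right_idempotent_flip) (simp add: extension_on_def)
qed

text \<open>The left action determines the right action: $(a \cdot b) a' = a (b \cdot a')$, and \<open>A\<close> is
non-degenerate.\<close>

lemma ndi_Hom_eqI:
  assumes "A \<in> ndi_Ob K" and f: "f \<in> ndi_Hom K B A" and g: "g \<in> ndi_Hom K B A"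
    and l: "\<And>b a. \<lbrakk>b \<in> carrier B; a \<in> carrier A\<rbrakk> \<Longrightarrow> lact f b a = lact g b a"
  shows "f = g"
proof -
  have r: "ract f a b = ract g a b" if ab: "a \<in> carrier A" "b \<in> carrier B" for a b
  proof (rule left_nondegenerate_eqI[OF ndi_Ob_right_nondegenerate[OF assms(1)] ndi_Ob_module[OF assms(1)]
        bilinear_map_flip[OF ndi_Ob_mult[OF assms(1)]]])
    show "ract f a b \<in> carrier A" "ract g a b \<in> carrier A"
      using bilinear_map_closed[OF ract_bilinear[OF f] ab] bilinear_map_closed[OF ract_bilinear[OF g] ab] by auto
    show "ract f a b \<otimes>\<^bsub>A\<^esub> a' = ract g a b \<otimes>\<^bsub>A\<^esub> a'" if "a' \<in> carrier A" for a'
      using ab that by (simp add: ract_mult_lact[OF f] ract_mult_lact[OF g] l)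
  qed
  have "lact f = lact g"
  proof (rule PiE_ext[OF lact_extensional[OF f] lact_extensional[OF g]])
    fix b assume b: "b \<in> carrier B"
    show "lact f b = lact g b"
      by (rule PiE_ext[of _ "carrier A" "\<lambda>_. carrier A"])
        (use b l lact_extensional[OF f] lact_extensional[OF g] in \<open>auto dest: PiE_mem\<close>)
  qed
  moreover have "ract f = ract g"
  proof (rule PiE_ext[OF ract_extensional[OF f] ract_extensional[OF g]])
    fix a assume a: "a \<in> carrier A"
    show "ract f a = ract g a"
      by (rule PiE_ext[of _ "carrier B" "\<lambda>_. carrier A"])
        (use a r ract_extensional[OF f] ract_extensional[OF g] in \<open>auto dest: PiE_mem\<close>)
  qed
  ultimately show ?thesis
    using ndi_Hom_src[OF f] ndi_Hom_src[OF g] ndi_Hom_tgt[OF f] ndi_Hom_tgt[OF g] by simp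
qed

section \<open>Composition\<close>

text \<open>The one-sided core of composition: \<open>B\<close> acts on \<open>C\<close>, \<open>A\<close> acts on \<open>B\<close> from both sides, and the action of \<open>A\<close>
is transported to \<open>C\<close> by $a \cdot (b \cdot c) = \mathrm{lam}(a, b) \cdot c$. The condition
\<open>compatible\<close> makes this independent of the decomposition. Because only actions are mentioned, the
left and the right action of a composite are two instances of the same construction, with \<open>lam\<close> and
\<open>rho\<close> exchanged.\<close>

locale action_transport =
  fixes K :: "('k, 'm) ring_scheme" and A :: "('k, 'a, 'p) module_scheme"
    and B :: "('k, 'b, 'q) module_scheme" and C :: "('k, 'c, 'r) module_scheme"
    and act :: "'b \<Rightarrow> 'c \<Rightarrow> 'c" and lam :: "'a \<Rightarrow> 'b \<Rightarrow> 'b" and rho :: "'a \<Rightarrow> 'b \<Rightarrow> 'b"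
  assumes mA: "module K A" and mB: "module K B" and mC: "module K C"
    and act: "bilinear_map K B C C act" and lam: "bilinear_map K A B B lam" and rho: "bilinear_map K A B B rho"
    and nondegenerate: "left_nondegenerate C B act" and idempotent: "left_idempotent C B act"
    and compatible: "\<lbrakk>a \<in> carrier A; b \<in> carrier B; b' \<in> carrier B; c \<in> carrier C\<rbrakk>
      \<Longrightarrow> act b (act (lam a b') c) = act (rho a b) (act b' c)"
begin

definition induced :: "'a \<Rightarrow> 'c \<Rightarrow> 'c" where
  "induced a c = (THE s. \<exists>(n::nat). \<exists>x\<in>{..<n} \<rightarrow> carrier C. \<exists>b\<in>{..<n} \<rightarrow> carrier B.
     c = (\<Oplus>\<^bsub>C\<^esub>i\<in>{..<n}. act (b i) (x i)) \<and> s = (\<Oplus>\<^bsub>C\<^esub>i\<in>{..<n}. act (lam a (b i)) (x i)))"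

sublocale A: module K A by (rule mA)
sublocale B: module K B by (rule mB)
sublocale C: module K C by (rule mC)

lemmas act_closed = bilinear_map_closed[OF act]
lemmas lam_closed = bilinear_map_closed[OF lam]
lemmas rho_closed = bilinear_map_closed[OF rho]
lemmas bil_act = act
lemmas eqI = left_nondegenerate_eqI[OF nondegenerate mC act]

text \<open>For any decomposition $c = \sum b_i \cdot x_i$ and any $b$,
\[ b \cdot \sum \mathrm{lam}(a, b_i) \cdot x_i = \sum \mathrm{rho}(a, b) \cdot (b_i \cdot x_i)
   = \mathrm{rho}(a, b) \cdot c, \]
which no longer mentions the decomposition.\<close>

lemma
  assumes a: "a \<in> carrier A" and c: "c \<in> carrier C"
  shows induced_closed: "induced a c \<in> carrier C"
    and act_induced: "b \<in> carrier B \<Longrightarrow> act b (induced a c) = act (rho a b) c"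
proof -
  let ?R = "\<lambda>s. \<exists>(n::nat). \<exists>x\<in>{..<n} \<rightarrow> carrier C. \<exists>b\<in>{..<n} \<rightarrow> carrier B.
     c = (\<Oplus>\<^bsub>C\<^esub>i\<in>{..<n}. act (b i) (x i)) \<and> s = (\<Oplus>\<^bsub>C\<^esub>i\<in>{..<n}. act (lam a (b i)) (x i))"
  have R: "s \<in> carrier C \<and> (\<forall>b\<in>carrier B. act b s = act (rho a b) c)" if Rs: "?R s" for s
  proof -
    obtain n x b where n: "x \<in> {..<n::nat} \<rightarrow> carrier C" "b \<in> {..<n} \<rightarrow> carrier B"
      "c = (\<Oplus>\<^bsub>C\<^esub>i\<in>{..<n}. act (b i) (x i))" "s = (\<Oplus>\<^bsub>C\<^esub>i\<in>{..<n}. act (lam a (b i)) (x i))"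
      using Rs by blast
    have x: "x i \<in> carrier C" and b: "b i \<in> carrier B" if "i < n" for i using n(1,2) that by auto
    have "act b' s = act (rho a b') c" if b': "b' \<in> carrier B" for b'
    proof -
      have "act b' s = (\<Oplus>\<^bsub>C\<^esub>i\<in>{..<n}. act b' (act (lam a (b i)) (x i)))"
        unfolding n(4) by (rule linear_map_finsum[OF bilinear_map_right[OF act b'] mC mC])
          (use x b a act_closed lam_closed in auto)
      also have "\<dots> = (\<Oplus>\<^bsub>C\<^esub>i\<in>{..<n}. act (rho a b') (act (b i) (x i)))"
        by (rule C.M.add.finprod_cong') (use x b a b' compatible act_closed rho_closed in auto)
      also have "\<dots> = act (rho a b') c"
        unfolding n(3) by (rule linear_map_finsum[OF bilinear_map_right[OF act rho_closed[OF a b']] mC mC, symmetric])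
          (use x b act_closed in auto)
      finally show ?thesis .
    qed
    moreover have "s \<in> carrier C"
      unfolding n(4) by (rule C.M.finsum_closed) (use x b a act_closed lam_closed in auto)
    ultimately show ?thesis by blast
  qed
  have "\<exists>s. ?R s"
    using idempotent c unfolding left_idempotent_def by blast
  then obtain s where s: "?R s" ..
  have "?R (THE s. ?R s)"
  proof (rule theI[of ?R, OF s])
    fix t assume t: "?R t"
    show "t = s" by (rule eqI) (use R[OF s] R[OF t] in auto)
  qed
  then have "?R (induced a c)" unfolding induced_def .
  from R[OF this] show "induced a c \<in> carrier C"
    "b \<in> carrier B \<Longrightarrow> act b (induced a c) = act (rho a b) c" by blast+
qed

lemma induced_eqI:
  assumes "a \<in> carrier A" "c \<in> carrier C" "s \<in> carrier C"
    and "\<And>b. b \<in> carrier B \<Longrightarrow> act b s = act (rho a b) c"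
  shows "induced a c = s"
  by (rule eqI) (use assms induced_closed act_induced in auto)

lemma induced_act:
  assumes "a \<in> carrier A" "b \<in> carrier B" "c \<in> carrier C"
  shows "induced a (act b c) = act (lam a b) c"
  by (rule induced_eqI) (use assms act_closed lam_closed compatible in auto)

lemma induced_bilinear: "bilinear_map K A C C induced"
proof (rule bilinear_mapI; rule linear_mapI)
  note simps = bilinear_map_add_left[OF act] bilinear_map_add_right[OF act] bilinear_map_smult_left[OF act]
    bilinear_map_smult_right[OF act] bilinear_map_add_left[OF rho] bilinear_map_smult_left[OF rho]
    act_closed rho_closed act_induced induced_closed
  show "induced a (c \<oplus>\<^bsub>C\<^esub> c') = induced a c \<oplus>\<^bsub>C\<^esub> induced a c'"
    if "a \<in> carrier A" "c \<in> carrier C" "c' \<in> carrier C" for a c c'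
    by (rule induced_eqI) (use that in \<open>simp_all add: simps\<close>)
  show "induced a (r \<odot>\<^bsub>C\<^esub> c) = r \<odot>\<^bsub>C\<^esub> induced a c"
    if "a \<in> carrier A" "r \<in> carrier K" "c \<in> carrier C" for a r c
    by (rule induced_eqI) (use that in \<open>simp_all add: simps\<close>)
  show "induced (a \<oplus>\<^bsub>A\<^esub> a') c = induced a c \<oplus>\<^bsub>C\<^esub> induced a' c"
    if "c \<in> carrier C" "a \<in> carrier A" "a' \<in> carrier A" for a a' c
    by (rule induced_eqI) (use that in \<open>simp_all add: simps\<close>)
  show "induced (r \<odot>\<^bsub>A\<^esub> a) c = r \<odot>\<^bsub>C\<^esub> induced a c"
    if "c \<in> carrier C" "r \<in> carrier K" "a \<in> carrier A" for a r c
    by (rule induced_eqI) (use that in \<open>simp_all add: simps\<close>)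
qed (simp_all add: induced_closed)

lemmas linear_eqI = linear_map_eqI_idempotent[OF idempotent mC mC act]

lemma induced_mult:
  assumes "\<And>b. b \<in> carrier B \<Longrightarrow> lam a'' b = lam a (lam a' b)"
    and a: "a \<in> carrier A" "a' \<in> carrier A" "a'' \<in> carrier A" and c: "c \<in> carrier C"
  shows "induced a'' c = induced a (induced a' c)"
  by (rule linear_eqI[OF bilinear_map_right[OF induced_bilinear a(3)]
        linear_map_compose[OF bilinear_map_right[OF induced_bilinear a(2)] bilinear_map_right[OF induced_bilinear a(1)]] _ c])
    (simp add: a assms(1) lam_closed induced_act)

lemma induced_nondegenerate:
  assumes "left_idempotent B A rho"
  shows "left_nondegenerate C A induced"
  unfolding left_nondegenerate_def
proof (intro ballI impI)
  fix c assume c: "c \<in> carrier C" and zero: "\<forall>a\<in>carrier A. induced a c = \<zero>\<^bsub>C\<^esub>"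
  have "act b c = \<zero>\<^bsub>C\<^esub>" if b: "b \<in> carrier B" for b
    using assms mB rho b
  proof (induction rule: left_idempotent_induct)
    case zero
    show ?case by (rule linear_map_zero[OF bilinear_map_left[OF act c] mB mC])
  next
    case (act a b)
    note ab = this
    have "act (rho a b) c = act b (induced a c)" using ab c by (simp add: act_induced)
    also have "\<dots> = \<zero>\<^bsub>C\<^esub>"
      using zero ab linear_map_zero[OF bilinear_map_right[OF bil_act ab(2)] mC mC] by simp
    finally show ?case .
  next
    case (add b b')
    then show ?case using c by (simp add: bilinear_map_add_left[OF bil_act])
  qed
  then show "c = \<zero>\<^bsub>C\<^esub>" using nondegenerate c unfolding left_nondegenerate_def by blast
qed

lemma induced_idempotent:
  assumes "left_idempotent B A lam"
  shows "left_idempotent C A induced"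
proof -
  let ?S = "{induced a c | a c. a \<in> carrier A \<and> c \<in> carrier C}"
  have S: "?S \<subseteq> carrier C" using induced_closed by blast
  note add_fs = finite_sums_add[OF C.M.abelian_group_axioms S]
  have 1: "act b c \<in> finite_sums C ?S" if b: "b \<in> carrier B" and c: "c \<in> carrier C" for b c
    using assms mB lam b
  proof (induction rule: left_idempotent_induct)
    case zero
    show ?case using linear_map_zero[OF bilinear_map_left[OF act c] mB mC] by (simp add: finite_sums.zero)
  next
    case (act a b)
    have "induced a (act b c) \<in> ?S"
      using act c act_closed by blast
    then show ?case using finite_sums_incl[OF C.M.abelian_group_axioms S] induced_act[OF act c] by simp
  next
    case (add b b')
    then show ?case using c add_fs by (simp add: bilinear_map_add_left[OF act])
  qed
  have "c \<in> finite_sums C ?S" if "c \<in> carrier C" for c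
    using idempotent mC act that
    by (induction rule: left_idempotent_induct) (auto intro: finite_sums.zero 1 add_fs)
  then have "carrier C \<subseteq> finite_sums C ?S" by (rule subsetI)
  then show ?thesis
    using left_idempotent_iff[of C A, OF C.M.abelian_group_axioms induced_closed] by (rule iffD2[rotated])
qed

end

locale composable =
  fixes K :: "('k, 'm) ring_scheme" and A B C :: "('k, 'u) module" and f g :: "('k, 'u) extension"
  assumes A: "A \<in> ndi_Ob K" and B: "B \<in> ndi_Ob K" and C: "C \<in> ndi_Ob K"
    and f: "f \<in> ndi_Hom K A B" and g: "g \<in> ndi_Hom K B C"
begin

lemmas fl = bilinear_map_closed[OF lact_bilinear[OF f]]
lemmas fr = bilinear_map_closed[OF ract_bilinear[OF f]]
lemmas gl = bilinear_map_closed[OF lact_bilinear[OF g]]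
lemmas B_closed = bilinear_map_closed[OF ndi_Ob_mult[OF B]]
lemmas C_closed = bilinear_map_closed[OF ndi_Ob_mult[OF C]]

sublocale left: action_transport K A B C "lact g" "lact f" "\<lambda>a b. ract f b a"
proof (rule action_transport.intro)
  fix a b b' c
  assume "a \<in> carrier A" "b \<in> carrier B" "b' \<in> carrier B" "c \<in> carrier C"
  then show "lact g b (lact g (lact f a b') c) = lact g (ract f b a) (lact g b' c)"
    by (simp add: lact_mult_src[OF g, symmetric] ract_mult_lact[OF f] fl fr)
qed (rule ndi_Ob_module[OF A] ndi_Ob_module[OF B] ndi_Ob_module[OF C] lact_bilinear[OF f] lact_bilinear[OF g]
    lact_nondegenerate[OF g] lact_idempotent[OF g] bilinear_map_flip[OF ract_bilinear[OF f]])+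

sublocale right: action_transport K A B C "\<lambda>b c. ract g c b" "\<lambda>a b. ract f b a" "lact f"
proof (rule action_transport.intro)
  fix a b b' c
  assume "a \<in> carrier A" "b \<in> carrier B" "b' \<in> carrier B" "c \<in> carrier C"
  then show "ract g (ract g c (ract f b' a)) b = ract g (ract g c b') (lact f a b)"
    by (simp add: ract_mult_src[OF g, symmetric] ract_mult_lact[OF f] fl fr)
qed (rule ndi_Ob_module[OF A] ndi_Ob_module[OF B] ndi_Ob_module[OF C] lact_bilinear[OF f]
    ract_nondegenerate[OF g] ract_idempotent[OF g] bilinear_map_flip[OF ract_bilinear[OF f]]
    bilinear_map_flip[OF ract_bilinear[OF g]])+

abbreviation "L \<equiv> left.induced"
abbreviation "R c a \<equiv> right.induced a c"

text \<open>The left action of $g \circ f$ is transported along the left action of \<open>g\<close>, the right action along the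
right action of \<open>g\<close>.\<close>

lemma ndi_Comp_eq: "ndi_Comp g f = extension_on A C L (\<lambda>c a. R c a)"
  unfolding ndi_Comp_def extension_on_def left.induced_def right.induced_def
  using ndi_Hom_src[OF f] ndi_Hom_tgt[OF f] ndi_Hom_tgt[OF g] by (simp add: Let_def)

text \<open>The bimodule law of a composite is first proved for the left action of \<open>B\<close> in place of that of \<open>A\<close>;
there \<open>c\<close> may be assumed to be a product $c' \cdot b'$.\<close>

lemma lact_R:
  assumes "a \<in> carrier A" "b \<in> carrier B" "c \<in> carrier C"
  shows "lact g b (R c a) = R (lact g b c) a"
proof -
  note R = bilinear_map_right[OF right.induced_bilinear assms(1)]
  note l = bilinear_map_right[OF lact_bilinear[OF g] assms(2)]
  show ?thesis
    by (rule right.linear_eqI[OF linear_map_compose[OF R l] linear_map_compose[OF l R] _ assms(3)])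
      (simp add: assms right.induced_act ract_lact[OF g, symmetric] gl fr)
qed

lemma ndi_Comp_in_Hom: "ndi_Comp g f \<in> ndi_Hom K A C"
  unfolding ndi_Comp_eq
proof (rule extension_on_in_Hom[OF ndi_Ob_module[OF A] ndi_Ob_projective[OF C] ndi_Ob_mult[OF C] ndi_Ob_mult[OF A]
      left.induced_bilinear bilinear_map_flip[OF right.induced_bilinear]])
  note Ac = bilinear_map_closed[OF ndi_Ob_mult[OF A]]
  show "L (a \<otimes>\<^bsub>A\<^esub> a') c = L a (L a' c)" if "a \<in> carrier A" "a' \<in> carrier A" "c \<in> carrier C" for a a' c
    by (rule left.induced_mult) (use that Ac in \<open>auto simp: lact_mult_src[OF f]\<close>)
  show "R c (a \<otimes>\<^bsub>A\<^esub> a') = R (R c a) a'" if "a \<in> carrier A" "a' \<in> carrier A" "c \<in> carrier C" for a a' c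
    by (rule right.induced_mult) (use that Ac in \<open>auto simp: ract_mult_src[OF f]\<close>)
  show "R (L a c) a' = L a (R c a')" if "a \<in> carrier A" "a' \<in> carrier A" "c \<in> carrier C" for a a' c
  proof (rule left.induced_eqI[symmetric])
    show "lact g b (R (L a c) a') = lact g (ract f b a) (R c a')" if "b \<in> carrier B" for b
      using that \<open>a \<in> carrier A\<close> \<open>a' \<in> carrier A\<close> \<open>c \<in> carrier C\<close>
      by (simp add: lact_R left.induced_closed left.act_induced fr)
  qed (use that left.induced_closed right.induced_closed in auto)
  show "L a (c \<otimes>\<^bsub>C\<^esub> c') = L a c \<otimes>\<^bsub>C\<^esub> c'" if "a \<in> carrier A" "c \<in> carrier C" "c' \<in> carrier C" for a c c'
  proof -
    note L = bilinear_map_right[OF left.induced_bilinear that(1)]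
    note m = bilinear_map_left[OF ndi_Ob_mult[OF C] that(3)]
    show ?thesis
      by (rule left.linear_eqI[OF linear_map_compose[OF m L] linear_map_compose[OF L m] _ that(2)])
        (simp add: that left.induced_act lact_mult[OF g, symmetric] fl C_closed)
  qed
  show "R (c \<otimes>\<^bsub>C\<^esub> c') a = c \<otimes>\<^bsub>C\<^esub> R c' a" if "a \<in> carrier A" "c \<in> carrier C" "c' \<in> carrier C" for a c c'
  proof -
    note R = bilinear_map_right[OF right.induced_bilinear that(1)]
    note m = bilinear_map_right[OF ndi_Ob_mult[OF C] that(2)]
    show ?thesis
      by (rule right.linear_eqI[OF linear_map_compose[OF m R] linear_map_compose[OF R m] _ that(3)])
        (simp add: that right.induced_act ract_mult[OF g, symmetric] fr C_closed)
  qed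
  show "R c a \<otimes>\<^bsub>C\<^esub> c' = c \<otimes>\<^bsub>C\<^esub> L a c'" if "a \<in> carrier A" "c \<in> carrier C" "c' \<in> carrier C" for a c c'
  proof -
    note R = bilinear_map_right[OF right.induced_bilinear that(1)]
    note m = bilinear_map_left[OF ndi_Ob_mult[OF C]]
    show ?thesis
      by (rule right.linear_eqI[OF linear_map_compose[OF R m[OF that(3)]] m[OF left.induced_closed[OF that(1,3)]] _ that(2)])
        (simp add: that right.induced_act ract_mult_lact[OF g] left.act_induced left.induced_closed fr)
  qed
  show "left_nondegenerate C A L" by (rule left.induced_nondegenerate[OF ract_idempotent[OF f]])
  show "left_nondegenerate C A right.induced" by (rule right.induced_nondegenerate[OF lact_idempotent[OF f]])
  show "left_idempotent C A L" by (rule left.induced_idempotent[OF lact_idempotent[OF f]])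
  show "left_idempotent C A right.induced" by (rule right.induced_idempotent[OF ract_idempotent[OF f]])
qed

lemma lact_ndi_Comp:
  assumes "a \<in> carrier A" "b \<in> carrier B" "c \<in> carrier C"
  shows "lact (ndi_Comp g f) a (lact g b c) = lact g (lact f a b) c"
  using assms unfolding ndi_Comp_eq by (simp add: lact_extension_on gl left.induced_act)

text \<open>As \<open>C\<close> is generated by the products $b \cdot c$, at most one morphism satisfies the equation; the
composite does.\<close>

lemma ndi_Comp_eqI:
  assumes e: "e \<in> ndi_Hom K A C"
    and eq: "\<And>a b c. \<lbrakk>a \<in> carrier A; b \<in> carrier B; c \<in> carrier C\<rbrakk>
      \<Longrightarrow> lact e a (lact g b c) = lact g (lact f a b) c"
  shows "ndi_Comp g f = e"
proof (rule ndi_Hom_eqI[OF C ndi_Comp_in_Hom e])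
  fix a c assume a: "a \<in> carrier A" and c: "c \<in> carrier C"
  show "lact (ndi_Comp g f) a c = lact e a c"
    by (rule left.linear_eqI[OF bilinear_map_right[OF lact_bilinear[OF ndi_Comp_in_Hom] a]
          bilinear_map_right[OF lact_bilinear[OF e] a] _ c])
      (simp add: lact_ndi_Comp eq a)
qed

end

lemma ndi_Id_eq: "ndi_Id A = extension_on A A (monoid.mult A) (monoid.mult A)"
  by (simp add: ndi_Id_def extension_on_def)

lemma ndi_Id_in_Hom:
  assumes A: "A \<in> ndi_Ob K" shows "ndi_Id A \<in> ndi_Hom K A A"
  unfolding ndi_Id_eq
  by (rule extension_on_in_Hom[OF ndi_Ob_module[OF A] ndi_Ob_projective[OF A] ndi_Ob_mult[OF A] ndi_Ob_mult[OF A]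
        ndi_Ob_mult[OF A] ndi_Ob_mult[OF A]])
    (simp_all add: ndi_Ob_assoc[OF A] ndi_Ob_left_nondegenerate[OF A] ndi_Ob_right_nondegenerate[OF A]
      ndi_Ob_left_idempotent[OF A] ndi_Ob_right_idempotent[OF A])

lemma lact_ndi_Id: "\<lbrakk>a \<in> carrier A; b \<in> carrier A\<rbrakk> \<Longrightarrow> lact (ndi_Id A) a b = a \<otimes>\<^bsub>A\<^esub> b"
  by (simp add: ndi_Id_def)

lemma ndi_category:
  fixes K :: "('k, 'm) ring_scheme"
  shows "category (ndi_Ob K :: ('k, 'u) module set) (ndi_Hom K) ndi_Comp ndi_Id"
proof
  fix A B :: "('k, 'u) module" assume A: "A \<in> ndi_Ob K" and B: "B \<in> ndi_Ob K"
  show "ndi_Id A \<in> ndi_Hom K A A" by (rule ndi_Id_in_Hom[OF A])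
  fix f assume f: "f \<in> ndi_Hom K A B"
  interpret l: composable K A B B f "ndi_Id B" using A B f ndi_Id_in_Hom by (simp add: composable_def)
  interpret r: composable K A A B "ndi_Id A" f using A B f ndi_Id_in_Hom by (simp add: composable_def)
  show "ndi_Comp (ndi_Id B) f = f"
    by (rule l.ndi_Comp_eqI[OF f]) (simp add: lact_ndi_Id lact_mult[OF f] l.fl)
  show "ndi_Comp f (ndi_Id A) = f"
    by (rule r.ndi_Comp_eqI[OF f]) (simp add: lact_ndi_Id lact_mult_src[OF f])
next
  fix A B C :: "('k, 'u) module" and f g assume "A \<in> ndi_Ob K" "B \<in> ndi_Ob K" "C \<in> ndi_Ob K" "f \<in> ndi_Hom K A B" "g \<in> ndi_Hom K B C"
  then show "ndi_Comp g f \<in> ndi_Hom K A C" by (intro composable.ndi_Comp_in_Hom composable.intro)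
next
  fix A B C D :: "('k, 'u) module" and f g h
  assume o: "A \<in> ndi_Ob K" "B \<in> ndi_Ob K" "C \<in> ndi_Ob K" "D \<in> ndi_Ob K"
    and f: "f \<in> ndi_Hom K A B" and g: "g \<in> ndi_Hom K B C" and h: "h \<in> ndi_Hom K C D"
  interpret gf: composable K A B C f g using o f g by (simp add: composable_def)
  interpret hg: composable K B C D g h using o g h by (simp add: composable_def)
  interpret h_gf: composable K A C D "ndi_Comp g f" h using o h gf.ndi_Comp_in_Hom by (simp add: composable_def)
  interpret hg_f: composable K A B D f "ndi_Comp h g" using o f hg.ndi_Comp_in_Hom by (simp add: composable_def)
  show "ndi_Comp (ndi_Comp h g) f = ndi_Comp h (ndi_Comp g f)"
  proof (rule hg_f.ndi_Comp_eqI[OF h_gf.ndi_Comp_in_Hom])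
    fix a b d assume a: "a \<in> carrier A" and b: "b \<in> carrier B" and d: "d \<in> carrier D"
    let ?e = "ndi_Comp h (ndi_Comp g f)"
    show "lact ?e a (lact (ndi_Comp h g) b d) = lact (ndi_Comp h g) (lact f a b) d"
    proof (rule hg.left.linear_eqI[OF _ _ _ d])
      show "linear_map K D D (\<lambda>d. lact ?e a (lact (ndi_Comp h g) b d))"
        by (rule linear_map_compose[OF bilinear_map_right[OF lact_bilinear[OF hg.ndi_Comp_in_Hom] b]
              bilinear_map_right[OF lact_bilinear[OF h_gf.ndi_Comp_in_Hom] a]])
      show "linear_map K D D (\<lambda>d. lact (ndi_Comp h g) (lact f a b) d)"
        by (rule bilinear_map_right[OF lact_bilinear[OF hg.ndi_Comp_in_Hom] gf.fl[OF a b]])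
      show "lact ?e a (lact (ndi_Comp h g) b (lact h c d)) = lact (ndi_Comp h g) (lact f a b) (lact h c d)"
        if "c \<in> carrier C" "d \<in> carrier D" for c d
        using a b that by (simp add: hg.lact_ndi_Comp h_gf.lact_ndi_Comp gf.lact_ndi_Comp gf.fl gf.gl)
    qed
  qed
qed (auto simp: ndi_Hom_def)

section \<open>Morphisms induced by isomorphisms of algebras\<close>

definition algebra_iso ::
    "('k, 'm) ring_scheme \<Rightarrow> ('k, 'a, 'p) module_scheme \<Rightarrow> ('k, 'b, 'q) module_scheme \<Rightarrow> ('a \<Rightarrow> 'b) \<Rightarrow> bool"
  where "algebra_iso K B A \<phi> \<longleftrightarrow> linear_map K B A \<phi> \<and> bij_betw \<phi> (carrier B) (carrier A) \<and>
    (\<forall>x\<in>carrier B. \<forall>y\<in>carrier B. \<phi> (x \<otimes>\<^bsub>B\<^esub> y) = \<phi> x \<otimes>\<^bsub>A\<^esub> \<phi> y)"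

lemma
  assumes "algebra_iso K B A \<phi>"
  shows algebra_iso_linear: "linear_map K B A \<phi>"
    and algebra_iso_bij: "bij_betw \<phi> (carrier B) (carrier A)"
    and algebra_iso_mult: "\<lbrakk>x \<in> carrier B; y \<in> carrier B\<rbrakk> \<Longrightarrow> \<phi> (x \<otimes>\<^bsub>B\<^esub> y) = \<phi> x \<otimes>\<^bsub>A\<^esub> \<phi> y"
  using assms by (simp_all add: algebra_iso_def)

lemma algebra_isoI:
  assumes "linear_map K B A \<phi>" "linear_map K A B \<psi>"
    and "\<And>x. x \<in> carrier B \<Longrightarrow> \<psi> (\<phi> x) = x" "\<And>y. y \<in> carrier A \<Longrightarrow> \<phi> (\<psi> y) = y"
    and "\<And>x y. \<lbrakk>x \<in> carrier B; y \<in> carrier B\<rbrakk> \<Longrightarrow> \<phi> (x \<otimes>\<^bsub>B\<^esub> y) = \<phi> x \<otimes>\<^bsub>A\<^esub> \<phi> y"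
  shows "algebra_iso K B A \<phi>"
proof -
  have "bij_betw \<phi> (carrier B) (carrier A)"
    by (rule bij_betwI[where g = \<psi>])
      (use assms(3,4) linear_map_closed[OF assms(1)] linear_map_closed[OF assms(2)] in auto)
  then show ?thesis unfolding algebra_iso_def using assms(1,5) by blast
qed

lemma algebra_iso_id: "algebra_iso K A A (\<lambda>x. x)"
  by (rule algebra_isoI[OF linear_map_id linear_map_id]) simp_all

lemma algebra_iso_compose:
  assumes "algebra_iso K A B \<phi>" "algebra_iso K B C \<psi>"
  shows "algebra_iso K A C (\<lambda>x. \<psi> (\<phi> x))"
  using assms bij_betw_trans[of \<phi> "carrier A" "carrier B" \<psi> "carrier C"]
  by (auto simp: algebra_iso_def comp_def linear_map_closed intro: linear_map_compose)

lemma algebra_iso_inverse: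
  assumes \<phi>: "algebra_iso K B A \<phi>" and B: "module K B" "bilinear_map K B B B (monoid.mult B)"
    and A: "module K A" "bilinear_map K A A A (monoid.mult A)"
  obtains \<psi> where "algebra_iso K A B \<psi>" "\<And>x. x \<in> carrier B \<Longrightarrow> \<psi> (\<phi> x) = x" "\<And>y. y \<in> carrier A \<Longrightarrow> \<phi> (\<psi> y) = y"
proof -
  interpret A: module K A by fact
  interpret B: module K B by fact
  define \<psi> where "\<psi> = inv_into (carrier B) \<phi>"
  note \<phi>' = algebra_iso_linear[OF \<phi>] algebra_iso_bij[OF \<phi>] algebra_iso_mult[OF \<phi>]
  have inj: "inj_on \<phi> (carrier B)" using \<phi>'(2) by (simp add: bij_betw_def)
  have 1: "\<psi> (\<phi> x) = x" if "x \<in> carrier B" for x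
    using inv_into_f_f[OF inj that] by (simp add: \<psi>_def)
  have 2: "\<phi> (\<psi> y) = y" "\<psi> y \<in> carrier B" if "y \<in> carrier A" for y
  proof -
    have y: "y \<in> \<phi> ` carrier B" using that \<phi>'(2) by (simp add: bij_betw_def)
    show "\<phi> (\<psi> y) = y" "\<psi> y \<in> carrier B"
      unfolding \<psi>_def using f_inv_into_f[OF y] inv_into_into[OF y] by simp_all
  qed
  have eqI: "x = y" if "x \<in> carrier B" "y \<in> carrier B" "\<phi> x = \<phi> y" for x y
    using inj_onD[OF inj that(3,1,2)] .
  have lin: "linear_map K A B \<psi>"
    by (rule linear_mapI; (rule eqI)?)
      (simp_all add: 2 linear_map_add[OF \<phi>'(1)] linear_map_smult[OF \<phi>'(1)])
  have "\<psi> (x \<otimes>\<^bsub>A\<^esub> y) = \<psi> x \<otimes>\<^bsub>B\<^esub> \<psi> y" if "x \<in> carrier A" "y \<in> carrier A" for x y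
    by (rule eqI) (use that in \<open>simp_all add: 2 \<phi>'(3) bilinear_map_closed[OF A(2)] bilinear_map_closed[OF B(2)]\<close>)
  then have "algebra_iso K A B \<psi>"
    using algebra_isoI[OF lin \<phi>'(1) 2(1) 1] by blast
  then show thesis using that 1 2(1) by blast
qed

lemma extension_of_map_eq:
  "extension_of_map B A \<phi> = extension_on B A (\<lambda>b a. \<phi> b \<otimes>\<^bsub>A\<^esub> a) (\<lambda>a b. a \<otimes>\<^bsub>A\<^esub> \<phi> b)"
  by (simp add: extension_of_map_def extension_on_def)

lemma extension_of_map_id: "extension_of_map A A (\<lambda>x. x) = ndi_Id A"
  by (simp add: extension_of_map_def ndi_Id_def)

lemma extension_of_map_cong:
  assumes "\<And>b. b \<in> carrier B \<Longrightarrow> \<phi> b = \<phi>' b"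
  shows "extension_of_map B A \<phi> = extension_of_map B A \<phi>'"
  using assms by (auto simp: extension_of_map_def fun_eq_iff)

lemma lact_extension_of_map:
  "\<lbrakk>b \<in> carrier B; a \<in> carrier A\<rbrakk> \<Longrightarrow> lact (extension_of_map B A \<phi>) b a = \<phi> b \<otimes>\<^bsub>A\<^esub> a"
  by (simp add: extension_of_map_def)

lemma extension_of_map_in_Hom:
  assumes B: "B \<in> ndi_Ob K" and A: "A \<in> ndi_Ob K" and \<phi>: "algebra_iso K B A \<phi>"
  shows "extension_of_map B A \<phi> \<in> ndi_Hom K B A"
proof -
  interpret A: module K A by (rule ndi_Ob_module[OF A])
  note \<phi>' = algebra_iso_linear[OF \<phi>] algebra_iso_bij[OF \<phi>] algebra_iso_mult[OF \<phi>]
  have surj: "\<phi> ` carrier B = carrier A" using \<phi>'(2) by (simp add: bij_betw_def)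
  note mA = ndi_Ob_mult[OF A]
  note c = bilinear_map_closed[OF mA] linear_map_closed[OF \<phi>'(1)]
  have l: "bilinear_map K B A A (\<lambda>b a. \<phi> b \<otimes>\<^bsub>A\<^esub> a)"
    using bilinear_map_compose[OF mA \<phi>'(1) linear_map_id linear_map_id] .
  have r: "bilinear_map K A B A (\<lambda>a b. a \<otimes>\<^bsub>A\<^esub> \<phi> b)"
    using bilinear_map_compose[OF mA linear_map_id \<phi>'(1) linear_map_id] .
  have nondeg: "left_nondegenerate A B (\<lambda>b a. h (\<phi> b) a)" if "left_nondegenerate A A h" for h
    using that unfolding left_nondegenerate_def surj[symmetric] by simp
  have idem: "left_idempotent A B (\<lambda>b a. h (\<phi> b) a)"
    if "left_idempotent A A h" and h: "bilinear_map K A A A h" for h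
  proof -
    have "{h (\<phi> b) a | b a. b \<in> carrier B \<and> a \<in> carrier A} = {h a' a | a' a. a' \<in> carrier A \<and> a \<in> carrier A}"
      unfolding surj[symmetric] by blast
    then show ?thesis
      using left_idempotent_iff[of A B "\<lambda>b a. h (\<phi> b) a", OF A.M.abelian_group_axioms]
        left_idempotent_iff[of A A h, OF A.M.abelian_group_axioms] that c bilinear_map_closed[OF h] by simp
  qed
  show ?thesis
    unfolding extension_of_map_eq
    by (rule extension_on_in_Hom[OF ndi_Ob_module[OF B] ndi_Ob_projective[OF A] mA ndi_Ob_mult[OF B] l r])
      (simp_all add: \<phi>'(3) c ndi_Ob_assoc[OF A] nondeg[OF ndi_Ob_left_nondegenerate[OF A]]
        nondeg[OF ndi_Ob_right_nondegenerate[OF A]] idem[OF ndi_Ob_left_idempotent[OF A] mA]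
        idem[OF ndi_Ob_right_idempotent[OF A] bilinear_map_flip[OF mA]])
qed

text \<open>On a product $a' \cdot b$ both sides are $(\alpha(a) a') \cdot b$, and such products generate \<open>B\<close>.\<close>

lemma lact_Comp_extension_of_map:
  assumes o: "A \<in> ndi_Ob K" "A' \<in> ndi_Ob K" "B \<in> ndi_Ob K"
    and \<alpha>: "algebra_iso K A A' \<alpha>" and f: "f \<in> ndi_Hom K A' B" and ab: "a \<in> carrier A" "b \<in> carrier B"
  shows "lact (ndi_Comp f (extension_of_map A A' \<alpha>)) a b = lact f (\<alpha> a) b"
proof -
  note e = extension_of_map_in_Hom[OF o(1,2) \<alpha>]
  interpret c: composable K A A' B "extension_of_map A A' \<alpha>" f using o e f by (simp add: composable_def)
  have \<alpha>a: "\<alpha> a \<in> carrier A'" by (rule linear_map_closed[OF algebra_iso_linear[OF \<alpha>] ab(1)])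
  show ?thesis
    by (rule c.left.linear_eqI[OF bilinear_map_right[OF lact_bilinear[OF c.ndi_Comp_in_Hom] ab(1)]
          bilinear_map_right[OF lact_bilinear[OF f] \<alpha>a] _ ab(2)])
      (simp add: c.lact_ndi_Comp ab \<alpha>a lact_extension_of_map lact_mult_src[OF f])
qed

text \<open>Both composites are determined by how \<open>a\<close> acts on products $\beta(b) b'$, where the left-hand side is
$\beta(a \cdot b) b'$ and the right-hand side is $\alpha(a) \cdot (\beta(b) b') = (\alpha(a) \cdot \beta(b)) b'$.\<close>

lemma ndi_Comp_extension_of_map_square:
  assumes o: "A \<in> ndi_Ob K" "A' \<in> ndi_Ob K" "B \<in> ndi_Ob K" "B' \<in> ndi_Ob K"
    and \<alpha>: "algebra_iso K A A' \<alpha>" and \<beta>: "algebra_iso K B B' \<beta>"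
    and f: "f \<in> ndi_Hom K A B" and f': "f' \<in> ndi_Hom K A' B'"
    and eq: "\<And>a b. \<lbrakk>a \<in> carrier A; b \<in> carrier B\<rbrakk> \<Longrightarrow> \<beta> (lact f a b) = lact f' (\<alpha> a) (\<beta> b)"
  shows "ndi_Comp (extension_of_map B B' \<beta>) f = ndi_Comp f' (extension_of_map A A' \<alpha>)"
proof -
  note e\<alpha> = extension_of_map_in_Hom[OF o(1,2) \<alpha>]
  note e\<beta> = extension_of_map_in_Hom[OF o(3,4) \<beta>]
  interpret c: composable K A B B' f "extension_of_map B B' \<beta>" using o e\<beta> f by (simp add: composable_def)
  interpret c': composable K A A' B' "extension_of_map A A' \<alpha>" f' using o e\<alpha> f' by (simp add: composable_def)
  note closed = linear_map_closed[OF algebra_iso_linear[OF \<alpha>]] linear_map_closed[OF algebra_iso_linear[OF \<beta>]]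
    bilinear_map_closed[OF ndi_Ob_mult[OF o(4)]]
  show ?thesis
    by (rule c.ndi_Comp_eqI[OF c'.ndi_Comp_in_Hom])
      (simp add: lact_extension_of_map lact_Comp_extension_of_map[OF o(1,2,4) \<alpha> f'] closed c.fl eq lact_mult[OF f'])
qed

lemma ndi_Comp_extension_of_map:
  assumes o: "A \<in> ndi_Ob K" "B \<in> ndi_Ob K" "C \<in> ndi_Ob K"
    and \<phi>: "algebra_iso K A B \<phi>" and \<psi>: "algebra_iso K B C \<psi>"
  shows "ndi_Comp (extension_of_map B C \<psi>) (extension_of_map A B \<phi>) = extension_of_map A C (\<lambda>x. \<psi> (\<phi> x))"
proof (rule ndi_Hom_eqI[OF o(3)])
  note e\<phi> = extension_of_map_in_Hom[OF o(1,2) \<phi>]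
  note e\<psi> = extension_of_map_in_Hom[OF o(2,3) \<psi>]
  show "ndi_Comp (extension_of_map B C \<psi>) (extension_of_map A B \<phi>) \<in> ndi_Hom K A C"
    using o e\<phi> e\<psi> by (intro composable.ndi_Comp_in_Hom composable.intro)
  show "extension_of_map A C (\<lambda>x. \<psi> (\<phi> x)) \<in> ndi_Hom K A C"
    by (rule extension_of_map_in_Hom[OF o(1,3) algebra_iso_compose[OF \<phi> \<psi>]])
  show "lact (ndi_Comp (extension_of_map B C \<psi>) (extension_of_map A B \<phi>)) a c
      = lact (extension_of_map A C (\<lambda>x. \<psi> (\<phi> x))) a c" if "a \<in> carrier A" "c \<in> carrier C" for a c
    using that linear_map_closed[OF algebra_iso_linear[OF \<phi>]]
    by (simp add: lact_Comp_extension_of_map[OF o \<phi> e\<psi>] lact_extension_of_map)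
qed

lemma iso_in_extension_of_map:
  fixes A B :: "('k, 'u) module"
  assumes A: "A \<in> ndi_Ob K" and B: "B \<in> ndi_Ob K" and \<phi>: "algebra_iso K A B \<phi>"
  shows "category.iso_in (ndi_Hom K) ndi_Comp ndi_Id A B (extension_of_map A B \<phi>)"
proof -
  obtain \<psi> where \<psi>: "algebra_iso K B A \<psi>" and inv: "\<And>x. x \<in> carrier A \<Longrightarrow> \<psi> (\<phi> x) = x"
      "\<And>y. y \<in> carrier B \<Longrightarrow> \<phi> (\<psi> y) = y"
    by (rule algebra_iso_inverse[OF \<phi> ndi_Ob_module[OF A] ndi_Ob_mult[OF A] ndi_Ob_module[OF B] ndi_Ob_mult[OF B]])
      blast
  have "ndi_Comp (extension_of_map B A \<psi>) (extension_of_map A B \<phi>) = ndi_Id A"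
    unfolding ndi_Comp_extension_of_map[OF A B A \<phi> \<psi>] extension_of_map_id[symmetric]
    by (rule extension_of_map_cong) (rule inv)
  moreover have "ndi_Comp (extension_of_map A B \<phi>) (extension_of_map B A \<psi>) = ndi_Id B"
    unfolding ndi_Comp_extension_of_map[OF B A B \<psi> \<phi>] extension_of_map_id[symmetric]
    by (rule extension_of_map_cong) (rule inv)
  ultimately show ?thesis
    unfolding category.iso_in_def[OF ndi_category]
    using extension_of_map_in_Hom[OF A B \<phi>] extension_of_map_in_Hom[OF B A \<psi>] by blast
qed

section \<open>Tensor products of algebras and morphisms\<close>

context ndi_universe
begin

text \<open>Turns a tensor product of right actions into one of left actions; the order of the two nested lifts
is immaterial.\<close>

lemma tensor_action_flip:
  assumes m: "module K P" "module K Q" "module K M" "module K N" "module K M'" "module K N'"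
    and h: "bilinear_map K P M M' h" and h': "bilinear_map K Q N N' h'"
    and xy: "x \<in> carrier (P \<boxtimes> Q)" "y \<in> carrier (M \<boxtimes> N)"
  shows "tensor_action M N P Q M' N' (\<lambda>m p. h p m) (\<lambda>n q. h' q n) y x = tensor_action P Q M N M' N' h h' x y"
proof -
  note fl = bilinear_map_flip[OF h] bilinear_map_flip[OF h']
  show ?thesis
    by (rule ndi_bilinear_eqI[OF m(1-4) bilinear_map_flip[OF tensor_action_bilinear[OF m(3,4,1,2,5,6) fl]]
          tensor_action_bilinear[OF m h h'] _ xy])
      (simp add: tensor_action_pure[OF m(3,4,1,2,5,6) fl] tensor_action_pure[OF m h h'])
qed

lemma
  assumes p: "projective_module K M" "projective_module K N" and m': "module K P" "module K Q"
    and h: "bilinear_map K M P M h" and h': "bilinear_map K N Q N h'"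
  shows right_nondegenerate_tensor: "\<lbrakk>left_nondegenerate M P (\<lambda>p x. h x p); left_nondegenerate N Q (\<lambda>q y. h' y q)\<rbrakk>
      \<Longrightarrow> left_nondegenerate (M \<boxtimes> N) (P \<boxtimes> Q) (\<lambda>z x. tensor_action M N P Q M N h h' x z)"
    and right_idempotent_tensor: "\<lbrakk>left_idempotent M P (\<lambda>p x. h x p); left_idempotent N Q (\<lambda>q y. h' y q)\<rbrakk>
      \<Longrightarrow> left_idempotent (M \<boxtimes> N) (P \<boxtimes> Q) (\<lambda>z x. tensor_action M N P Q M N h h' x z)"
proof -
  have m: "module K M" "module K N" using p by (simp_all add: projective_module_def)
  interpret MN: module K "M \<boxtimes> N" by (rule ndi_tensor_module[OF m])
  note fl = bilinear_map_flip[OF h] bilinear_map_flip[OF h']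
  have eq: "tensor_action M N P Q M N h h' x z = tensor_action P Q M N M N (\<lambda>p x. h x p) (\<lambda>q y. h' y q) z x"
    if "z \<in> carrier (P \<boxtimes> Q)" "x \<in> carrier (M \<boxtimes> N)" for z x
    using tensor_action_flip[OF m m' m h h' that(2,1)] by simp
  note closed = bilinear_map_closed[OF tensor_action_bilinear[OF m' m m fl]]
  show "left_nondegenerate (M \<boxtimes> N) (P \<boxtimes> Q) (\<lambda>z x. tensor_action M N P Q M N h h' x z)"
    if "left_nondegenerate M P (\<lambda>p x. h x p)" "left_nondegenerate N Q (\<lambda>q y. h' y q)"
    by (rule iffD2[OF left_nondegenerate_cong left_nondegenerate_tensor[OF p m' fl that]]) (rule eq)
  show "left_idempotent (M \<boxtimes> N) (P \<boxtimes> Q) (\<lambda>z x. tensor_action M N P Q M N h h' x z)"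
    if "left_idempotent M P (\<lambda>p x. h x p)" "left_idempotent N Q (\<lambda>q y. h' y q)"
    by (rule iffD2[OF left_idempotent_cong[OF MN.M.abelian_group_axioms closed eq]
          left_idempotent_tensor[OF m m' fl that]])
qed

lemma
  assumes A: "A \<in> ndi_Ob K" and B: "B \<in> ndi_Ob K"
  shows tensor_mult_Ob: "\<lbrakk>x \<in> carrier (A \<boxtimes> B); y \<in> carrier (A \<boxtimes> B)\<rbrakk>
      \<Longrightarrow> x \<otimes>\<^bsub>A \<boxtimes> B\<^esub> y = tensor_action A B A B A B (monoid.mult A) (monoid.mult B) x y"
    and tensor_mult_bilinear: "bilinear_map K (A \<boxtimes> B) (A \<boxtimes> B) (A \<boxtimes> B) (monoid.mult (A \<boxtimes> B))"
    and tensor_mult_pure: "\<lbrakk>a \<in> carrier A; b \<in> carrier B; a' \<in> carrier A; b' \<in> carrier B\<rbrakk>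
      \<Longrightarrow> pure A B a b \<otimes>\<^bsub>A \<boxtimes> B\<^esub> pure A B a' b' = pure A B (a \<otimes>\<^bsub>A\<^esub> a') (b \<otimes>\<^bsub>B\<^esub> b')"
proof -
  note m = ndi_Ob_module[OF A] ndi_Ob_module[OF B]
  note h = ndi_Ob_mult[OF A] ndi_Ob_mult[OF B]
  show eq: "x \<otimes>\<^bsub>A \<boxtimes> B\<^esub> y = tensor_action A B A B A B (monoid.mult A) (monoid.mult B) x y"
    if "x \<in> carrier (A \<boxtimes> B)" "y \<in> carrier (A \<boxtimes> B)" for x y
    using tensor_mult[OF m h that] .
  show "bilinear_map K (A \<boxtimes> B) (A \<boxtimes> B) (A \<boxtimes> B) (monoid.mult (A \<boxtimes> B))"
    by (rule bilinear_map_cong[OF tensor_action_bilinear[OF m m m h] ndi_tensor_module[OF m] ndi_tensor_module[OF m] eq])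
  show "pure A B a b \<otimes>\<^bsub>A \<boxtimes> B\<^esub> pure A B a' b' = pure A B (a \<otimes>\<^bsub>A\<^esub> a') (b \<otimes>\<^bsub>B\<^esub> b')"
    if "a \<in> carrier A" "b \<in> carrier B" "a' \<in> carrier A" "b' \<in> carrier B"
    using that by (simp add: eq pure_closed[OF m] tensor_action_pure[OF m m m h])
qed

lemma tensor_in_Ob:
  assumes A: "A \<in> ndi_Ob K" and B: "B \<in> ndi_Ob K"
  shows "A \<boxtimes> B \<in> ndi_Ob K"
proof -
  note m = ndi_Ob_module[OF A] ndi_Ob_module[OF B]
  note p = ndi_Ob_projective[OF A] ndi_Ob_projective[OF B]
  note h = ndi_Ob_mult[OF A] ndi_Ob_mult[OF B]
  note act = tensor_action_bilinear[OF m m m h]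
  note closed = bilinear_map_closed[OF act]
  note eq = tensor_mult_Ob[OF A B]
  interpret AB: module K "A \<boxtimes> B" by (rule ndi_tensor_module[OF m])
  show ?thesis
  proof (rule ndi_ObI[OF projective_tensor[OF p] tensor_mult_bilinear[OF A B]])
    show "x \<otimes>\<^bsub>A \<boxtimes> B\<^esub> y \<otimes>\<^bsub>A \<boxtimes> B\<^esub> z = x \<otimes>\<^bsub>A \<boxtimes> B\<^esub> (y \<otimes>\<^bsub>A \<boxtimes> B\<^esub> z)"
      if "x \<in> carrier (A \<boxtimes> B)" "y \<in> carrier (A \<boxtimes> B)" "z \<in> carrier (A \<boxtimes> B)" for x y z
      using tensor_action_assoc[OF m m m m m m h h h h ndi_Ob_assoc[OF A] ndi_Ob_assoc[OF B] that]
      by (simp add: eq that closed)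
    show "left_nondegenerate (A \<boxtimes> B) (A \<boxtimes> B) (monoid.mult (A \<boxtimes> B))"
      by (rule iffD2[OF left_nondegenerate_cong[OF eq] left_nondegenerate_tensor[OF p m h]])
        (rule ndi_Ob_left_nondegenerate[OF A] ndi_Ob_left_nondegenerate[OF B] | assumption)+
    show "left_nondegenerate (A \<boxtimes> B) (A \<boxtimes> B) (\<lambda>x y. y \<otimes>\<^bsub>A \<boxtimes> B\<^esub> x)"
      by (rule iffD2[OF left_nondegenerate_cong[OF eq] right_nondegenerate_tensor[OF p m h]])
        (rule ndi_Ob_right_nondegenerate[OF A] ndi_Ob_right_nondegenerate[OF B] | assumption)+
    show "left_idempotent (A \<boxtimes> B) (A \<boxtimes> B) (monoid.mult (A \<boxtimes> B))"
      by (rule iffD2[OF left_idempotent_cong[OF AB.M.abelian_group_axioms closed eq] left_idempotent_tensor[OF m m h]])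
        (rule ndi_Ob_left_idempotent[OF A] ndi_Ob_left_idempotent[OF B] | assumption)+
  qed
qed

lemma
  assumes o: "A \<in> ndi_Ob K" "B \<in> ndi_Ob K" "A' \<in> ndi_Ob K" "B' \<in> ndi_Ob K"
    and f: "f \<in> ndi_Hom K B A" and f': "f' \<in> ndi_Hom K B' A'"
  shows tensor_Hom_in_Hom: "ndi_tensor_Hom K f f' \<in> ndi_Hom K (B \<boxtimes> B') (A \<boxtimes> A')"
    and lact_tensor_Hom: "\<lbrakk>x \<in> carrier (B \<boxtimes> B'); y \<in> carrier (A \<boxtimes> A')\<rbrakk>
      \<Longrightarrow> lact (ndi_tensor_Hom K f f') x y = tensor_action B B' A A' A A' (lact f) (lact f') x y"
    and lact_tensor_Hom_pure: "\<lbrakk>b \<in> carrier B; b' \<in> carrier B'; a \<in> carrier A; a' \<in> carrier A'\<rbrakk>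
      \<Longrightarrow> lact (ndi_tensor_Hom K f f') (pure B B' b b') (pure A A' a a') = pure A A' (lact f b a) (lact f' b' a')"
proof -
  note m = o[THEN ndi_Ob_module]
  note p = ndi_Ob_projective[OF o(1)] ndi_Ob_projective[OF o(3)]
  note h = o[THEN ndi_Ob_mult]
  note l = lact_bilinear[OF f] lact_bilinear[OF f']
  note r = ract_bilinear[OF f] ract_bilinear[OF f']
  let ?l = "tensor_action B B' A A' A A' (lact f) (lact f')"
  let ?r = "tensor_action A A' B B' A A' (ract f) (ract f')"
  have eq: "ndi_tensor_Hom K f f' = extension_on (B \<boxtimes> B') (A \<boxtimes> A') ?l ?r"
    unfolding ndi_tensor_Hom_def extension_on_def tensor_action_def
    by (simp add: Let_def ndi_Hom_src[OF f] ndi_Hom_src[OF f'] ndi_Hom_tgt[OF f] ndi_Hom_tgt[OF f'])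
  note L = tensor_action_bilinear[OF m(2,4,1,3,1,3) l]
  note R = tensor_action_bilinear[OF m(1,3,2,4,1,3) r]
  note mA = tensor_mult_Ob[OF o(1,3)] and mB = tensor_mult_Ob[OF o(2,4)]
  note cA = bilinear_map_closed[OF tensor_action_bilinear[OF m(1,3) m(1,3) m(1,3) h(1,3)]]
  note cB = bilinear_map_closed[OF tensor_action_bilinear[OF m(2,4) m(2,4) m(2,4) h(2,4)]]
  note cL = bilinear_map_closed[OF L] and cR = bilinear_map_closed[OF R]
  note bm = tensor_mult_bilinear[OF o(1,3)] tensor_mult_bilinear[OF o(2,4)]
  show "ndi_tensor_Hom K f f' \<in> ndi_Hom K (B \<boxtimes> B') (A \<boxtimes> A')"
    unfolding eq
  proof (rule extension_on_in_Hom[OF ndi_tensor_module[OF m(2,4)] projective_tensor[OF p] bm L R])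
    fix b b' a assume *: "b \<in> carrier (B \<boxtimes> B')" "b' \<in> carrier (B \<boxtimes> B')" "a \<in> carrier (A \<boxtimes> A')"
    show "?l (b \<otimes>\<^bsub>B \<boxtimes> B'\<^esub> b') a = ?l b (?l b' a)"
      unfolding mB[OF *(1,2)]
      by (rule tensor_action_assoc)
        (rule m h l lact_mult_src[OF f] lact_mult_src[OF f'] * | assumption)+
    show "?r a (b \<otimes>\<^bsub>B \<boxtimes> B'\<^esub> b') = ?r (?r a b) b'"
      unfolding mB[OF *(1,2)]
      by (rule tensor_action_assoc[symmetric])
        (rule m h r ract_mult_src[OF f, symmetric]
            ract_mult_src[OF f', symmetric] *(3,1,2) | assumption)+
    show "?r (?l b a) b' = ?l b (?r a b')"
      by (rule tensor_action_assoc)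
        (rule m l r ract_lact[OF f] ract_lact[OF f'] *(1,3,2) | assumption)+
  next
    fix b a a' assume *: "b \<in> carrier (B \<boxtimes> B')" "a \<in> carrier (A \<boxtimes> A')" "a' \<in> carrier (A \<boxtimes> A')"
    show "?l b (a \<otimes>\<^bsub>A \<boxtimes> A'\<^esub> a') = ?l b a \<otimes>\<^bsub>A \<boxtimes> A'\<^esub> a'"
      unfolding mA[OF *(2,3)] mA[OF cL[OF *(1,2)] *(3)]
      by (rule tensor_action_assoc[symmetric])
        (rule m h l lact_mult[OF f, symmetric]
            lact_mult[OF f', symmetric] * | assumption)+
    show "?r (a \<otimes>\<^bsub>A \<boxtimes> A'\<^esub> a') b = a \<otimes>\<^bsub>A \<boxtimes> A'\<^esub> ?r a' b"
      unfolding mA[OF *(2,3)] mA[OF *(2) cR[OF *(3,1)]]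
      by (rule tensor_action_assoc)
        (rule m h r ract_mult[OF f] ract_mult[OF f'] *(2,3,1) | assumption)+
    show "?r a b \<otimes>\<^bsub>A \<boxtimes> A'\<^esub> a' = a \<otimes>\<^bsub>A \<boxtimes> A'\<^esub> ?l b a'"
      unfolding mA[OF cR[OF *(2,1)] *(3)] mA[OF *(2) cL[OF *(1,3)]]
      by (rule tensor_action_assoc)
        (rule m h l r ract_mult_lact[OF f] ract_mult_lact[OF f'] *(2,1,3) | assumption)+
  next
    show "left_nondegenerate (A \<boxtimes> A') (B \<boxtimes> B') ?l"
      by (rule left_nondegenerate_tensor[OF p m(2,4) l lact_nondegenerate[OF f] lact_nondegenerate[OF f']])
    show "left_nondegenerate (A \<boxtimes> A') (B \<boxtimes> B') (\<lambda>b a. ?r a b)"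
      by (rule right_nondegenerate_tensor[OF p m(2,4) r ract_nondegenerate[OF f] ract_nondegenerate[OF f']])
    show "left_idempotent (A \<boxtimes> A') (B \<boxtimes> B') ?l"
      by (rule left_idempotent_tensor[OF m(1,3) m(2,4) l lact_idempotent[OF f] lact_idempotent[OF f']])
    show "left_idempotent (A \<boxtimes> A') (B \<boxtimes> B') (\<lambda>b a. ?r a b)"
      by (rule right_idempotent_tensor[OF p m(2,4) r ract_idempotent[OF f] ract_idempotent[OF f']])
  qed
  show lact: "lact (ndi_tensor_Hom K f f') x y = ?l x y" if "x \<in> carrier (B \<boxtimes> B')" "y \<in> carrier (A \<boxtimes> A')" for x y
    unfolding eq by (rule lact_extension_on[OF that])
  show "lact (ndi_tensor_Hom K f f') (pure B B' b b') (pure A A' a a') = pure A A' (lact f b a) (lact f' b' a')"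
    if "b \<in> carrier B" "b' \<in> carrier B'" "a \<in> carrier A" "a' \<in> carrier A'"
    using that by (simp add: lact pure_closed[OF m(2,4)] pure_closed[OF m(1,3)] tensor_action_pure[OF m(2,4,1,3,1,3) l])
qed

text \<open>The tensor product of the two composites satisfies the equation that characterizes the composite of
the tensor products, because each composite satisfies its own.\<close>

lemma interchange:
  fixes A B C A' B' C' :: "('k, 'u) module"
  assumes o: "A \<in> ndi_Ob K" "B \<in> ndi_Ob K" "C \<in> ndi_Ob K" "A' \<in> ndi_Ob K" "B' \<in> ndi_Ob K" "C' \<in> ndi_Ob K"
    and f: "f \<in> ndi_Hom K A B" and g: "g \<in> ndi_Hom K B C"
    and f': "f' \<in> ndi_Hom K A' B'" and g': "g' \<in> ndi_Hom K B' C'"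
  shows "ndi_tensor_Hom K (ndi_Comp g f) (ndi_Comp g' f') = ndi_Comp (ndi_tensor_Hom K g g') (ndi_tensor_Hom K f f')"
proof -
  note m = o[THEN ndi_Ob_module]
  interpret c: composable K A B C f g using o f g by (simp add: composable_def)
  interpret c': composable K A' B' C' f' g' using o f' g' by (simp add: composable_def)
  note e = c.ndi_Comp_in_Hom c'.ndi_Comp_in_Hom
  note tf = tensor_Hom_in_Hom[OF o(2,1,5,4) f f'] and tg = tensor_Hom_in_Hom[OF o(3,2,6,5) g g']
    and te = tensor_Hom_in_Hom[OF o(3,1,6,4) e]
  interpret t: composable K "A \<boxtimes> A'" "B \<boxtimes> B'" "C \<boxtimes> C'" "ndi_tensor_Hom K f f'" "ndi_tensor_Hom K g g'"
    using o tf tg by (simp add: composable_def tensor_in_Ob)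
  note lf = lact_tensor_Hom[OF o(2,1,5,4) f f'] and lg = lact_tensor_Hom[OF o(3,2,6,5) g g']
    and le = lact_tensor_Hom[OF o(3,1,6,4) e]
  have "ndi_Comp (ndi_tensor_Hom K g g') (ndi_tensor_Hom K f f') = ndi_tensor_Hom K (ndi_Comp g f) (ndi_Comp g' f')"
  proof (rule t.ndi_Comp_eqI[OF te])
    fix a b c assume *: "a \<in> carrier (A \<boxtimes> A')" "b \<in> carrier (B \<boxtimes> B')" "c \<in> carrier (C \<boxtimes> C')"
    show "lact (ndi_tensor_Hom K (ndi_Comp g f) (ndi_Comp g' f')) a (lact (ndi_tensor_Hom K g g') b c)
      = lact (ndi_tensor_Hom K g g') (lact (ndi_tensor_Hom K f f') a b) c"
      unfolding le[OF *(1) t.gl[OF *(2,3)]] lg[OF t.fl[OF *(1,2)] *(3)]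
      unfolding lg[OF *(2,3)] lf[OF *(1,2)]
      by (rule tensor_action_assoc[symmetric])
        (rule m lact_bilinear[OF f] lact_bilinear[OF g] lact_bilinear[OF f'] lact_bilinear[OF g']
          lact_bilinear[OF e(1)] lact_bilinear[OF e(2)] c.lact_ndi_Comp[symmetric] c'.lact_ndi_Comp[symmetric] * | assumption)+
  qed
  then show ?thesis by (rule sym)
qed

end

section \<open>The unit object\<close>

lemma module_base_algebra:
  assumes "cring K" shows "module K (base_algebra K)"
proof -
  interpret cring K by fact
  show ?thesis
  proof (rule moduleI)
    show "abelian_group (base_algebra K)"
    proof (rule abelian_groupI)
      fix x assume "x \<in> carrier (base_algebra K)"
      then show "\<exists>y\<in>carrier (base_algebra K). y \<oplus>\<^bsub>base_algebra K\<^esub> x = \<zero>\<^bsub>base_algebra K\<^esub>"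
        by (intro bexI[of _ "\<ominus>\<^bsub>K\<^esub> x"]) (simp_all add: base_algebra_def l_neg)
    qed (simp_all add: base_algebra_def a_ac)
  qed (simp_all add: base_algebra_def assms l_distr r_distr m_assoc)
qed

context ndi_universe
begin

abbreviation unit_obj :: "('k, 'u) module"  ("\<I>") where "\<I> \<equiv> ndi_unit K"

abbreviation scalar :: "'u \<Rightarrow> 'k" where "scalar \<equiv> of_univ (base_algebra K)"

definition unit_elem :: 'u where "unit_elem = to_univ (base_algebra K) \<one>\<^bsub>K\<^esub>"

lemma
  shows unit_module: "module K \<I>"
    and scalar_linear: "linear_map K \<I> (base_algebra K) scalar"
    and scalar_closed: "x \<in> carrier \<I> \<Longrightarrow> scalar x \<in> carrier K"
    and unit_mult_bilinear: "bilinear_map K \<I> \<I> \<I> (monoid.mult \<I>)"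
    and scalar_mult: "\<lbrakk>x \<in> carrier \<I>; y \<in> carrier \<I>\<rbrakk> \<Longrightarrow> scalar (x \<otimes>\<^bsub>\<I>\<^esub> y) = scalar x \<otimes>\<^bsub>K\<^esub> scalar y"
    and unit_elem_closed: "unit_elem \<in> carrier \<I>"
    and scalar_unit_elem: "scalar unit_elem = \<one>\<^bsub>K\<^esub>"
    and scalar_smult_unit_elem: "x \<in> carrier \<I> \<Longrightarrow> scalar x \<odot>\<^bsub>\<I>\<^esub> unit_elem = x"
    and scalar_eqI: "\<lbrakk>x \<in> carrier \<I>; y \<in> carrier \<I>; scalar x = scalar y\<rbrakk> \<Longrightarrow> x = y"
proof -
  interpret K: cring K by (rule cring_K)
  note mb = module_base_algebra[OF cring_K]
  let ?u = "to_univ (base_algebra K) :: 'k \<Rightarrow> 'u"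
  have inj: "inj_on ?u (carrier (base_algebra K))"
    by (rule inj_on_to_univ) (simp add: base_algebra_def scalars_lepoll)
  note ou = of_univ_to_univ[OF refl inj]
  have carr: "carrier \<I> = ?u ` carrier K"
    using carrier_univ_copy[OF refl inj] by (simp add: ndi_unit_def base_algebra_def)
  have smK: "r \<odot>\<^bsub>base_algebra K\<^esub> s = r \<otimes>\<^bsub>K\<^esub> s" for r s by (simp add: base_algebra_def)
  have cK: "carrier (base_algebra K) = carrier K" by (simp add: base_algebra_def)
  show "module K \<I>" unfolding ndi_unit_def by (rule module_univ_copy[OF refl inj mb])
  show lin: "linear_map K \<I> (base_algebra K) scalar"
    unfolding ndi_unit_def by (rule of_univ_linear[OF refl inj mb])
  show sc: "scalar x \<in> carrier K" if "x \<in> carrier \<I>" for x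
    using linear_map_closed[OF lin that] by (simp add: base_algebra_def)
  have mult: "x \<otimes>\<^bsub>\<I>\<^esub> y = ?u (scalar x \<otimes>\<^bsub>K\<^esub> scalar y)" for x y
    by (simp add: ndi_unit_def univ_copy_def base_algebra_def)
  have "bilinear_map K (base_algebra K) (base_algebra K) (base_algebra K) (\<lambda>r s. r \<otimes>\<^bsub>K\<^esub> s)"
    using bilinear_map_smult[OF mb] by (simp add: base_algebra_def)
  from bilinear_map_compose[OF this lin lin to_univ_linear[OF refl inj mb, folded ndi_unit_def]]
  show "bilinear_map K \<I> \<I> \<I> (monoid.mult \<I>)" unfolding mult[abs_def] .
  show "scalar (x \<otimes>\<^bsub>\<I>\<^esub> y) = scalar x \<otimes>\<^bsub>K\<^esub> scalar y" if "x \<in> carrier \<I>" "y \<in> carrier \<I>" for x y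
    unfolding mult by (rule ou) (simp add: cK sc that)
  show one: "unit_elem \<in> carrier \<I>" unfolding unit_elem_def carr by simp
  show sone: "scalar unit_elem = \<one>\<^bsub>K\<^esub>" unfolding unit_elem_def by (rule ou) (simp add: cK)
  show eqI: "x = y" if "x \<in> carrier \<I>" "y \<in> carrier \<I>" "scalar x = scalar y" for x y
    using that ou unfolding carr cK by auto
  interpret I: module K \<I> by fact
  show "scalar x \<odot>\<^bsub>\<I>\<^esub> unit_elem = x" if x: "x \<in> carrier \<I>" for x
  proof (rule eqI)
    show "scalar (scalar x \<odot>\<^bsub>\<I>\<^esub> unit_elem) = scalar x"
      using linear_map_smult[OF lin sc[OF x] one] sc[OF x] by (simp add: sone smK)
  qed (use x one sc in auto)
qed

lemma unit_in_Ob: "\<I> \<in> ndi_Ob K"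
proof -
  interpret K: cring K by (rule cring_K)
  interpret I: module K \<I> by (rule unit_module)
  note mc = bilinear_map_closed[OF unit_mult_bilinear]
  have one_r: "x \<otimes>\<^bsub>\<I>\<^esub> unit_elem = x" "unit_elem \<otimes>\<^bsub>\<I>\<^esub> x = x" if "x \<in> carrier \<I>" for x
    using that by (auto intro!: scalar_eqI simp: mc unit_elem_closed scalar_mult scalar_unit_elem scalar_closed)
  have "dual_basis K \<I> {unit_elem} (\<lambda>_. scalar) (\<lambda>_. unit_elem)"
    unfolding dual_basis_def
  proof (intro conjI ballI)
    fix x assume x: "x \<in> carrier \<I>"
    have "x = (\<Oplus>\<^bsub>\<I>\<^esub>j\<in>{unit_elem}. scalar x \<odot>\<^bsub>\<I>\<^esub> unit_elem)"
      using x by (simp add: scalar_smult_unit_elem)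
    then show "\<exists>S. finite S \<and> S \<subseteq> {unit_elem} \<and> (\<forall>j\<in>{unit_elem} - S. scalar x = \<zero>\<^bsub>K\<^esub>) \<and>
        x = (\<Oplus>\<^bsub>\<I>\<^esub>j\<in>S. scalar x \<odot>\<^bsub>\<I>\<^esub> unit_elem)"
      by (intro exI[of _ "{unit_elem}"]) simp
  qed (auto simp: scalar_linear unit_elem_closed)
  then have p: "projective_module K \<I>" by (rule dual_basis_imp_projective_module[OF unit_module])
  show ?thesis
  proof (rule ndi_ObI[OF p unit_mult_bilinear])
    show "a \<otimes>\<^bsub>\<I>\<^esub> b \<otimes>\<^bsub>\<I>\<^esub> c = a \<otimes>\<^bsub>\<I>\<^esub> (b \<otimes>\<^bsub>\<I>\<^esub> c)" if "a \<in> carrier \<I>" "b \<in> carrier \<I>" "c \<in> carrier \<I>" for a b c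
      using that by (intro scalar_eqI) (simp_all add: mc scalar_mult scalar_closed K.m_assoc)
    show "left_nondegenerate \<I> \<I> (monoid.mult \<I>)" "left_nondegenerate \<I> \<I> (\<lambda>a b. b \<otimes>\<^bsub>\<I>\<^esub> a)"
      unfolding left_nondegenerate_def using one_r unit_elem_closed by metis+
    have "x \<in> finite_sums \<I> {a \<otimes>\<^bsub>\<I>\<^esub> b | a b. a \<in> carrier \<I> \<and> b \<in> carrier \<I>}" if x: "x \<in> carrier \<I>" for x
    proof (rule finite_sums_incl[OF I.M.abelian_group_axioms])
      show "x \<in> {a \<otimes>\<^bsub>\<I>\<^esub> b | a b. a \<in> carrier \<I> \<and> b \<in> carrier \<I>}"
        using one_r(2)[OF x, symmetric] unit_elem_closed x by blast
    qed (use mc in blast)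
    then show "left_idempotent \<I> \<I> (monoid.mult \<I>)"
      using left_idempotent_iff[of \<I> \<I> "monoid.mult \<I>", OF I.M.abelian_group_axioms mc] by blast
  qed
qed

section \<open>Iterated tensor products\<close>

text \<open>Linear maps on iterated tensor products are determined by their values on tensors of elements of the
factors. Naturality of associativity, pentagon and triangle are reduced to such elements.\<close>

lemma ndi_linear_eqI3:
  assumes m: "module K A" "module K B" "module K C"
    and f: "linear_map K ((A \<boxtimes> B) \<boxtimes> C) M f" and g: "linear_map K ((A \<boxtimes> B) \<boxtimes> C) M g"
    and eq: "\<And>a b c. \<lbrakk>a \<in> carrier A; b \<in> carrier B; c \<in> carrier C\<rbrakk>
      \<Longrightarrow> f (pure (A \<boxtimes> B) C (pure A B a b) c) = g (pure (A \<boxtimes> B) C (pure A B a b) c)"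
    and x: "x \<in> carrier ((A \<boxtimes> B) \<boxtimes> C)"
  shows "f x = g x"
proof (rule ndi_linear_eqI[OF ndi_tensor_module[OF m(1,2)] m(3) f g _ x])
  fix y c assume y: "y \<in> carrier (A \<boxtimes> B)" and c: "c \<in> carrier C"
  note p = bilinear_map_left[OF pure_bilinear[OF ndi_tensor_module[OF m(1,2)] m(3)] c]
  show "f (pure (A \<boxtimes> B) C y c) = g (pure (A \<boxtimes> B) C y c)"
    by (rule ndi_linear_eqI[OF m(1,2) linear_map_compose[OF p f] linear_map_compose[OF p g] _ y]) (rule eq[OF _ _ c])
qed

lemma ndi_linear_eqI3':
  assumes m: "module K A" "module K B" "module K C"
    and f: "linear_map K (A \<boxtimes> (B \<boxtimes> C)) M f" and g: "linear_map K (A \<boxtimes> (B \<boxtimes> C)) M g"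
    and eq: "\<And>a b c. \<lbrakk>a \<in> carrier A; b \<in> carrier B; c \<in> carrier C\<rbrakk>
      \<Longrightarrow> f (pure A (B \<boxtimes> C) a (pure B C b c)) = g (pure A (B \<boxtimes> C) a (pure B C b c))"
    and x: "x \<in> carrier (A \<boxtimes> (B \<boxtimes> C))"
  shows "f x = g x"
proof (rule ndi_linear_eqI[OF m(1) ndi_tensor_module[OF m(2,3)] f g _ x])
  fix a y assume y: "y \<in> carrier (B \<boxtimes> C)" and a: "a \<in> carrier A"
  note p = bilinear_map_right[OF pure_bilinear[OF m(1) ndi_tensor_module[OF m(2,3)]] a]
  show "f (pure A (B \<boxtimes> C) a y) = g (pure A (B \<boxtimes> C) a y)"
    by (rule ndi_linear_eqI[OF m(2,3) linear_map_compose[OF p f] linear_map_compose[OF p g] _ y]) (rule eq[OF a])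
qed

lemma ndi_linear_eqI4:
  assumes m: "module K A" "module K B" "module K C" "module K D"
    and f: "linear_map K (((A \<boxtimes> B) \<boxtimes> C) \<boxtimes> D) M f" and g: "linear_map K (((A \<boxtimes> B) \<boxtimes> C) \<boxtimes> D) M g"
    and eq: "\<And>a b c d. \<lbrakk>a \<in> carrier A; b \<in> carrier B; c \<in> carrier C; d \<in> carrier D\<rbrakk>
      \<Longrightarrow> f (pure ((A \<boxtimes> B) \<boxtimes> C) D (pure (A \<boxtimes> B) C (pure A B a b) c) d)
        = g (pure ((A \<boxtimes> B) \<boxtimes> C) D (pure (A \<boxtimes> B) C (pure A B a b) c) d)"
    and x: "x \<in> carrier (((A \<boxtimes> B) \<boxtimes> C) \<boxtimes> D)"
  shows "f x = g x"
proof (rule ndi_linear_eqI3[OF ndi_tensor_module[OF m(1,2)] m(3,4) f g _ x])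
  fix y c d assume y: "y \<in> carrier (A \<boxtimes> B)" and c: "c \<in> carrier C" and d: "d \<in> carrier D"
  note AB = ndi_tensor_module[OF m(1,2)]
  note p = linear_map_compose[OF bilinear_map_left[OF pure_bilinear[OF AB m(3)] c]
      bilinear_map_left[OF pure_bilinear[OF ndi_tensor_module[OF AB m(3)] m(4)] d]]
  show "f (pure ((A \<boxtimes> B) \<boxtimes> C) D (pure (A \<boxtimes> B) C y c) d) = g (pure ((A \<boxtimes> B) \<boxtimes> C) D (pure (A \<boxtimes> B) C y c) d)"
    by (rule ndi_linear_eqI[OF m(1,2) linear_map_compose[OF p f] linear_map_compose[OF p g] _ y])
      (rule eq[OF _ _ c d])
qed

lemma ndi_bilinear_eqI3:
  assumes m: "module K A" "module K B" "module K C" and m': "module K A'" "module K B'" "module K C'"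
    and f: "bilinear_map K ((A \<boxtimes> B) \<boxtimes> C) ((A' \<boxtimes> B') \<boxtimes> C') M f"
    and g: "bilinear_map K ((A \<boxtimes> B) \<boxtimes> C) ((A' \<boxtimes> B') \<boxtimes> C') M g"
    and eq: "\<And>a b c a' b' c'. \<lbrakk>a \<in> carrier A; b \<in> carrier B; c \<in> carrier C;
        a' \<in> carrier A'; b' \<in> carrier B'; c' \<in> carrier C'\<rbrakk>
      \<Longrightarrow> f (pure (A \<boxtimes> B) C (pure A B a b) c) (pure (A' \<boxtimes> B') C' (pure A' B' a' b') c')
        = g (pure (A \<boxtimes> B) C (pure A B a b) c) (pure (A' \<boxtimes> B') C' (pure A' B' a' b') c')"
    and x: "x \<in> carrier ((A \<boxtimes> B) \<boxtimes> C)" and y: "y \<in> carrier ((A' \<boxtimes> B') \<boxtimes> C')"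
  shows "f x y = g x y"
proof (rule ndi_linear_eqI3[OF m bilinear_map_left[OF f y] bilinear_map_left[OF g y] _ x])
  fix a b c assume abc: "a \<in> carrier A" "b \<in> carrier B" "c \<in> carrier C"
  have p: "pure (A \<boxtimes> B) C (pure A B a b) c \<in> carrier ((A \<boxtimes> B) \<boxtimes> C)"
    using abc by (intro pure_closed ndi_tensor_module m)
  show "f (pure (A \<boxtimes> B) C (pure A B a b) c) y = g (pure (A \<boxtimes> B) C (pure A B a b) c) y"
    by (rule ndi_linear_eqI3[OF m' bilinear_map_right[OF f p] bilinear_map_right[OF g p] _ y]) (rule eq[OF abc])
qed

lemma ndi_lift_bilinear:
  assumes m: "module K A" "module K B" "module K C" "module K M"
    and h: "\<And>c. c \<in> carrier C \<Longrightarrow> bilinear_map K A B M (h c)"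
    and h': "\<And>a b. \<lbrakk>a \<in> carrier A; b \<in> carrier B\<rbrakk> \<Longrightarrow> linear_map K C M (\<lambda>c. h c a b)"
  shows "bilinear_map K (A \<boxtimes> B) C M (\<lambda>x c. ndi_lift K A B M (h c) x)"
proof -
  interpret X: module_pair K A B using m by (simp add: module_pair_def)
  show ?thesis
    unfolding ndi_lift_def
    using bilinear_map_compose[OF tensor_lift_bilinear[OF m h h']
        of_univ_linear[OF refl inj_on_to_univ_tensor[OF m(1,2)] X.tensor_module] linear_map_id linear_map_id]
    unfolding ndi_tensor_def .
qed

section \<open>Associativity and unit constraints\<close>

definition assoc_map :: "('k, 'u) module \<Rightarrow> ('k, 'u) module \<Rightarrow> ('k, 'u) module \<Rightarrow> 'u \<Rightarrow> 'u" where
  "assoc_map A B C = ndi_lift K (A \<boxtimes> B) C (A \<boxtimes> (B \<boxtimes> C))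
    (\<lambda>x c. ndi_lift K A B (A \<boxtimes> (B \<boxtimes> C)) (\<lambda>a b. pure A (B \<boxtimes> C) a (pure B C b c)) x)"

definition assoc_map_inv :: "('k, 'u) module \<Rightarrow> ('k, 'u) module \<Rightarrow> ('k, 'u) module \<Rightarrow> 'u \<Rightarrow> 'u" where
  "assoc_map_inv A B C = ndi_lift K A (B \<boxtimes> C) ((A \<boxtimes> B) \<boxtimes> C)
    (\<lambda>a y. ndi_lift K B C ((A \<boxtimes> B) \<boxtimes> C) (\<lambda>b c. pure (A \<boxtimes> B) C (pure A B a b) c) y)"

lemma
  assumes m: "module K A" "module K B" "module K C"
  shows assoc_map_linear: "linear_map K ((A \<boxtimes> B) \<boxtimes> C) (A \<boxtimes> (B \<boxtimes> C)) (assoc_map A B C)"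
    and assoc_map_pure: "\<lbrakk>a \<in> carrier A; b \<in> carrier B; c \<in> carrier C\<rbrakk>
      \<Longrightarrow> assoc_map A B C (pure (A \<boxtimes> B) C (pure A B a b) c) = pure A (B \<boxtimes> C) a (pure B C b c)"
proof -
  note AB = ndi_tensor_module[OF m(1,2)] and BC = ndi_tensor_module[OF m(2,3)]
  note R = ndi_tensor_module[OF m(1) BC]
  note p = pure_bilinear[OF m(1) BC] and q = pure_bilinear[OF m(2,3)]
  have h: "bilinear_map K A B (A \<boxtimes> (B \<boxtimes> C)) (\<lambda>a b. pure A (B \<boxtimes> C) a (pure B C b c))" if "c \<in> carrier C" for c
    using bilinear_map_compose[OF p linear_map_id bilinear_map_left[OF q that] linear_map_id] .
  have h': "linear_map K C (A \<boxtimes> (B \<boxtimes> C)) (\<lambda>c. pure A (B \<boxtimes> C) a (pure B C b c))"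
    if "a \<in> carrier A" "b \<in> carrier B" for a b
    using linear_map_compose[OF bilinear_map_right[OF q that(2)] bilinear_map_right[OF p that(1)]] .
  note bil = ndi_lift_bilinear[OF m R h h']
  show "linear_map K ((A \<boxtimes> B) \<boxtimes> C) (A \<boxtimes> (B \<boxtimes> C)) (assoc_map A B C)"
    unfolding assoc_map_def by (rule ndi_lift_linear[OF AB m(3) R bil])
  show "assoc_map A B C (pure (A \<boxtimes> B) C (pure A B a b) c) = pure A (B \<boxtimes> C) a (pure B C b c)"
    if "a \<in> carrier A" "b \<in> carrier B" "c \<in> carrier C"
    unfolding assoc_map_def
    by (simp add: ndi_lift_pure[OF AB m(3) R bil] ndi_lift_pure[OF m(1,2) R h] pure_closed[OF m(1,2)] that)
qed

lemma
  assumes m: "module K A" "module K B" "module K C"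
  shows assoc_map_inv_linear: "linear_map K (A \<boxtimes> (B \<boxtimes> C)) ((A \<boxtimes> B) \<boxtimes> C) (assoc_map_inv A B C)"
    and assoc_map_inv_pure: "\<lbrakk>a \<in> carrier A; b \<in> carrier B; c \<in> carrier C\<rbrakk>
      \<Longrightarrow> assoc_map_inv A B C (pure A (B \<boxtimes> C) a (pure B C b c)) = pure (A \<boxtimes> B) C (pure A B a b) c"
proof -
  note AB = ndi_tensor_module[OF m(1,2)] and BC = ndi_tensor_module[OF m(2,3)]
  note R = ndi_tensor_module[OF AB m(3)]
  note p = pure_bilinear[OF AB m(3)] and q = pure_bilinear[OF m(1,2)]
  have h: "bilinear_map K B C ((A \<boxtimes> B) \<boxtimes> C) (\<lambda>b c. pure (A \<boxtimes> B) C (pure A B a b) c)" if "a \<in> carrier A" for a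
    using bilinear_map_compose[OF p bilinear_map_right[OF q that] linear_map_id linear_map_id] .
  have h': "linear_map K A ((A \<boxtimes> B) \<boxtimes> C) (\<lambda>a. pure (A \<boxtimes> B) C (pure A B a b) c)"
    if "b \<in> carrier B" "c \<in> carrier C" for b c
    using linear_map_compose[OF bilinear_map_left[OF q that(1)] bilinear_map_left[OF p that(2)]] .
  note bil = bilinear_map_flip[OF ndi_lift_bilinear[OF m(2,3,1) R h h']]
  show "linear_map K (A \<boxtimes> (B \<boxtimes> C)) ((A \<boxtimes> B) \<boxtimes> C) (assoc_map_inv A B C)"
    unfolding assoc_map_inv_def by (rule ndi_lift_linear[OF m(1) BC R bil])
  show "assoc_map_inv A B C (pure A (B \<boxtimes> C) a (pure B C b c)) = pure (A \<boxtimes> B) C (pure A B a b) c"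
    if "a \<in> carrier A" "b \<in> carrier B" "c \<in> carrier C"
    unfolding assoc_map_inv_def
    by (simp add: ndi_lift_pure[OF m(1) BC R bil] ndi_lift_pure[OF m(2,3) R h] pure_closed[OF m(2,3)] that)
qed

lemma assoc_map_iso:
  fixes A B C :: "('k, 'u) module"
  assumes o: "A \<in> ndi_Ob K" "B \<in> ndi_Ob K" "C \<in> ndi_Ob K"
  shows "algebra_iso K ((A \<boxtimes> B) \<boxtimes> C) (A \<boxtimes> (B \<boxtimes> C)) (assoc_map A B C)"
proof -
  note m = o[THEN ndi_Ob_module] and mm = o[THEN ndi_Ob_mult]
  note \<alpha> = assoc_map_linear[OF m] and \<beta> = assoc_map_inv_linear[OF m]
  note v = assoc_map_pure[OF m] assoc_map_inv_pure[OF m]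
  note tO = tensor_in_Ob
  show ?thesis
  proof (rule algebra_isoI[OF \<alpha> \<beta>])
    show "assoc_map_inv A B C (assoc_map A B C x) = x" if "x \<in> carrier ((A \<boxtimes> B) \<boxtimes> C)" for x
      by (rule ndi_linear_eqI3[OF m linear_map_compose[OF \<alpha> \<beta>] linear_map_id _ that]) (simp add: v)
    show "assoc_map A B C (assoc_map_inv A B C x) = x" if "x \<in> carrier (A \<boxtimes> (B \<boxtimes> C))" for x
      by (rule ndi_linear_eqI3'[OF m linear_map_compose[OF \<beta> \<alpha>] linear_map_id _ that]) (simp add: v)
    note ml = tensor_mult_bilinear[OF tO[OF o(1,2)] o(3)] and mr = tensor_mult_bilinear[OF o(1) tO[OF o(2,3)]]
    show "assoc_map A B C (x \<otimes>\<^bsub>(A \<boxtimes> B) \<boxtimes> C\<^esub> y) = assoc_map A B C x \<otimes>\<^bsub>A \<boxtimes> (B \<boxtimes> C)\<^esub> assoc_map A B C y"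
      if "x \<in> carrier ((A \<boxtimes> B) \<boxtimes> C)" "y \<in> carrier ((A \<boxtimes> B) \<boxtimes> C)" for x y
      by (rule ndi_bilinear_eqI3[OF m m bilinear_map_compose[OF ml linear_map_id linear_map_id \<alpha>]
            bilinear_map_compose[OF mr \<alpha> \<alpha> linear_map_id] _ that])
        (simp add: v tensor_mult_pure[OF tO[OF o(1,2)] o(3)] tensor_mult_pure[OF o(1) tO[OF o(2,3)]]
          tensor_mult_pure[OF o(1,2)] tensor_mult_pure[OF o(2,3)] pure_closed[OF m(1,2)] pure_closed[OF m(2,3)]
          bilinear_map_closed[OF mm(1)] bilinear_map_closed[OF mm(2)] bilinear_map_closed[OF mm(3)])
  qed
qed

lemma ndi_assoc_eq: "ndi_assoc K A B C = extension_of_map ((A \<boxtimes> B) \<boxtimes> C) (A \<boxtimes> (B \<boxtimes> C)) (assoc_map A B C)"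
  by (simp add: ndi_assoc_def assoc_map_def Let_def)

definition lunit_map :: "('k, 'u) module \<Rightarrow> 'u \<Rightarrow> 'u" where
  "lunit_map A = ndi_lift K \<I> A A (\<lambda>r a. scalar r \<odot>\<^bsub>A\<^esub> a)"

definition runit_map :: "('k, 'u) module \<Rightarrow> 'u \<Rightarrow> 'u" where
  "runit_map A = ndi_lift K A \<I> A (\<lambda>a r. scalar r \<odot>\<^bsub>A\<^esub> a)"

lemma
  assumes m: "module K A"
  shows lunit_map_linear: "linear_map K (\<I> \<boxtimes> A) A (lunit_map A)"
    and lunit_map_pure: "\<lbrakk>r \<in> carrier \<I>; a \<in> carrier A\<rbrakk> \<Longrightarrow> lunit_map A (pure \<I> A r a) = scalar r \<odot>\<^bsub>A\<^esub> a"
    and runit_map_linear: "linear_map K (A \<boxtimes> \<I>) A (runit_map A)"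
    and runit_map_pure: "\<lbrakk>r \<in> carrier \<I>; a \<in> carrier A\<rbrakk> \<Longrightarrow> runit_map A (pure A \<I> a r) = scalar r \<odot>\<^bsub>A\<^esub> a"
proof -
  note h = bilinear_map_compose[OF bilinear_map_smult[OF m] scalar_linear linear_map_id linear_map_id]
  show "linear_map K (\<I> \<boxtimes> A) A (lunit_map A)"
    unfolding lunit_map_def by (rule ndi_lift_linear[OF unit_module m m h])
  show "lunit_map A (pure \<I> A r a) = scalar r \<odot>\<^bsub>A\<^esub> a" if "r \<in> carrier \<I>" "a \<in> carrier A"
    unfolding lunit_map_def by (rule ndi_lift_pure[OF unit_module m m h that])
  show "linear_map K (A \<boxtimes> \<I>) A (runit_map A)"
    unfolding runit_map_def by (rule ndi_lift_linear[OF m unit_module m bilinear_map_flip[OF h]])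
  show "runit_map A (pure A \<I> a r) = scalar r \<odot>\<^bsub>A\<^esub> a" if "r \<in> carrier \<I>" "a \<in> carrier A"
    unfolding runit_map_def by (rule ndi_lift_pure[OF m unit_module m bilinear_map_flip[OF h] that(2,1)])
qed

lemma
  fixes A :: "('k, 'u) module"
  assumes A: "A \<in> ndi_Ob K"
  shows lunit_map_iso: "algebra_iso K (\<I> \<boxtimes> A) A (lunit_map A)"
    and runit_map_iso: "algebra_iso K (A \<boxtimes> \<I>) A (runit_map A)"
proof -
  note m = ndi_Ob_module[OF A] and mm = ndi_Ob_mult[OF A]
  interpret A: module K A by (rule m)
  note l = lunit_map_linear[OF m] and r = runit_map_linear[OF m]
  note bl = pure_bilinear[OF unit_module m] and br = pure_bilinear[OF m unit_module]
  note u = unit_elem_closed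
  note il = bilinear_map_right[OF bl u] and ir = bilinear_map_left[OF br u]
  note v = lunit_map_pure[OF m] runit_map_pure[OF m]
  have mult: "(scalar r \<odot>\<^bsub>A\<^esub> a) \<otimes>\<^bsub>A\<^esub> (scalar s \<odot>\<^bsub>A\<^esub> b) = scalar (r \<otimes>\<^bsub>\<I>\<^esub> s) \<odot>\<^bsub>A\<^esub> (a \<otimes>\<^bsub>A\<^esub> b)"
    if "r \<in> carrier \<I>" "s \<in> carrier \<I>" "a \<in> carrier A" "b \<in> carrier A" for r s a b
    using that by (simp add: scalar_mult scalar_closed bilinear_map_smult_left[OF mm] bilinear_map_smult_right[OF mm]
        bilinear_map_closed[OF mm] A.smult_assoc1[symmetric] A.R.m_comm)
  have move: "pure \<I> A unit_elem (scalar r \<odot>\<^bsub>A\<^esub> a) = pure \<I> A r a"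
    "pure A \<I> (scalar r \<odot>\<^bsub>A\<^esub> a) unit_elem = pure A \<I> a r" if "r \<in> carrier \<I>" "a \<in> carrier A" for r a
  proof -
    have "pure \<I> A unit_elem (scalar r \<odot>\<^bsub>A\<^esub> a) = pure \<I> A (scalar r \<odot>\<^bsub>\<I>\<^esub> unit_elem) a"
      using that u by (simp add: bilinear_map_smult_left[OF bl] bilinear_map_smult_right[OF bl] scalar_closed)
    then show "pure \<I> A unit_elem (scalar r \<odot>\<^bsub>A\<^esub> a) = pure \<I> A r a"
      using that by (simp add: scalar_smult_unit_elem)
    have "pure A \<I> (scalar r \<odot>\<^bsub>A\<^esub> a) unit_elem = pure A \<I> a (scalar r \<odot>\<^bsub>\<I>\<^esub> unit_elem)"
      using that u by (simp add: bilinear_map_smult_left[OF br] bilinear_map_smult_right[OF br] scalar_closed)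
    then show "pure A \<I> (scalar r \<odot>\<^bsub>A\<^esub> a) unit_elem = pure A \<I> a r"
      using that by (simp add: scalar_smult_unit_elem)
  qed
  show "algebra_iso K (\<I> \<boxtimes> A) A (lunit_map A)"
  proof (rule algebra_isoI[OF l il])
    show "pure \<I> A unit_elem (lunit_map A x) = x" if "x \<in> carrier (\<I> \<boxtimes> A)" for x
      by (rule ndi_linear_eqI[OF unit_module m linear_map_compose[OF l il] linear_map_id _ that]) (simp add: v move)
    show "lunit_map A (pure \<I> A unit_elem a) = a" if "a \<in> carrier A" for a
      using that u by (simp add: v scalar_unit_elem)
    show "lunit_map A (x \<otimes>\<^bsub>\<I> \<boxtimes> A\<^esub> y) = lunit_map A x \<otimes>\<^bsub>A\<^esub> lunit_map A y"
      if "x \<in> carrier (\<I> \<boxtimes> A)" "y \<in> carrier (\<I> \<boxtimes> A)" for x y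
      by (rule ndi_bilinear_eqI[OF unit_module m unit_module m
            bilinear_map_compose[OF tensor_mult_bilinear[OF unit_in_Ob A] linear_map_id linear_map_id l]
            bilinear_map_compose[OF mm l l linear_map_id] _ that])
        (simp add: v mult tensor_mult_pure[OF unit_in_Ob A] bilinear_map_closed[OF mm] bilinear_map_closed[OF unit_mult_bilinear])
  qed
  show "algebra_iso K (A \<boxtimes> \<I>) A (runit_map A)"
  proof (rule algebra_isoI[OF r ir])
    show "pure A \<I> (runit_map A x) unit_elem = x" if "x \<in> carrier (A \<boxtimes> \<I>)" for x
      by (rule ndi_linear_eqI[OF m unit_module linear_map_compose[OF r ir] linear_map_id _ that]) (simp add: v move)
    show "runit_map A (pure A \<I> a unit_elem) = a" if "a \<in> carrier A" for a
      using that u by (simp add: v scalar_unit_elem)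
    show "runit_map A (x \<otimes>\<^bsub>A \<boxtimes> \<I>\<^esub> y) = runit_map A x \<otimes>\<^bsub>A\<^esub> runit_map A y"
      if "x \<in> carrier (A \<boxtimes> \<I>)" "y \<in> carrier (A \<boxtimes> \<I>)" for x y
      by (rule ndi_bilinear_eqI[OF m unit_module m unit_module
            bilinear_map_compose[OF tensor_mult_bilinear[OF A unit_in_Ob] linear_map_id linear_map_id r]
            bilinear_map_compose[OF mm r r linear_map_id] _ that])
        (simp add: v mult tensor_mult_pure[OF A unit_in_Ob] bilinear_map_closed[OF mm] bilinear_map_closed[OF unit_mult_bilinear])
  qed
qed

lemma ndi_lunit_eq: "ndi_lunit K A = extension_of_map (\<I> \<boxtimes> A) A (lunit_map A)"
  by (simp add: ndi_lunit_def lunit_map_def)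

lemma ndi_runit_eq: "ndi_runit K A = extension_of_map (A \<boxtimes> \<I>) A (runit_map A)"
  by (simp add: ndi_runit_def runit_map_def)

lemma tensor_map_iso:
  fixes A B A' B' :: "('k, 'u) module"
  assumes o: "A \<in> ndi_Ob K" "B \<in> ndi_Ob K" "A' \<in> ndi_Ob K" "B' \<in> ndi_Ob K"
    and \<phi>: "algebra_iso K B A \<phi>" and \<phi>': "algebra_iso K B' A' \<phi>'"
  shows "algebra_iso K (B \<boxtimes> B') (A \<boxtimes> A') (tensor_map B B' A A' \<phi> \<phi>')"
proof -
  note m = o[THEN ndi_Ob_module] and mm = o[THEN ndi_Ob_mult]
  obtain \<psi> where \<psi>: "algebra_iso K A B \<psi>" "\<And>x. x \<in> carrier B \<Longrightarrow> \<psi> (\<phi> x) = x" "\<And>y. y \<in> carrier A \<Longrightarrow> \<phi> (\<psi> y) = y"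
    by (rule algebra_iso_inverse[OF \<phi> m(2) mm(2) m(1) mm(1)]) blast
  obtain \<psi>' where \<psi>': "algebra_iso K A' B' \<psi>'" "\<And>x. x \<in> carrier B' \<Longrightarrow> \<psi>' (\<phi>' x) = x"
      "\<And>y. y \<in> carrier A' \<Longrightarrow> \<phi>' (\<psi>' y) = y"
    by (rule algebra_iso_inverse[OF \<phi>' m(4) mm(4) m(3) mm(3)]) blast
  note l = algebra_iso_linear[OF \<phi>] algebra_iso_linear[OF \<phi>']
  note k = algebra_iso_linear[OF \<psi>(1)] algebra_iso_linear[OF \<psi>'(1)]
  note L = tensor_map_linear[OF m(2,4,1,3) l] and R = tensor_map_linear[OF m(1,3,2,4) k]
  note v = tensor_map_pure[OF m(2,4,1,3) l] tensor_map_pure[OF m(1,3,2,4) k]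
    linear_map_closed[OF l(1)] linear_map_closed[OF l(2)] linear_map_closed[OF k(1)] linear_map_closed[OF k(2)]
  show ?thesis
  proof (rule algebra_isoI[OF L R])
    show "tensor_map A A' B B' \<psi> \<psi>' (tensor_map B B' A A' \<phi> \<phi>' x) = x" if "x \<in> carrier (B \<boxtimes> B')" for x
      by (rule ndi_linear_eqI[OF m(2,4) linear_map_compose[OF L R] linear_map_id _ that]) (simp add: v \<psi> \<psi>')
    show "tensor_map B B' A A' \<phi> \<phi>' (tensor_map A A' B B' \<psi> \<psi>' x) = x" if "x \<in> carrier (A \<boxtimes> A')" for x
      by (rule ndi_linear_eqI[OF m(1,3) linear_map_compose[OF R L] linear_map_id _ that]) (simp add: v \<psi> \<psi>')
    show "tensor_map B B' A A' \<phi> \<phi>' (x \<otimes>\<^bsub>B \<boxtimes> B'\<^esub> y)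
        = tensor_map B B' A A' \<phi> \<phi>' x \<otimes>\<^bsub>A \<boxtimes> A'\<^esub> tensor_map B B' A A' \<phi> \<phi>' y"
      if "x \<in> carrier (B \<boxtimes> B')" "y \<in> carrier (B \<boxtimes> B')" for x y
      by (rule ndi_bilinear_eqI[OF m(2,4) m(2,4)
            bilinear_map_compose[OF tensor_mult_bilinear[OF o(2,4)] linear_map_id linear_map_id L]
            bilinear_map_compose[OF tensor_mult_bilinear[OF o(1,3)] L L linear_map_id] _ that])
        (simp add: v tensor_mult_pure[OF o(2,4)] tensor_mult_pure[OF o(1,3)] bilinear_map_closed[OF mm(2)]
          bilinear_map_closed[OF mm(4)] algebra_iso_mult[OF \<phi>] algebra_iso_mult[OF \<phi>'])
  qed
qed

text \<open>On pure tensors, $(\varphi(b) \otimes \varphi'(b'))(a \otimes a') = \varphi(b) a \otimes \varphi'(b') a'$.\<close>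

lemma tensor_Hom_extension_of_map:
  fixes A B A' B' :: "('k, 'u) module"
  assumes o: "A \<in> ndi_Ob K" "B \<in> ndi_Ob K" "A' \<in> ndi_Ob K" "B' \<in> ndi_Ob K"
    and \<phi>: "algebra_iso K B A \<phi>" and \<phi>': "algebra_iso K B' A' \<phi>'"
  shows "ndi_tensor_Hom K (extension_of_map B A \<phi>) (extension_of_map B' A' \<phi>')
    = extension_of_map (B \<boxtimes> B') (A \<boxtimes> A') (tensor_map B B' A A' \<phi> \<phi>')"
proof (rule ndi_Hom_eqI[OF tensor_in_Ob[OF o(1,3)]])
  note m = o[THEN ndi_Ob_module]
  note e = extension_of_map_in_Hom[OF o(2,1) \<phi>] extension_of_map_in_Hom[OF o(4,3) \<phi>']
  note l = algebra_iso_linear[OF \<phi>] algebra_iso_linear[OF \<phi>']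
  note L = tensor_map_linear[OF m(2,4,1,3) l]
  show t: "ndi_tensor_Hom K (extension_of_map B A \<phi>) (extension_of_map B' A' \<phi>') \<in> ndi_Hom K (B \<boxtimes> B') (A \<boxtimes> A')"
    by (rule tensor_Hom_in_Hom[OF o e])
  show t': "extension_of_map (B \<boxtimes> B') (A \<boxtimes> A') (tensor_map B B' A A' \<phi> \<phi>') \<in> ndi_Hom K (B \<boxtimes> B') (A \<boxtimes> A')"
    by (rule extension_of_map_in_Hom[OF tensor_in_Ob[OF o(2,4)] tensor_in_Ob[OF o(1,3)] tensor_map_iso[OF o \<phi> \<phi>']])
  show "lact (ndi_tensor_Hom K (extension_of_map B A \<phi>) (extension_of_map B' A' \<phi>')) x y
      = lact (extension_of_map (B \<boxtimes> B') (A \<boxtimes> A') (tensor_map B B' A A' \<phi> \<phi>')) x y"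
    if "x \<in> carrier (B \<boxtimes> B')" "y \<in> carrier (A \<boxtimes> A')" for x y
    by (rule ndi_bilinear_eqI[OF m(2,4,1,3) lact_bilinear[OF t] lact_bilinear[OF t'] _ that])
      (simp add: lact_tensor_Hom_pure[OF o e] lact_extension_of_map pure_closed[OF m(2,4)] pure_closed[OF m(1,3)]
        tensor_map_pure[OF m(2,4,1,3) l] tensor_mult_pure[OF o(1,3)] linear_map_closed[OF l(1)] linear_map_closed[OF l(2)])
qed

section \<open>Naturality and coherence\<close>

lemma tensor_map_id:
  assumes m: "module K A" "module K B" and "x \<in> carrier (A \<boxtimes> B)"
  shows "tensor_map A B A B (\<lambda>a. a) (\<lambda>b. b) x = x"
  by (rule ndi_linear_eqI[OF m tensor_map_linear[OF m m linear_map_id linear_map_id] linear_map_id _ assms(3)])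
    (simp add: tensor_map_pure[OF m m linear_map_id linear_map_id])

lemma tensor_Hom_Id:
  fixes A B :: "('k, 'u) module"
  assumes o: "A \<in> ndi_Ob K" "B \<in> ndi_Ob K"
  shows "ndi_tensor_Hom K (ndi_Id A) (ndi_Id B) = ndi_Id (A \<boxtimes> B)"
  unfolding extension_of_map_id[symmetric] tensor_Hom_extension_of_map[OF o(1,1) o(2,2) algebra_iso_id algebra_iso_id]
  by (rule extension_of_map_cong) (rule tensor_map_id[OF o[THEN ndi_Ob_module]])

lemma assoc_natural:
  fixes A B C A' B' C' :: "('k, 'u) module"
  assumes o: "A \<in> ndi_Ob K" "B \<in> ndi_Ob K" "C \<in> ndi_Ob K" "A' \<in> ndi_Ob K" "B' \<in> ndi_Ob K" "C' \<in> ndi_Ob K"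
    and f: "f \<in> ndi_Hom K A A'" and g: "g \<in> ndi_Hom K B B'" and h: "h \<in> ndi_Hom K C C'"
  shows "ndi_Comp (ndi_assoc K A' B' C') (ndi_tensor_Hom K (ndi_tensor_Hom K f g) h)
    = ndi_Comp (ndi_tensor_Hom K f (ndi_tensor_Hom K g h)) (ndi_assoc K A B C)"
proof -
  note m = o[THEN ndi_Ob_module]
  note T = tensor_in_Ob
  note fg = tensor_Hom_in_Hom[OF o(4,1,5,2) f g] and gh = tensor_Hom_in_Hom[OF o(5,2,6,3) g h]
  note l = tensor_Hom_in_Hom[OF T[OF o(4,5)] T[OF o(1,2)] o(6,3) fg h]
  note r = tensor_Hom_in_Hom[OF o(4,1) T[OF o(5,6)] T[OF o(2,3)] f gh]
  note \<alpha> = assoc_map_iso[OF o(1-3)] and \<beta> = assoc_map_iso[OF o(4-6)]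
  note c = bilinear_map_closed[OF lact_bilinear[OF f]] bilinear_map_closed[OF lact_bilinear[OF g]]
    bilinear_map_closed[OF lact_bilinear[OF h]]
  show ?thesis
    unfolding ndi_assoc_eq
  proof (rule ndi_Comp_extension_of_map_square[OF T[OF T[OF o(1,2)] o(3)] T[OF o(1) T[OF o(2,3)]]
        T[OF T[OF o(4,5)] o(6)] T[OF o(4) T[OF o(5,6)]] \<alpha> \<beta> l r])
    fix x y assume xy: "x \<in> carrier ((A \<boxtimes> B) \<boxtimes> C)" "y \<in> carrier ((A' \<boxtimes> B') \<boxtimes> C')"
    show "assoc_map A' B' C' (lact (ndi_tensor_Hom K (ndi_tensor_Hom K f g) h) x y)
        = lact (ndi_tensor_Hom K f (ndi_tensor_Hom K g h)) (assoc_map A B C x) (assoc_map A' B' C' y)"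
      by (rule ndi_bilinear_eqI3[OF m bilinear_map_compose[OF lact_bilinear[OF l] linear_map_id linear_map_id
              algebra_iso_linear[OF \<beta>]]
            bilinear_map_compose[OF lact_bilinear[OF r] algebra_iso_linear[OF \<alpha>] algebra_iso_linear[OF \<beta>] linear_map_id] _ xy])
        (simp add: lact_tensor_Hom_pure[OF T[OF o(4,5)] T[OF o(1,2)] o(6,3) fg h] lact_tensor_Hom_pure[OF o(4,1,5,2) f g]
          lact_tensor_Hom_pure[OF o(4,1) T[OF o(5,6)] T[OF o(2,3)] f gh] lact_tensor_Hom_pure[OF o(5,2,6,3) g h]
          pure_closed m assoc_map_pure c)
  qed
qed

lemma
  fixes A B :: "('k, 'u) module"
  assumes o: "A \<in> ndi_Ob K" "B \<in> ndi_Ob K" and f: "f \<in> ndi_Hom K A B"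
  shows lunit_natural: "ndi_Comp (ndi_lunit K B) (ndi_tensor_Hom K (ndi_Id \<I>) f) = ndi_Comp f (ndi_lunit K A)"
    and runit_natural: "ndi_Comp (ndi_runit K B) (ndi_tensor_Hom K f (ndi_Id \<I>)) = ndi_Comp f (ndi_runit K A)"
proof -
  note m = o[THEN ndi_Ob_module]
  interpret B: module K B by (rule m(2))
  note T = tensor_in_Ob and u = unit_in_Ob
  note i = ndi_Id_in_Hom[OF unit_in_Ob]
  note l = tensor_Hom_in_Hom[OF u u o(2,1) i f] and r = tensor_Hom_in_Hom[OF o(2,1) u u f i]
  note fb = lact_bilinear[OF f]
  note simps = bilinear_map_closed[OF fb] bilinear_map_smult_left[OF fb] bilinear_map_smult_right[OF fb]
    scalar_closed scalar_mult lact_ndi_Id B.smult_assoc1 bilinear_map_closed[OF unit_mult_bilinear]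
  show "ndi_Comp (ndi_lunit K B) (ndi_tensor_Hom K (ndi_Id \<I>) f) = ndi_Comp f (ndi_lunit K A)"
    unfolding ndi_lunit_eq
  proof (rule ndi_Comp_extension_of_map_square[OF T[OF u o(1)] o(1) T[OF u o(2)] o(2) lunit_map_iso[OF o(1)]
        lunit_map_iso[OF o(2)] l f])
    fix x y assume xy: "x \<in> carrier (\<I> \<boxtimes> A)" "y \<in> carrier (\<I> \<boxtimes> B)"
    show "lunit_map B (lact (ndi_tensor_Hom K (ndi_Id \<I>) f) x y) = lact f (lunit_map A x) (lunit_map B y)"
      by (rule ndi_bilinear_eqI[OF unit_module m(1) unit_module m(2) bilinear_map_compose[OF lact_bilinear[OF l]
              linear_map_id linear_map_id lunit_map_linear[OF m(2)]]
            bilinear_map_compose[OF fb lunit_map_linear[OF m(1)] lunit_map_linear[OF m(2)] linear_map_id] _ xy])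
        (simp add: lact_tensor_Hom_pure[OF u u o(2,1) i f] lunit_map_pure m simps)
  qed
  show "ndi_Comp (ndi_runit K B) (ndi_tensor_Hom K f (ndi_Id \<I>)) = ndi_Comp f (ndi_runit K A)"
    unfolding ndi_runit_eq
  proof (rule ndi_Comp_extension_of_map_square[OF T[OF o(1) u] o(1) T[OF o(2) u] o(2) runit_map_iso[OF o(1)]
        runit_map_iso[OF o(2)] r f])
    fix x y assume xy: "x \<in> carrier (A \<boxtimes> \<I>)" "y \<in> carrier (B \<boxtimes> \<I>)"
    show "runit_map B (lact (ndi_tensor_Hom K f (ndi_Id \<I>)) x y) = lact f (runit_map A x) (runit_map B y)"
      by (rule ndi_bilinear_eqI[OF m(1) unit_module m(2) unit_module bilinear_map_compose[OF lact_bilinear[OF r]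
              linear_map_id linear_map_id runit_map_linear[OF m(2)]]
            bilinear_map_compose[OF fb runit_map_linear[OF m(1)] runit_map_linear[OF m(2)] linear_map_id] _ xy])
        (simp add: lact_tensor_Hom_pure[OF o(2,1) u u f i] runit_map_pure m simps)
  qed
qed

text \<open>All five morphisms are induced by isomorphisms of algebras, and so are both composites. The maps
underlying the two sides agree because each sends $((a \otimes b) \otimes c) \otimes d$ to
$a \otimes (b \otimes (c \otimes d))$.\<close>

lemma pentagon:
  fixes A B C D :: "('k, 'u) module"
  assumes o: "A \<in> ndi_Ob K" "B \<in> ndi_Ob K" "C \<in> ndi_Ob K" "D \<in> ndi_Ob K"
  shows "ndi_Comp (ndi_tensor_Hom K (ndi_Id A) (ndi_assoc K B C D))
      (ndi_Comp (ndi_assoc K A (B \<boxtimes> C) D) (ndi_tensor_Hom K (ndi_assoc K A B C) (ndi_Id D)))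
    = ndi_Comp (ndi_assoc K A B (C \<boxtimes> D)) (ndi_assoc K (A \<boxtimes> B) C D)"
proof -
  note m = o[THEN ndi_Ob_module]
  note T = tensor_in_Ob and M = ndi_tensor_module and id = algebra_iso_id
  note AB = T[OF o(1,2)] and BC = T[OF o(2,3)] and CD = T[OF o(3,4)]
  note ABC = T[OF AB o(3)] and ABC' = T[OF o(1) BC] and BCD = T[OF BC o(4)] and BCD' = T[OF o(2) CD]
  note s1 = T[OF ABC o(4)] and s2 = T[OF ABC' o(4)] and s3 = T[OF o(1) BCD] and s4 = T[OF o(1) BCD'] and s5 = T[OF AB CD]
  note a1 = tensor_map_iso[OF ABC' ABC o(4,4) assoc_map_iso[OF o(1-3)] id]
  note a2 = assoc_map_iso[OF o(1) BC o(4)]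
  note a3 = tensor_map_iso[OF o(1,1) BCD' BCD id assoc_map_iso[OF o(2-4)]]
  note b1 = assoc_map_iso[OF AB o(3,4)] and b2 = assoc_map_iso[OF o(1,2) CD]
  note lin = algebra_iso_linear
  show ?thesis
    unfolding ndi_assoc_eq extension_of_map_id[symmetric]
      tensor_Hom_extension_of_map[OF ABC' ABC o(4,4) assoc_map_iso[OF o(1-3)] id]
      tensor_Hom_extension_of_map[OF o(1,1) BCD' BCD id assoc_map_iso[OF o(2-4)]]
      ndi_Comp_extension_of_map[OF s1 s2 s3 a1 a2]
      ndi_Comp_extension_of_map[OF s1 s3 s4 algebra_iso_compose[OF a1 a2] a3]
      ndi_Comp_extension_of_map[OF s1 s5 s4 b1 b2]
  proof (rule extension_of_map_cong)
    fix x assume x: "x \<in> carrier (((A \<boxtimes> B) \<boxtimes> C) \<boxtimes> D)"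
    show "tensor_map A ((B \<boxtimes> C) \<boxtimes> D) A (B \<boxtimes> (C \<boxtimes> D)) (\<lambda>x. x) (assoc_map B C D)
        (assoc_map A (B \<boxtimes> C) D
          (tensor_map ((A \<boxtimes> B) \<boxtimes> C) D (A \<boxtimes> (B \<boxtimes> C)) D (assoc_map A B C) (\<lambda>x. x) x))
      = assoc_map A B (C \<boxtimes> D) (assoc_map (A \<boxtimes> B) C D x)"
      by (rule ndi_linear_eqI4[OF m linear_map_compose[OF linear_map_compose[OF lin[OF a1] lin[OF a2]] lin[OF a3]]
            linear_map_compose[OF lin[OF b1] lin[OF b2]] _ x])
        (simp add: tensor_map_pure[OF M[OF M[OF m(1,2)] m(3)] m(4) M[OF m(1) M[OF m(2,3)]] m(4) assoc_map_linear[OF m(1-3)] linear_map_id]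
          tensor_map_pure[OF m(1) M[OF M[OF m(2,3)] m(4)] m(1) M[OF m(2) M[OF m(3,4)]] linear_map_id assoc_map_linear[OF m(2-4)]]
          assoc_map_pure pure_closed M m)
  qed
qed

text \<open>Here both sides send $(a \otimes r) \otimes b$ to $ra \otimes b = a \otimes rb$.\<close>

lemma triangle:
  fixes A B :: "('k, 'u) module"
  assumes o: "A \<in> ndi_Ob K" "B \<in> ndi_Ob K"
  shows "ndi_Comp (ndi_tensor_Hom K (ndi_Id A) (ndi_lunit K B)) (ndi_assoc K A \<I> B)
    = ndi_tensor_Hom K (ndi_runit K A) (ndi_Id B)"
proof -
  note m = o[THEN ndi_Ob_module] and u = unit_in_Ob
  note T = tensor_in_Ob and M = ndi_tensor_module and id = algebra_iso_id
  note AI = T[OF o(1) u] and IB = T[OF u o(2)]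
  note a1 = assoc_map_iso[OF o(1) u o(2)]
  note a2 = tensor_map_iso[OF o(1,1) o(2) IB id lunit_map_iso[OF o(2)]]
  note b = tensor_map_iso[OF o(1) AI o(2,2) runit_map_iso[OF o(1)] id]
  note lin = algebra_iso_linear
  note bil = pure_bilinear[OF m]
  show ?thesis
    unfolding ndi_assoc_eq ndi_lunit_eq ndi_runit_eq extension_of_map_id[symmetric]
      tensor_Hom_extension_of_map[OF o(1,1) o(2) IB id lunit_map_iso[OF o(2)]]
      tensor_Hom_extension_of_map[OF o(1) AI o(2,2) runit_map_iso[OF o(1)] id]
      ndi_Comp_extension_of_map[OF T[OF AI o(2)] T[OF o(1) IB] T[OF o] a1 a2]
  proof (rule extension_of_map_cong)
    fix x assume x: "x \<in> carrier ((A \<boxtimes> \<I>) \<boxtimes> B)"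
    show "tensor_map A (\<I> \<boxtimes> B) A B (\<lambda>x. x) (lunit_map B) (assoc_map A \<I> B x)
        = tensor_map (A \<boxtimes> \<I>) B A B (runit_map A) (\<lambda>x. x) x"
      by (rule ndi_linear_eqI3[OF m(1) unit_module m(2) linear_map_compose[OF lin[OF a1] lin[OF a2]] lin[OF b] _ x])
        (simp add: tensor_map_pure[OF m(1) M[OF unit_module m(2)] m(1,2) linear_map_id lunit_map_linear[OF m(2)]]
          tensor_map_pure[OF M[OF m(1) unit_module] m(2) m(1,2) runit_map_linear[OF m(1)] linear_map_id]
          assoc_map_pure lunit_map_pure runit_map_pure pure_closed m unit_module scalar_closed
          bilinear_map_smult_left[OF bil] bilinear_map_smult_right[OF bil])
  qed
qed

end

theorem proposition1p12:
  fixes K :: "('k, 'm) ring_scheme"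
  assumes "cring K"
    and "infinite (UNIV :: 'u set)"
    and "carrier K \<lesssim> (UNIV :: 'u set)"
  shows "monoidal_category (ndi_Ob K :: ('k, 'u) module set) (ndi_Hom K) ndi_Comp ndi_Id
           (ndi_tensor K) (ndi_tensor_Hom K) (ndi_unit K)
           (ndi_assoc K) (ndi_lunit K) (ndi_runit K)"
proof -
  interpret ndi_universe K "TYPE('u)" using assms by (rule ndi_universe.intro)
  note T = tensor_in_Ob and u = unit_in_Ob
  show ?thesis
  proof (intro monoidal_category.intro monoidal_category_axioms.intro)
    show "category (ndi_Ob K :: ('k, 'u) module set) (ndi_Hom K) ndi_Comp ndi_Id" by (rule ndi_category)
  next
    fix A B C :: "('k, 'u) module"
    assume o: "A \<in> ndi_Ob K" "B \<in> ndi_Ob K" "C \<in> ndi_Ob K"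
    show "category.iso_in (ndi_Hom K) ndi_Comp ndi_Id ((A \<boxtimes> B) \<boxtimes> C) (A \<boxtimes> B \<boxtimes> C) (ndi_assoc K A B C)"
      unfolding ndi_assoc_eq
      by (rule iso_in_extension_of_map[OF T[OF T[OF o(1,2)] o(3)] T[OF o(1) T[OF o(2,3)]] assoc_map_iso[OF o]])
  next
    fix A :: "('k, 'u) module" assume A: "A \<in> ndi_Ob K"
    show "category.iso_in (ndi_Hom K) ndi_Comp ndi_Id (\<I> \<boxtimes> A) A (ndi_lunit K A)"
      unfolding ndi_lunit_eq by (rule iso_in_extension_of_map[OF T[OF u A] A lunit_map_iso[OF A]])
    show "category.iso_in (ndi_Hom K) ndi_Comp ndi_Id (A \<boxtimes> \<I>) A (ndi_runit K A)"
      unfolding ndi_runit_eq by (rule iso_in_extension_of_map[OF T[OF A u] A runit_map_iso[OF A]])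
  next
    fix A B A' B' :: "('k, 'u) module" and f f'
    assume o: "A \<in> ndi_Ob K" "B \<in> ndi_Ob K" "A' \<in> ndi_Ob K" "B' \<in> ndi_Ob K"
      and ff: "f \<in> ndi_Hom K A B" "f' \<in> ndi_Hom K A' B'"
    show "ndi_tensor_Hom K f f' \<in> ndi_Hom K (A \<boxtimes> A') (B \<boxtimes> B')"
      by (rule tensor_Hom_in_Hom[OF o(2,1,4,3) ff])
  qed (rule u T tensor_Hom_Id interchange assoc_natural lunit_natural runit_natural pentagon triangle; assumption)+
qed

end
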